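(* Let $K$ be a field, $l\in\mathbb N$, and let $R=K[X_0,\dots,X_N]/J_0$, where each $X_i$ has a nonzero multidegree in $\mathbb N^l$ and $J_0$ is a proper homogeneous ideal of $K[X_0,\dots,X_N]$. Let $I\subseteq R$ be a homogeneous ideal such that $0=H^2_I(R)=H^3_I(R)=\dots$, i.e. $H^i_I(R)=0$ for all $i\ge2$. Then $$\operatorname{ara}^h(I)\le 1\iff \operatorname{Ass}_R\bigl(({}^*D)(H^1_I(R))\bigr)\text{ satisfies homogeneous prime avoidance}.$$
   Context: $R$ carries the induced $\mathbb N^l$-grading; $\mathfrak m=(X_0,\dots,X_N)R$ is its maximal homogeneous ideal. $H^i_I(R)$ denotes local cohomology of $R$ supported in $I$, with its natural grading. $E:=E_R(R/\mathfrak m)$ is an $R$-injective hull of $R/\mathfrak m$; it has a natural grading and is also a ${}^*$-injective hull of $R/\mathfrak m$, i.e. an injective hull in the category of graded $R$-modules. For graded $R$-modules $M,N$, ${}^*\operatorname{Hom}_R(M,N)\subseteq\operatorname{Hom}_R(M,N)$ is the graded submodule generated (as a group, by direct sum) by the homogeneous $R$-homomorphisms $M\to N$ of all degrees in $\mathbb Z^l$, and $({}^*D)(M):={}^*\operatorname{Hom}_R(M,E)$. The homogeneous arithmetic rank is $\operatorname{ara}^h(I):=\min\{s\in\mathbb N\mid\exists r_1,\dots,r_s\in R\text{ homogeneous}:\ \sqrt I=\sqrt{(r_1,\dots,r_s)R}\}$. For an $R$-module $M$, $\operatorname{Ass}_R(M)$ is the set of prime ideals of the form $\operatorname{ann}_R(m)$,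 $m\in M$; all primes in $\operatorname{Ass}_R(({}^*D)(H^1_I(R)))$ are homogeneous. For a homogeneous ideal $J$, $J^h:=\{r\in J\mid r\text{ homogeneous}\}$. A set $X$ of homogeneous prime ideals of $R$ satisfies homogeneous prime avoidance if, for every homogeneous ideal $J$ of $R$, $J^h\subseteq\bigcup_{\mathfrak p\in X}\mathfrak p$ implies that there exists $\mathfrak p_0\in X$ with $J\subseteq\mathfrak p_0$. *)

theory Defs
  imports "HOL-Algebra.Module" "HOL-Algebra.QuotRing" "HOL-Algebra.Ideal_Product"
    "HOL-Algebra.Generated_Groups"
    "HOL-Library.Poly_Mapping" "HOL-Library.Function_Algebras"
begin

section \<open>Modules over a commutative ring\<close>

text \<open>The ring components \<open>mult\<close> and \<open>one\<close> of a module record play no role in the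
  locale \<^locale>\<open>module\<close>; they are left unspecified in quotients and modules of homomorphisms.\<close>

definition regular_module :: "('r, 'x) ring_scheme \<Rightarrow> ('r, 'r) module" where
  "regular_module R = \<lparr>carrier = carrier R, mult = mult R, one = one R, zero = zero R,
     add = add R, smult = mult R\<rparr>"

definition quot_module :: "('r, 'm, 'x) module_scheme \<Rightarrow> 'm set \<Rightarrow> ('r, 'm set) module" where
  "quot_module M U = \<lparr>carrier = a_rcosets\<^bsub>M\<^esub> U, mult = undefined, one = undefined, zero = U,
     add = set_add M, smult = (\<lambda>r A. \<Union>x\<in>A. U +>\<^bsub>M\<^esub> (r \<odot>\<^bsub>M\<^esub> x))\<rparr>"

definition mod_hom ::
  "('r, 'x) ring_scheme \<Rightarrow> ('r, 'm, 'y) module_scheme \<Rightarrow> ('r, 'n, 'z) module_scheme \<Rightarrow> ('m \<Rightarrow> 'n) set" where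
  "mod_hom R M N = {f \<in> carrier M \<rightarrow>\<^sub>E carrier N.
     (\<forall>x\<in>carrier M. \<forall>y\<in>carrier M. f (x \<oplus>\<^bsub>M\<^esub> y) = f x \<oplus>\<^bsub>N\<^esub> f y) \<and>
     (\<forall>r\<in>carrier R. \<forall>x\<in>carrier M. f (r \<odot>\<^bsub>M\<^esub> x) = r \<odot>\<^bsub>N\<^esub> f x)}"

definition Hom_module ::
  "('r, 'x) ring_scheme \<Rightarrow> ('r, 'm, 'y) module_scheme \<Rightarrow> ('r, 'n, 'z) module_scheme \<Rightarrow> ('r, 'm \<Rightarrow> 'n) module" where
  "Hom_module R M N = \<lparr>carrier = mod_hom R M N, mult = undefined, one = undefined,
     zero = (\<lambda>x\<in>carrier M. \<zero>\<^bsub>N\<^esub>),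
     add = (\<lambda>f g. \<lambda>x\<in>carrier M. f x \<oplus>\<^bsub>N\<^esub> g x),
     smult = (\<lambda>r f. \<lambda>x\<in>carrier M. r \<odot>\<^bsub>N\<^esub> f x)\<rparr>"

definition annihilator :: "('r, 'x) ring_scheme \<Rightarrow> ('r, 'm, 'y) module_scheme \<Rightarrow> 'm \<Rightarrow> 'r set" where
  "annihilator R M x = {r \<in> carrier R. r \<odot>\<^bsub>M\<^esub> x = \<zero>\<^bsub>M\<^esub>}"

definition Ass :: "('r, 'x) ring_scheme \<Rightarrow> ('r, 'm, 'y) module_scheme \<Rightarrow> 'r set set" where
  "Ass R M = {p. primeideal p R \<and> (\<exists>x\<in>carrier M. p = annihilator R M x)}"

definition radical :: "('r, 'x) ring_scheme \<Rightarrow> 'r set \<Rightarrow> 'r set" where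
  "radical R I = {x \<in> carrier R. \<exists>n::nat. x [^]\<^bsub>R\<^esub> n \<in> I}"


section \<open>Gradings\<close>

text \<open>A grading of a ring or module is the family of its homogeneous components, indexed by an
  abelian group.\<close>

definition internal_direct_sum :: "('m, 'x) ring_scheme \<Rightarrow> ('g \<Rightarrow> 'm set) \<Rightarrow> bool" where
  "internal_direct_sum M GM \<longleftrightarrow>
     (\<forall>d. subgroup (GM d) (add_monoid M)) \<and>
     (\<forall>x\<in>carrier M. \<exists>!f. (\<forall>d. f d \<in> GM d) \<and> finite {d. f d \<noteq> \<zero>\<^bsub>M\<^esub>} \<and>
        x = (\<Oplus>\<^bsub>M\<^esub>d\<in>{d. f d \<noteq> \<zero>\<^bsub>M\<^esub>}. f d))"

definition graded_module :: "('r, 'x) ring_scheme \<Rightarrow> ('g::ab_group_add \<Rightarrow> 'r set) \<Rightarrow>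
    ('r, 'm, 'y) module_scheme \<Rightarrow> ('g \<Rightarrow> 'm set) \<Rightarrow> bool" where
  "graded_module R G M GM \<longleftrightarrow> module R M \<and> internal_direct_sum M GM \<and>
     (\<forall>d e. \<forall>r\<in>G d. \<forall>x\<in>GM e. r \<odot>\<^bsub>M\<^esub> x \<in> GM (d + e))"

definition quot_grading :: "('m, 'x) ring_scheme \<Rightarrow> 'm set \<Rightarrow> ('g \<Rightarrow> 'm set) \<Rightarrow> 'g \<Rightarrow> 'm set set" where
  "quot_grading M U GM d = (\<lambda>x. U +>\<^bsub>M\<^esub> x) ` GM d"

definition homogeneous_elements :: "('g \<Rightarrow> 'm set) \<Rightarrow> 'm set" where
  "homogeneous_elements GM = (\<Union>d. GM d)"

definition homogeneous_ideal :: "('r, 'x) ring_scheme \<Rightarrow> ('g \<Rightarrow> 'r set) \<Rightarrow> 'r set \<Rightarrow> bool" where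
  "homogeneous_ideal R G J \<longleftrightarrow>
     ideal J R \<and> (\<exists>S. S \<subseteq> homogeneous_elements G \<and> J = Idl\<^bsub>R\<^esub> S)"

definition graded_submodule :: "('r, 'x) ring_scheme \<Rightarrow> ('g::ab_group_add \<Rightarrow> 'r set) \<Rightarrow>
    ('r, 'm, 'y) module_scheme \<Rightarrow> ('g \<Rightarrow> 'm set) \<Rightarrow> 'm set \<Rightarrow> bool" where
  "graded_submodule R G M GM U \<longleftrightarrow>
     submodule U R M \<and> graded_module R G (M\<lparr>carrier := U\<rparr>) (\<lambda>d. U \<inter> GM d)"

definition hom_of_degree :: "('r, 'x) ring_scheme \<Rightarrow>
    ('r, 'm, 'y) module_scheme \<Rightarrow> ('g::ab_group_add \<Rightarrow> 'm set) \<Rightarrow>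
    ('r, 'n, 'z) module_scheme \<Rightarrow> ('g \<Rightarrow> 'n set) \<Rightarrow> 'g \<Rightarrow> ('m \<Rightarrow> 'n) set" where
  "hom_of_degree R M GM N GN a = {f \<in> mod_hom R M N. \<forall>d. f ` GM d \<subseteq> GN (d + a)}"

definition star_Hom :: "('r, 'x) ring_scheme \<Rightarrow>
    ('r, 'm, 'y) module_scheme \<Rightarrow> ('g::ab_group_add \<Rightarrow> 'm set) \<Rightarrow>
    ('r, 'n, 'z) module_scheme \<Rightarrow> ('g \<Rightarrow> 'n set) \<Rightarrow> ('r, 'm \<Rightarrow> 'n) module" where
  "star_Hom R M GM N GN = (Hom_module R M N)
     \<lparr>carrier := generate (add_monoid (Hom_module R M N)) (\<Union>a. hom_of_degree R M GM N GN a)\<rparr>"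


section \<open>Injective objects in the category of graded modules\<close>

text \<open>HOL cannot quantify over all graded modules inside a definition, so the test modules live in
  the element type of the ring.  Since that type accommodates all homogeneous ideals, with arbitrarily
  shifted gradings, Baer's criterion shows that nothing is lost.\<close>

definition star_injective :: "('r, 'x) ring_scheme \<Rightarrow> ('g::ab_group_add \<Rightarrow> 'r set) \<Rightarrow>
    ('r, 'e) module \<Rightarrow> ('g \<Rightarrow> 'e set) \<Rightarrow> bool" where
  "star_injective R G E GE \<longleftrightarrow> graded_module R G E GE \<and>
     (\<forall>(M :: ('r, 'r) module) GM (N :: ('r, 'r) module) GN f g.
        graded_module R G M GM \<longrightarrow> graded_module R G N GN \<longrightarrow>
        f \<in> hom_of_degree R M GM N GN 0 \<longrightarrow> inj_on f (carrier M) \<longrightarrow>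
        g \<in> hom_of_degree R M GM E GE 0 \<longrightarrow>
        (\<exists>h\<in>hom_of_degree R N GN E GE 0. \<forall>x\<in>carrier M. h (f x) = g x))"

definition star_injective_hull :: "('r, 'x) ring_scheme \<Rightarrow> ('g::ab_group_add \<Rightarrow> 'r set) \<Rightarrow>
    ('r, 'm) module \<Rightarrow> ('g \<Rightarrow> 'm set) \<Rightarrow> ('r, 'e) module \<Rightarrow> ('g \<Rightarrow> 'e set) \<Rightarrow> bool" where
  "star_injective_hull R G M GM E GE \<longleftrightarrow> star_injective R G E GE \<and>
     (\<exists>\<iota>\<in>hom_of_degree R M GM E GE 0. inj_on \<iota> (carrier M) \<and>
        (\<forall>U. graded_submodule R G E GE U \<longrightarrow> U \<noteq> {\<zero>\<^bsub>E\<^esub>} \<longrightarrow> U \<inter> \<iota> ` carrier M \<noteq> {\<zero>\<^bsub>E\<^esub>}))"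

definition star_injective_resolution :: "('r, 'x) ring_scheme \<Rightarrow> ('g::ab_group_add \<Rightarrow> 'r set) \<Rightarrow>
    ('r, 'm) module \<Rightarrow> ('g \<Rightarrow> 'm set) \<Rightarrow>
    (nat \<Rightarrow> ('r, 'c) module) \<Rightarrow> (nat \<Rightarrow> 'g \<Rightarrow> 'c set) \<Rightarrow> (nat \<Rightarrow> 'c \<Rightarrow> 'c) \<Rightarrow> bool" where
  "star_injective_resolution R G M GM C GC \<delta> \<longleftrightarrow>
     graded_module R G M GM \<and>
     (\<forall>i. star_injective R G (C i) (GC i)) \<and>
     (\<forall>i. \<delta> i \<in> hom_of_degree R (C i) (GC i) (C (Suc i)) (GC (Suc i)) 0) \<and>
     (\<exists>\<epsilon>\<in>hom_of_degree R M GM (C 0) (GC 0) 0. inj_on \<epsilon> (carrier M) \<and>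
        \<epsilon> ` carrier M = {x \<in> carrier (C 0). \<delta> 0 x = \<zero>\<^bsub>C 1\<^esub>}) \<and>
     (\<forall>i. \<delta> i ` carrier (C i) = {x \<in> carrier (C (Suc i)). \<delta> (Suc i) x = \<zero>\<^bsub>C (Suc (Suc i))\<^esub>})"


section \<open>Local cohomology\<close>

definition torsion_part :: "('r, 'x) ring_scheme \<Rightarrow> 'r set \<Rightarrow> ('r, 'm, 'y) module_scheme \<Rightarrow> 'm set" where
  "torsion_part R I M = {x \<in> carrier M.
     \<exists>n::nat. \<forall>a \<in> I [^]\<^bsub>ideals_set R\<^esub> n. a \<odot>\<^bsub>M\<^esub> x = \<zero>\<^bsub>M\<^esub>}"

text \<open>The right derived functors of \<^const>\<open>torsion_part\<close>, computed from a graded injective resolution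
  \<open>(C, GC, \<delta>)\<close> of the module: cocycles modulo coboundaries of the complex of torsion parts, with
  the induced grading.  No resolution is singled out; up to graded isomorphism the result does not
  depend on the choice.\<close>

definition lc_cocycles :: "('r, 'x) ring_scheme \<Rightarrow> 'r set \<Rightarrow>
    (nat \<Rightarrow> ('r, 'c) module) \<Rightarrow> (nat \<Rightarrow> 'c \<Rightarrow> 'c) \<Rightarrow> nat \<Rightarrow> 'c set" where
  "lc_cocycles R I C \<delta> i = {x \<in> torsion_part R I (C i). \<delta> i x = \<zero>\<^bsub>C (Suc i)\<^esub>}"

definition lc_coboundaries :: "('r, 'x) ring_scheme \<Rightarrow> 'r set \<Rightarrow>
    (nat \<Rightarrow> ('r, 'c) module) \<Rightarrow> (nat \<Rightarrow> 'c \<Rightarrow> 'c) \<Rightarrow> nat \<Rightarrow> 'c set" where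
  "lc_coboundaries R I C \<delta> i =
     (case i of 0 \<Rightarrow> {\<zero>\<^bsub>C 0\<^esub>} | Suc j \<Rightarrow> \<delta> j ` torsion_part R I (C j))"

definition local_cohomology :: "('r, 'x) ring_scheme \<Rightarrow> 'r set \<Rightarrow>
    (nat \<Rightarrow> ('r, 'c) module) \<Rightarrow> (nat \<Rightarrow> 'c \<Rightarrow> 'c) \<Rightarrow> nat \<Rightarrow> ('r, 'c set) module" where
  "local_cohomology R I C \<delta> i =
     quot_module ((C i)\<lparr>carrier := lc_cocycles R I C \<delta> i\<rparr>) (lc_coboundaries R I C \<delta> i)"

definition local_cohomology_grading :: "('r, 'x) ring_scheme \<Rightarrow> 'r set \<Rightarrow>
    (nat \<Rightarrow> ('r, 'c) module) \<Rightarrow> (nat \<Rightarrow> 'g \<Rightarrow> 'c set) \<Rightarrow> (nat \<Rightarrow> 'c \<Rightarrow> 'c) \<Rightarrow>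
    nat \<Rightarrow> 'g \<Rightarrow> 'c set set" where
  "local_cohomology_grading R I C GC \<delta> i =
     quot_grading ((C i)\<lparr>carrier := lc_cocycles R I C \<delta> i\<rparr>) (lc_coboundaries R I C \<delta> i)
       (\<lambda>d. lc_cocycles R I C \<delta> i \<inter> GC i d)"


section \<open>Homogeneous arithmetic rank and homogeneous prime avoidance\<close>

definition homogeneous_ara :: "('r, 'x) ring_scheme \<Rightarrow> ('g \<Rightarrow> 'r set) \<Rightarrow> 'r set \<Rightarrow> nat" where
  "homogeneous_ara R G I = (LEAST s. \<exists>rs. length rs = s \<and> set rs \<subseteq> homogeneous_elements G \<and>
     radical R I = radical R (Idl\<^bsub>R\<^esub> (set rs)))"

definition homogeneous_prime_avoidance ::
  "('r, 'x) ring_scheme \<Rightarrow> ('g \<Rightarrow> 'r set) \<Rightarrow> 'r set set \<Rightarrow> bool" where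
  "homogeneous_prime_avoidance R G X \<longleftrightarrow>
     (\<forall>J. homogeneous_ideal R G J \<longrightarrow> J \<inter> homogeneous_elements G \<subseteq> \<Union>X \<longrightarrow> (\<exists>p\<in>X. J \<subseteq> p))"


section \<open>Multigraded quotients of polynomial rings\<close>

text \<open>The variables are indexed by a finite type \<open>'n\<close>, and \<open>'l\<close> indexes the components of a
  multidegree.\<close>

type_synonym ('n, 'k) mpoly = "('n \<Rightarrow>\<^sub>0 nat) \<Rightarrow>\<^sub>0 'k"

definition poly_ring :: "('n, 'k::field) mpoly ring" where
  "poly_ring = \<lparr>carrier = UNIV, mult = (*), one = 1, zero = 0, add = (+)\<rparr>"

definition poly_var :: "'n \<Rightarrow> ('n, 'k::field) mpoly" where
  "poly_var i = Poly_Mapping.single (Poly_Mapping.single i 1) 1"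

definition monomial_degree :: "('n::finite \<Rightarrow> 'l \<Rightarrow> nat) \<Rightarrow> ('n \<Rightarrow>\<^sub>0 nat) \<Rightarrow> 'l \<Rightarrow> int" where
  "monomial_degree w m = (\<lambda>j. \<Sum>i\<in>UNIV. int (Poly_Mapping.lookup m i * w i j))"

definition poly_grading ::
  "('n::finite \<Rightarrow> 'l \<Rightarrow> nat) \<Rightarrow> ('l \<Rightarrow> int) \<Rightarrow> ('n, 'k::field) mpoly set" where
  "poly_grading w d = {f. \<forall>m\<in>Poly_Mapping.keys f. monomial_degree w m = d}"

end

theory Submission
  imports Defs "HOL-Library.Countable" "HOL.Topological_Spaces"
begin

text \<open>
  Write \<open>H\<close> for the first local cohomology module of \<open>R\<close> with support in \<open>I = (f\<^sub>1, \<dots>, f\<^sub>s)\<close>.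
  Since \<open>E\<close> is an injective cogenerator for graded modules and \<open>R\<close> is noetherian, a homogeneous
  ideal \<open>J\<close> lies in some associated prime of the graded Matlis dual of \<open>H\<close> if and only if
  \<open>J H \<noteq> H\<close>.  Homogeneous prime avoidance therefore says that every homogeneous \<open>J\<close> with \<open>J H = H\<close>
  contains a homogeneous element \<open>r\<close> with \<open>r H = H\<close>.

  The vanishing of the higher local cohomology yields \<open>I H = H\<close>: let \<open>Q\<close> be the injective
  resolution modulo its \<open>I\<close>-torsion.  The iterated mapping cone of \<open>Q\<close> along \<open>f\<^sub>1, \<dots>, f\<^sub>s\<close> is acyclic,
  because each \<open>f\<^sub>j\<close> acts invertibly on one layer of the torsion filtration, whereas its cohomology in
  degree \<open>0\<close> is the quotient of the zeroth cohomology \<open>T\<close> of \<open>Q\<close>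
    by \<open>I T\<close>; moreover \<open>H\<close> is a quotient of
  \<open>T\<close>.  If also \<open>f H = H\<close> with \<open>f \<in> I\<close> homogeneous, a graded Nakayama argument shows that a
  power of \<open>I\<close> lies in \<open>f R\<close>.  Conversely, if \<open>I\<close>
    and \<open>f R\<close> have the same radical, then \<open>f H = H\<close>, and
  \<open>J H = H\<close> forces a power of \<open>f\<close> into \<open>J\<close>, since \<open>H\<close> contains the class of \<open>1 / f\<close>.
\<close>

section \<open>Graded modules\<close>

text \<open>The test modules in \<open>star_injective\<close> have the type of the ring, whereas
  maps from \<open>C 0\<close> to \<open>E\<close> are needed; Baer's criterion and Zorn's lemma
  bridge this gap. To avoid nested cosets, the quotients by torsion are never formed: exactness
  modulo torsion carries an explicit torsion summand, and \<open>T\<close>, \<open>H\<close> and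
  \<open>J H\<close> are handled through preimages in \<open>C 0\<close>. As \<open>H\<close> is in
  general not finitely generated, Nakayama's lemma does not apply to \<open>f H = H\<close>. Its
  substitute is a comparison of degrees: with \<open>R\<close> standing for its image in
  \<open>T\<close>, the equations \<open>I T = T\<close> and \<open>T = f T + R\<close> give
  \<open>T = f T + I\<close>, hence a decomposition of 1 with ring part in \<open>I\<close>; and
  elements of \<open>mm\<close> have no component in degree 0, because degree 0 consists of 0 and
  units. This requires \<open>I\<close> inside \<open>mm\<close>; otherwise \<open>I = R\<close>.
  The same comparison settles the converse when \<open>f\<close> lies in \<open>mm\<close>;
  otherwise \<open>f\<close> is a unit and \<open>H = 0\<close>.\<close>

definition component :: "('m, 'x) ring_scheme \<Rightarrow> ('g \<Rightarrow> 'm set) \<Rightarrow> 'm \<Rightarrow> 'g \<Rightarrow> 'm" where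
  "component M GM x = (THE f. (\<forall>d. f d \<in> GM d) \<and> finite {d. f d \<noteq> \<zero>\<^bsub>M\<^esub>} \<and>
     x = (\<Oplus>\<^bsub>M\<^esub>d\<in>{d. f d \<noteq> \<zero>\<^bsub>M\<^esub>}. f d))"

locale graded_mod = module R M for R :: "('r, 'x) ring_scheme" (structure)
    and M :: "('r, 'm, 'y) module_scheme" (structure) +
  fixes G :: "'g::ab_group_add \<Rightarrow> 'r set" and GM :: "'g \<Rightarrow> 'm set"
  assumes graded: "graded_module R G M GM"
begin

abbreviation "cp \<equiv> component M GM"

lemma GM_subgroup: "subgroup (GM d) (add_monoid M)"
  using graded unfolding graded_module_def internal_direct_sum_def by blast

lemma GM_carrier: "x \<in> GM d \<Longrightarrow> x \<in> carrier M"
  using subgroup.subset[OF GM_subgroup] by fastforce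

lemma GM_zero [simp]: "\<zero>\<^bsub>M\<^esub> \<in> GM d"
  using subgroup.one_closed[OF GM_subgroup[of d]] by simp

lemma GM_add: "x \<in> GM d \<Longrightarrow> y \<in> GM d \<Longrightarrow> x \<oplus>\<^bsub>M\<^esub> y \<in> GM d"
  using subgroup.m_closed[OF GM_subgroup[of d]] by simp

lemma GM_smult: "r \<in> G d \<Longrightarrow> x \<in> GM e \<Longrightarrow> r \<odot>\<^bsub>M\<^esub> x \<in> GM (d + e)"
  using graded unfolding graded_module_def by blast

lemma cp_ex1:
  assumes "x \<in> carrier M"
  shows "\<exists>!f. (\<forall>d. f d \<in> GM d) \<and> finite {d. f d \<noteq> \<zero>\<^bsub>M\<^esub>} \<and>
     x = (\<Oplus>\<^bsub>M\<^esub>d\<in>{d. f d \<noteq> \<zero>\<^bsub>M\<^esub>}. f d)"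
  using graded assms unfolding graded_module_def internal_direct_sum_def by blast

lemma
  assumes "x \<in> carrier M"
  shows cp_in: "cp x d \<in> GM d"
    and cp_finite: "finite {d. cp x d \<noteq> \<zero>\<^bsub>M\<^esub>}"
    and cp_sum: "x = (\<Oplus>\<^bsub>M\<^esub>d\<in>{d. cp x d \<noteq> \<zero>\<^bsub>M\<^esub>}. cp x d)"
  using theI'[OF cp_ex1[OF assms]] unfolding component_def by blast+

lemma cp_carrier [simp]: "x \<in> carrier M \<Longrightarrow> cp x d \<in> carrier M"
  using cp_in GM_carrier by blast

lemma finsum_support:
  assumes "\<And>d. f d \<in> carrier M" "finite A" "{d. f d \<noteq> \<zero>\<^bsub>M\<^esub>} \<subseteq> A"
  shows "(\<Oplus>\<^bsub>M\<^esub>d\<in>{d. f d \<noteq> \<zero>\<^bsub>M\<^esub>}. f d) = (\<Oplus>\<^bsub>M\<^esub>d\<in>A. f d)"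
  by (rule M.add.finprod_mono_neutral_cong_left) (use assms in auto)

lemma cp_sum':
  assumes "x \<in> carrier M" "finite A" "{d. cp x d \<noteq> \<zero>\<^bsub>M\<^esub>} \<subseteq> A"
  shows "x = (\<Oplus>\<^bsub>M\<^esub>d\<in>A. cp x d)"
  using finsum_support[of "cp x" A] cp_sum[OF assms(1)] assms by simp

lemma cp_unique:
  assumes "\<And>d. f d \<in> GM d" "finite A" "{d. f d \<noteq> \<zero>\<^bsub>M\<^esub>} \<subseteq> A" "x = (\<Oplus>\<^bsub>M\<^esub>d\<in>A. f d)"
  shows "cp x = f"
proof -
  have c: "f d \<in> carrier M" for d using assms(1) GM_carrier by blast
  have x: "x \<in> carrier M" unfolding assms(4) using c by (auto intro: M.finsum_closed)
  have "x = (\<Oplus>\<^bsub>M\<^esub>d\<in>{d. f d \<noteq> \<zero>\<^bsub>M\<^esub>}. f d)"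
    using finsum_support[of f A] c assms by simp
  moreover have "finite {d. f d \<noteq> \<zero>\<^bsub>M\<^esub>}" using assms(2,3) finite_subset by blast
  ultimately show ?thesis
    using the1_equality[OF cp_ex1[OF x], of f] assms(1) unfolding component_def by blast
qed

lemma cp_homog:
  assumes "x \<in> GM d" shows "cp x = (\<lambda>e. if e = d then x else \<zero>\<^bsub>M\<^esub>)"
  by (rule cp_unique[of _ "{d}"]) (use assms GM_carrier in \<open>auto simp: M.finsum_insert\<close>)

lemma cp_zero [simp]: "cp \<zero>\<^bsub>M\<^esub> d = \<zero>\<^bsub>M\<^esub>"
  using cp_homog[OF GM_zero] by auto

lemma cp_add:
  assumes "x \<in> carrier M" "y \<in> carrier M"
  shows "cp (x \<oplus>\<^bsub>M\<^esub> y) d = cp x d \<oplus>\<^bsub>M\<^esub> cp y d"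
proof -
  let ?A = "{d. cp x d \<noteq> \<zero>\<^bsub>M\<^esub>} \<union> {d. cp y d \<noteq> \<zero>\<^bsub>M\<^esub>}"
  have f: "finite ?A" using cp_finite assms by simp
  have "cp (x \<oplus>\<^bsub>M\<^esub> y) = (\<lambda>d. cp x d \<oplus>\<^bsub>M\<^esub> cp y d)"
  proof (rule cp_unique[of _ ?A])
    show "x \<oplus>\<^bsub>M\<^esub> y = (\<Oplus>\<^bsub>M\<^esub>d\<in>?A. cp x d \<oplus>\<^bsub>M\<^esub> cp y d)"
      using cp_sum'[OF assms(1) f] cp_sum'[OF assms(2) f] assms
      by (subst M.finsum_addf) auto
  qed (use assms f cp_in GM_add in auto)
  then show ?thesis by simp
qed

lemma cp_smult:
  assumes "x \<in> carrier M" "r \<in> G e" "r \<in> carrier R"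
  shows "cp (r \<odot>\<^bsub>M\<^esub> x) d = r \<odot>\<^bsub>M\<^esub> cp x (d - e)"
proof -
  let ?A = "{d. cp x d \<noteq> \<zero>\<^bsub>M\<^esub>}"
  have f: "finite ?A" using cp_finite assms by simp
  have inj: "inj_on (\<lambda>d. d + e) ?A" by (auto intro: inj_onI)
  have "cp (r \<odot>\<^bsub>M\<^esub> x) = (\<lambda>d. r \<odot>\<^bsub>M\<^esub> cp x (d - e))"
  proof (rule cp_unique[of _ "(\<lambda>d. d + e) ` ?A"])
    show "r \<odot>\<^bsub>M\<^esub> cp x (d - e) \<in> GM d" for d
      using GM_smult[OF assms(2) cp_in[OF assms(1)], of "d - e"] by simp
    show "{d. r \<odot>\<^bsub>M\<^esub> cp x (d - e) \<noteq> \<zero>\<^bsub>M\<^esub>} \<subseteq> (\<lambda>d. d + e) ` ?A"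
    proof
      fix d assume "d \<in> {d. r \<odot>\<^bsub>M\<^esub> cp x (d - e) \<noteq> \<zero>\<^bsub>M\<^esub>}"
      then have "d - e \<in> ?A" using assms by auto
      then show "d \<in> (\<lambda>d. d + e) ` ?A" by (metis (no_types, lifting) diff_add_cancel imageI)
    qed
    have "r \<odot>\<^bsub>M\<^esub> x = r \<odot>\<^bsub>M\<^esub> (\<Oplus>\<^bsub>M\<^esub>d\<in>?A. cp x d)" using cp_sum[OF assms(1)] by simp
    also have "\<dots> = (\<Oplus>\<^bsub>M\<^esub>d\<in>?A. r \<odot>\<^bsub>M\<^esub> cp x d)"
      by (rule finsum_smult_ldistr) (use f assms in auto)
    also have "\<dots> = (\<Oplus>\<^bsub>M\<^esub>d\<in>(\<lambda>d. d + e) ` ?A. r \<odot>\<^bsub>M\<^esub> cp x (d - e))"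
      by (subst M.finsum_reindex[OF _ inj]) (use assms in auto)
    finally show "r \<odot>\<^bsub>M\<^esub> x = (\<Oplus>\<^bsub>M\<^esub>d\<in>(\<lambda>d. d + e) ` ?A. r \<odot>\<^bsub>M\<^esub> cp x (d - e))" .
  qed (use f in auto)
  then show ?thesis by simp
qed

lemma finsum_in:
  assumes "\<zero>\<^bsub>M\<^esub> \<in> U" "\<And>x y. x \<in> U \<Longrightarrow> y \<in> U \<Longrightarrow> x \<oplus>\<^bsub>M\<^esub> y \<in> U" "U \<subseteq> carrier M"
    and "finite A" "\<And>d. d \<in> A \<Longrightarrow> f d \<in> U"
  shows "(\<Oplus>\<^bsub>M\<^esub>d\<in>A. f d) \<in> U"
  using assms(4,5)
proof (induction A rule: finite_induct)
  case (insert a A)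
  then have "f \<in> A \<rightarrow> carrier M" "f a \<in> carrier M" using assms(3) by auto
  with insert show ?case by (simp add: M.finsum_insert assms(2))
qed (simp add: assms(1))

text \<open>An element is the sum of its components. As closure under addition is enough,
  \<open>U\<close> can later be the solution set of an existential statement; this is how claims are
  reduced to homogeneous elements.\<close>

lemma in_if_cp_in:
  assumes "x \<in> carrier M" "\<And>d. cp x d \<in> U"
    and "\<zero>\<^bsub>M\<^esub> \<in> U" "\<And>x y. x \<in> U \<Longrightarrow> y \<in> U \<Longrightarrow> x \<oplus>\<^bsub>M\<^esub> y \<in> U" "U \<subseteq> carrier M"
  shows "x \<in> U"
  using finsum_in[OF assms(3-5) cp_finite[OF assms(1)], of "cp x"] cp_sum[OF assms(1)] assms(2)
    by simp

lemma homog_induct [consumes 1, case_names zero homog add]: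
  assumes "x \<in> carrier M" "P \<zero>\<^bsub>M\<^esub>" "\<And>x d. x \<in> GM d \<Longrightarrow> P x"
    "\<And>x y. x \<in> carrier M \<Longrightarrow> y \<in> carrier M \<Longrightarrow> P x \<Longrightarrow> P y \<Longrightarrow> P (x \<oplus>\<^bsub>M\<^esub> y)"
  shows "P x"
proof -
  have "x \<in> {x \<in> carrier M. P x}"
    by (rule in_if_cp_in) (use assms cp_in[OF assms(1)] assms(3)[OF cp_in[OF assms(1)]] in auto)
  then show ?thesis by simp
qed

end

lemma regular_simps [simp]:
  "carrier (regular_module R) = carrier R" "\<zero>\<^bsub>regular_module R\<^esub> = \<zero>\<^bsub>R\<^esub>"
  "x \<oplus>\<^bsub>regular_module R\<^esub> y = x \<oplus>\<^bsub>R\<^esub> y" "x \<odot>\<^bsub>regular_module R\<^esub> y = x \<otimes>\<^bsub>R\<^esub> y"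
  by (auto simp: regular_module_def)

lemma (in cring) regular_minus [simp]: "\<ominus>\<^bsub>regular_module R\<^esub> x = \<ominus> x"
  by (simp add: a_inv_def m_inv_def regular_module_def)

locale graded_cring = R?: cring R for R :: "'r ring" (structure) +
  fixes G :: "'g::ab_group_add \<Rightarrow> 'r set"
  assumes graded_regular: "graded_module R G (regular_module R) G"
    and one_degree: "\<one> \<in> G 0"
begin

sublocale reg: graded_mod R "regular_module R" G G
  using graded_regular
  by (auto simp: graded_mod_def graded_mod_axioms_def graded_module_def)

abbreviation rc where "rc \<equiv> component (regular_module R) G"

lemmas G_carrier = reg.GM_carrier[simplified]
lemmas G_mult = reg.GM_smult[simplified]
lemmas rc_mult = reg.cp_smult[simplified]
lemmas rc_add = reg.cp_add[simplified]
lemmas rc_homog = reg.cp_homog[simplified]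
lemmas rc_zero = reg.cp_zero[simplified]
lemmas rc_in = reg.cp_in[simplified]
lemmas rc_carrier = reg.cp_carrier[simplified]

text \<open>The grading group carries no multiplication by integers, so n times the degree
  \<open>e\<close> appears as an iterated addition.\<close>

lemma G_pow: "f \<in> G e \<Longrightarrow> f [^] (n::nat) \<in> G (((+) e ^^ n) 0)"
proof (induction n)
  case (Suc n)
  then have "f \<otimes> f [^] n \<in> G (e + ((+) e ^^ n) 0)" using G_mult by blast
  then show ?case using Suc by (simp add: m_comm G_carrier)
qed (simp add: one_degree)

lemma graded_modI: "graded_module R G M GM \<Longrightarrow> graded_mod R M G GM"
  by (auto simp: graded_mod_def graded_mod_axioms_def graded_module_def)

end

lemma (in abelian_group) minus_add_distrib:
  assumes "a \<in> carrier G" "b \<in> carrier G" "c \<in> carrier G" "d \<in> carrier G"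
  shows "(a \<oplus> b) \<ominus> (c \<oplus> d) = (a \<ominus> c) \<oplus> (b \<ominus> d)"
  using assms by (simp add: a_minus_def minus_add a_ac)

lemma (in abelian_group) minus_zero_iff:
  "a \<in> carrier G \<Longrightarrow> b \<in> carrier G \<Longrightarrow> a \<ominus> b = \<zero> \<longleftrightarrow> a = b"
  by (metis a_minus_def add.inv_closed add.inv_inv minus_equality r_neg)

lemma finsum_carrier_update:
  assumes "abelian_group M" "abelian_group (M\<lparr>carrier := U\<rparr>)" "U \<subseteq> carrier M"
    and "finite A" "\<And>d. d \<in> A \<Longrightarrow> f d \<in> U"
  shows "(\<Oplus>\<^bsub>M\<lparr>carrier := U\<rparr>\<^esub>d\<in>A. f d) = (\<Oplus>\<^bsub>M\<^esub>d\<in>A. f d)"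
proof -
  interpret M: abelian_group M by fact
  interpret N: abelian_group "M\<lparr>carrier := U\<rparr>" by fact
  show ?thesis using assms(4,5)
  proof (induction A rule: finite_induct)
    case (insert a A)
    have 1: "f \<in> A \<rightarrow> carrier M" "f a \<in> carrier M" using insert assms(3) by auto
    have 2: "f \<in> A \<rightarrow> carrier (M\<lparr>carrier := U\<rparr>)" "f a \<in> carrier (M\<lparr>carrier := U\<rparr>)"
      using insert by auto
    show ?case
      using N.finsum_insert[OF insert(1,2) 2] M.finsum_insert[OF insert(1,2) 1] insert by simp
  qed simp
qed

context graded_mod
begin

text \<open>The shift by \<open>b\<close> turns maps of degree \<open>b\<close> into maps of degree
  0, the only ones that occur in \<open>star_injective\<close>.\<close>

lemma graded_module_shift:
  assumes U: "submodule U R M" and cl: "\<And>x d. x \<in> U \<Longrightarrow> component M GM x d \<in> U"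
    and Gc: "\<And>d. G d \<subseteq> carrier R"
  shows "graded_module R G (M\<lparr>carrier := U\<rparr>) (\<lambda>d. U \<inter> GM (d - b))"
proof -
  let ?N = "M\<lparr>carrier := U\<rparr>"
  have N: "module R ?N" using submodule.submodule_is_module[OF U] module_axioms .
  have UM: "U \<subseteq> carrier M" using submoduleE[OF U] by blast
  note fs = finsum_carrier_update[OF M.abelian_group_axioms module.axioms(2)[OF N] UM]
  have sg: "subgroup (U \<inter> GM (d - b)) (add_monoid ?N)" for d
  proof -
    have "subgroup (U \<inter> GM (d - b)) (add_monoid M)"
      using M.add.subgroups_Inter_pair[OF submodule.axioms(1)[OF U] GM_subgroup] by simp
    then show ?thesis
      using M.add.subgroup_incl[of "U \<inter> GM (d - b)" U] submodule.axioms(1)[OF U] by simp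
  qed
  have ex1: "\<exists>!f. (\<forall>d. f d \<in> U \<inter> GM (d - b)) \<and> finite {d. f d \<noteq> \<zero>\<^bsub>?N\<^esub>} \<and>
        x = (\<Oplus>\<^bsub>?N\<^esub>d\<in>{d. f d \<noteq> \<zero>\<^bsub>?N\<^esub>}. f d)" if x: "x \<in> carrier ?N" for x
  proof
    have xM: "x \<in> carrier M" "x \<in> U" using x UM by auto
    let ?f = "\<lambda>d. cp x (d - b)"
    let ?A = "{d. cp x d \<noteq> \<zero>\<^bsub>M\<^esub>}"
    have inj: "inj_on (\<lambda>d. d + b) ?A" by (auto intro: inj_onI)
    have im: "{d. ?f d \<noteq> \<zero>\<^bsub>M\<^esub>} = (\<lambda>d. d + b) ` ?A"
      by (auto simp: image_iff) (metis diff_add_cancel)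
    have fin: "finite {d. ?f d \<noteq> \<zero>\<^bsub>M\<^esub>}" unfolding im using cp_finite[OF xM(1)] by simp
    have "(\<Oplus>\<^bsub>?N\<^esub>d\<in>{d. ?f d \<noteq> \<zero>\<^bsub>M\<^esub>}. ?f d) = (\<Oplus>\<^bsub>M\<^esub>d\<in>{d. ?f d \<noteq> \<zero>\<^bsub>M\<^esub>}. ?f d)"
      using fs[OF fin] cl xM by simp
    also have "\<dots> = (\<Oplus>\<^bsub>M\<^esub>d\<in>?A. cp x d)"
      unfolding im by (subst M.finsum_reindex[OF _ inj]) (use xM in auto)
    finally show "(\<forall>d. ?f d \<in> U \<inter> GM (d - b)) \<and> finite {d. ?f d \<noteq> \<zero>\<^bsub>?N\<^esub>} \<and>
        x = (\<Oplus>\<^bsub>?N\<^esub>d\<in>{d. ?f d \<noteq> \<zero>\<^bsub>?N\<^esub>}. ?f d)"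
      using fin cl cp_in xM cp_sum[OF xM(1)] by simp
  next
    fix f assume f: "(\<forall>d. f d \<in> U \<inter> GM (d - b)) \<and> finite {d. f d \<noteq> \<zero>\<^bsub>?N\<^esub>} \<and>
        x = (\<Oplus>\<^bsub>?N\<^esub>d\<in>{d. f d \<noteq> \<zero>\<^bsub>?N\<^esub>}. f d)"
    let ?B = "{d. f d \<noteq> \<zero>\<^bsub>M\<^esub>}"
    have fM: "f d \<in> carrier M" for d using f UM by blast
    have inj: "inj_on (\<lambda>d. d - b) ?B" by (auto intro: inj_onI)
    have im: "{d. f (d + b) \<noteq> \<zero>\<^bsub>M\<^esub>} = (\<lambda>d. d - b) ` ?B"
      by (auto simp: image_iff) (metis add_diff_cancel)
    have "cp x = (\<lambda>d. f (d + b))"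
    proof (rule cp_unique[of _ "(\<lambda>d. d - b) ` ?B"])
      show "f (d + b) \<in> GM d" for d using f[THEN conjunct1, rule_format, of "d + b"] by simp
      have "x = (\<Oplus>\<^bsub>M\<^esub>d\<in>?B. f d)" using f fs[of ?B f] by simp
      also have "\<dots> = (\<Oplus>\<^bsub>M\<^esub>d\<in>(\<lambda>d. d - b) ` ?B. f (d + b))"
        by (subst M.finsum_reindex[OF _ inj]) (use fM in auto)
      finally show "x = (\<Oplus>\<^bsub>M\<^esub>d\<in>(\<lambda>d. d - b) ` ?B. f (d + b))" .
    qed (use f im in auto)
    then show "f = (\<lambda>d. cp x (d - b))" by simp
  qed
  have "r \<odot>\<^bsub>?N\<^esub> x \<in> U \<inter> GM (d + e - b)" if "r \<in> G d" "x \<in> U \<inter> GM (e - b)" for r x d e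
    using GM_smult[OF that(1), of x "e - b"] that submodule.smult_closed[OF U] Gc
    by (auto simp: algebra_simps)
  then show ?thesis
    using N sg ex1 unfolding graded_module_def internal_direct_sum_def by blast
qed

end

subsection \<open>Partial homomorphisms as linear relations\<close>

text \<open>A homogeneous partial homomorphism of degree \<open>b\<close> is represented by its graph, so that unions of
  chains cause no work in the application of Zorn's lemma.\<close>

definition linear_graph :: "('r, 'x) ring_scheme \<Rightarrow> ('r, 'm, 'y) module_scheme \<Rightarrow>
    ('g::ab_group_add \<Rightarrow> 'm set) \<Rightarrow> ('r, 'e, 'z) module_scheme \<Rightarrow> ('g \<Rightarrow> 'e set) \<Rightarrow> 'g \<Rightarrow>
    ('m \<times> 'e) set \<Rightarrow> bool" where
  "linear_graph R M GM E GE b \<Phi> \<longleftrightarrow> \<Phi> \<subseteq> carrier M \<times> carrier E \<and> (\<zero>\<^bsub>M\<^esub>, \<zero>\<^bsub>E\<^esub>) \<in> \<Phi> \<and>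
     (\<forall>x z y w. (x, z) \<in> \<Phi> \<longrightarrow> (y, w) \<in> \<Phi> \<longrightarrow> (x \<oplus>\<^bsub>M\<^esub> y, z \<oplus>\<^bsub>E\<^esub> w) \<in> \<Phi>) \<and>
     (\<forall>r\<in>carrier R. \<forall>x z. (x, z) \<in> \<Phi> \<longrightarrow> (r \<odot>\<^bsub>M\<^esub> x, r \<odot>\<^bsub>E\<^esub> z) \<in> \<Phi>) \<and>
     (\<forall>x z d. (x, z) \<in> \<Phi> \<longrightarrow> (component M GM x d, component E GE z (d + b)) \<in> \<Phi>) \<and>
     (\<forall>z. (\<zero>\<^bsub>M\<^esub>, z) \<in> \<Phi> \<longrightarrow> z = \<zero>\<^bsub>E\<^esub>)"

lemma linear_graphD:
  assumes "linear_graph R M GM E GE b \<Phi>"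
  shows "\<Phi> \<subseteq> carrier M \<times> carrier E" "(\<zero>\<^bsub>M\<^esub>, \<zero>\<^bsub>E\<^esub>) \<in> \<Phi>"
    "(x, z) \<in> \<Phi> \<Longrightarrow> (y, w) \<in> \<Phi> \<Longrightarrow> (x \<oplus>\<^bsub>M\<^esub> y, z \<oplus>\<^bsub>E\<^esub> w) \<in> \<Phi>"
    "r \<in> carrier R \<Longrightarrow> (x, z) \<in> \<Phi> \<Longrightarrow> (r \<odot>\<^bsub>M\<^esub> x, r \<odot>\<^bsub>E\<^esub> z) \<in> \<Phi>"
    "(x, z) \<in> \<Phi> \<Longrightarrow> (component M GM x d, component E GE z (d + b)) \<in> \<Phi>"
    "(\<zero>\<^bsub>M\<^esub>, z) \<in> \<Phi> \<Longrightarrow> z = \<zero>\<^bsub>E\<^esub>"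
  using assms unfolding linear_graph_def by blast+

lemma (in module) minus_one_smult: "x \<in> carrier M \<Longrightarrow> (\<ominus> \<one>) \<odot>\<^bsub>M\<^esub> x = \<ominus>\<^bsub>M\<^esub> x"
  by (simp add: smult_l_minus)

lemma linear_graph_minus:
  assumes "linear_graph R M GM E GE b \<Phi>" "module R M" "module R E" "(x, z) \<in> \<Phi>"
  shows "(\<ominus>\<^bsub>M\<^esub> x, \<ominus>\<^bsub>E\<^esub> z) \<in> \<Phi>"
proof -
  interpret M: module R M by fact
  interpret E: module R E by fact
  show ?thesis
    using linear_graphD(4)[OF assms(1), of "\<ominus>\<^bsub>R\<^esub> \<one>\<^bsub>R\<^esub>" x z] linear_graphD(1)[OF assms(1)] assms(4)
      M.minus_one_smult[of x] E.minus_one_smult[of z] by auto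
qed

lemma linear_graph_single_valued:
  assumes "linear_graph R M GM E GE b \<Phi>" "module R M" "module R E" "(x, z) \<in> \<Phi>" "(x, w) \<in> \<Phi>"
  shows "z = w"
proof -
  interpret M: module R M by fact
  interpret E: module R E by fact
  have c: "x \<in> carrier M" "z \<in> carrier E" "w \<in> carrier E"
    using linear_graphD(1)[OF assms(1)] assms(4,5) by auto
  have "(x \<oplus>\<^bsub>M\<^esub> \<ominus>\<^bsub>M\<^esub> x, z \<oplus>\<^bsub>E\<^esub> \<ominus>\<^bsub>E\<^esub> w) \<in> \<Phi>"
    using linear_graphD(3)[OF assms(1,4)] linear_graph_minus[OF assms(1-3,5)] by blast
  then have "z \<oplus>\<^bsub>E\<^esub> \<ominus>\<^bsub>E\<^esub> w = \<zero>\<^bsub>E\<^esub>"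
    using linear_graphD(6)[OF assms(1)] c by (simp add: M.M.r_neg)
  then show ?thesis using c using E.M.minus_zero_iff by (simp add: a_minus_def)
qed

text \<open>Compared with \<open>cp_smult\<close> the roles are exchanged: \<open>r\<close> is
  arbitrary and \<open>x\<close> homogeneous. Both sides are additive in \<open>r\<close>.\<close>

lemma (in graded_cring) cp_smult_homog:
  assumes "graded_module R G M GM" "x \<in> GM d" "r \<in> carrier R"
  shows "component M GM (r \<odot>\<^bsub>M\<^esub> x) i = rc r (i - d) \<odot>\<^bsub>M\<^esub> x"
proof -
  interpret M: graded_mod R M G GM using assms(1) by (rule graded_modI)
  have x: "x \<in> carrier M" using assms(2) M.GM_carrier by blast
  have "r \<in> carrier (regular_module R)" using assms(3) by simp
  then show ?thesis
  proof (induction r rule: reg.homog_induct)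
    case (homog r e)
    have "r \<in> carrier R" using homog G_carrier by blast
    then show ?case
      using x homog M.cp_smult[OF x homog, of i]
        by (auto simp: rc_homog M.cp_homog[OF assms(2)] diff_eq_eq algebra_simps)
  qed (use x in \<open>simp_all add: M.smult_l_distr M.cp_add rc_add rc_carrier rc_zero\<close>)
qed

text \<open>The extension step of Baer's criterion: \<open>x\<close> is adjoined to the domain with
  value \<open>e\<close>. By \<open>compat\<close>, \<open>e\<close> reproduces the values that
  \<open>\<Psi>\<close> already takes on multiples of \<open>x\<close>, which keeps the enlarged
  relation single-valued.\<close>

lemma (in graded_cring) linear_graph_extend:
  assumes M: "graded_module R G M GM" and E: "graded_module R G E GE"
    and \<Psi>: "linear_graph R M GM E GE b \<Psi>"
    and x: "x \<in> GM d" and e: "e \<in> GE (d + b)"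
    and compat: "\<And>r z. r \<in> carrier R \<Longrightarrow> (r \<odot>\<^bsub>M\<^esub> x, z) \<in> \<Psi> \<Longrightarrow> z = r \<odot>\<^bsub>E\<^esub> e"
  defines "\<Phi> \<equiv> {(v \<oplus>\<^bsub>M\<^esub> r \<odot>\<^bsub>M\<^esub> x, z \<oplus>\<^bsub>E\<^esub> r \<odot>\<^bsub>E\<^esub> e) |v z r. (v, z) \<in> \<Psi> \<and> r \<in> carrier R}"
  shows "linear_graph R M GM E GE b \<Phi>" "\<Psi> \<subseteq> \<Phi>" "(x, e) \<in> \<Phi>"
proof -
  interpret M: graded_mod R M G GM using M by (rule graded_modI)
  interpret E: graded_mod R E G GE using E by (rule graded_modI)
  note D = linear_graphD[OF \<Psi>]
  have xc [simp]: "x \<in> carrier M" and ec [simp]: "e \<in> carrier E"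
    using x e M.GM_carrier E.GM_carrier by auto
  have \<Psi>c: "v \<in> carrier M \<and> z \<in> carrier E" if "(v, z) \<in> \<Psi>" for v z using D(1) that by blast
  have I: "(v \<oplus>\<^bsub>M\<^esub> r \<odot>\<^bsub>M\<^esub> x, z \<oplus>\<^bsub>E\<^esub> r \<odot>\<^bsub>E\<^esub> e) \<in> \<Phi>" if "(v, z) \<in> \<Psi>" "r \<in> carrier R" for v z r
    unfolding \<Phi>_def using that by blast
  show "\<Psi> \<subseteq> \<Phi>"
  proof
    fix p assume "p \<in> \<Psi>"
    then obtain v z where p: "p = (v, z)" "(v, z) \<in> \<Psi>" by (cases p) auto
    show "p \<in> \<Phi>" using I[OF p(2) R.zero_closed] \<Psi>c[OF p(2)] p by simp
  qed
  show "(x, e) \<in> \<Phi>" using I[OF D(2) R.one_closed] by simp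
  have "(u \<oplus>\<^bsub>M\<^esub> v, z \<oplus>\<^bsub>E\<^esub> w) \<in> \<Phi>" if "(u, z) \<in> \<Phi>" "(v, w) \<in> \<Phi>" for u z v w
  proof -
    from that obtain u' z' r v' w' s where *: "u = u' \<oplus>\<^bsub>M\<^esub> r \<odot>\<^bsub>M\<^esub> x" "z = z' \<oplus>\<^bsub>E\<^esub> r \<odot>\<^bsub>E\<^esub> e"
      "(u', z') \<in> \<Psi>" "r \<in> carrier R" "v = v' \<oplus>\<^bsub>M\<^esub> s \<odot>\<^bsub>M\<^esub> x" "w = w' \<oplus>\<^bsub>E\<^esub> s \<odot>\<^bsub>E\<^esub> e"
      "(v', w') \<in> \<Psi>" "s \<in> carrier R" unfolding \<Phi>_def by blast
    have "u \<oplus>\<^bsub>M\<^esub> v = (u' \<oplus>\<^bsub>M\<^esub> v') \<oplus>\<^bsub>M\<^esub> (r \<oplus> s) \<odot>\<^bsub>M\<^esub> x"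
      "z \<oplus>\<^bsub>E\<^esub> w = (z' \<oplus>\<^bsub>E\<^esub> w') \<oplus>\<^bsub>E\<^esub> (r \<oplus> s) \<odot>\<^bsub>E\<^esub> e"
      using * \<Psi>c by (simp_all add: M.smult_l_distr E.smult_l_distr M.M.a_ac E.M.a_ac)
    then show ?thesis using I[OF D(3)[OF *(3,7)], of "r \<oplus> s"] * by simp
  qed
  moreover have "(s \<odot>\<^bsub>M\<^esub> u, s \<odot>\<^bsub>E\<^esub> z) \<in> \<Phi>" if "(u, z) \<in> \<Phi>" "s \<in> carrier R" for u z s
  proof -
    from that obtain u' z' r where *: "u = u' \<oplus>\<^bsub>M\<^esub> r \<odot>\<^bsub>M\<^esub> x" "z = z' \<oplus>\<^bsub>E\<^esub> r \<odot>\<^bsub>E\<^esub> e"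
      "(u', z') \<in> \<Psi>" "r \<in> carrier R" unfolding \<Phi>_def by blast
    have "s \<odot>\<^bsub>M\<^esub> u = s \<odot>\<^bsub>M\<^esub> u' \<oplus>\<^bsub>M\<^esub> (s \<otimes> r) \<odot>\<^bsub>M\<^esub> x" "s \<odot>\<^bsub>E\<^esub> z = s \<odot>\<^bsub>E\<^esub> z' \<oplus>\<^bsub>E\<^esub> (s \<otimes> r) \<odot>\<^bsub>E\<^esub> e"
      using * \<Psi>c that
        by (simp_all add: M.smult_r_distr E.smult_r_distr M.smult_assoc1 E.smult_assoc1)
    then show ?thesis using I[OF D(4)[OF that(2) *(3)], of "s \<otimes> r"] * that by simp
  qed
  moreover have "(component M GM u i, component E GE z (i + b)) \<in> \<Phi>" if "(u, z) \<in> \<Phi>" for u z i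
  proof -
    from that obtain u' z' r where *: "u = u' \<oplus>\<^bsub>M\<^esub> r \<odot>\<^bsub>M\<^esub> x" "z = z' \<oplus>\<^bsub>E\<^esub> r \<odot>\<^bsub>E\<^esub> e"
      "(u', z') \<in> \<Psi>" "r \<in> carrier R" unfolding \<Phi>_def by blast
    have "component M GM u i = component M GM u' i \<oplus>\<^bsub>M\<^esub> rc r (i - d) \<odot>\<^bsub>M\<^esub> x"
      using * \<Psi>c M.cp_add cp_smult_homog[OF M x *(4)] by simp
    moreover have "component E GE z (i + b) = component E GE z' (i + b) \<oplus>\<^bsub>E\<^esub> rc r (i - d) \<odot>\<^bsub>E\<^esub> e"
      using * \<Psi>c E.cp_add cp_smult_homog[OF E e *(4), of "i + b"] by simp
    ultimately show ?thesis using I[OF D(5)[OF *(3)]] *(4) rc_carrier by simp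
  qed
  moreover have "z = \<zero>\<^bsub>E\<^esub>" if "(\<zero>\<^bsub>M\<^esub>, z) \<in> \<Phi>" for z
  proof -
    from that obtain u z' r where *: "\<zero>\<^bsub>M\<^esub> = u \<oplus>\<^bsub>M\<^esub> r \<odot>\<^bsub>M\<^esub> x" "z = z' \<oplus>\<^bsub>E\<^esub> r \<odot>\<^bsub>E\<^esub> e"
      "(u, z') \<in> \<Psi>" "r \<in> carrier R" unfolding \<Phi>_def by blast
    \<comment> \<open>If \<open>u + r x = 0\<close>, then \<open>r x = - u\<close> is in the domain
      of \<open>\<Psi>\<close> with value \<open>- z'\<close>, and \<open>compat\<close> identifies
      this value with \<open>r e\<close>.\<close>
    have "r \<odot>\<^bsub>M\<^esub> x = \<ominus>\<^bsub>M\<^esub> u" using * \<Psi>c by (metis M.M.minus_equality M.M.a_comm M.smult_closed xc)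
    then have "\<ominus>\<^bsub>E\<^esub> z' = r \<odot>\<^bsub>E\<^esub> e"
      using linear_graph_minus[OF \<Psi> M.module_axioms E.module_axioms *(3)] compat *(4) by simp
    then show ?thesis using * \<Psi>c by (metis E.M.r_neg)
  qed
  moreover have "\<Phi> \<subseteq> carrier M \<times> carrier E" unfolding \<Phi>_def using \<Psi>c by auto
  ultimately show "linear_graph R M GM E GE b \<Phi>"
    unfolding linear_graph_def using \<open>\<Psi> \<subseteq> \<Phi>\<close> D(2) by blast
qed

lemma mod_homD:
  assumes "f \<in> mod_hom R M N"
  shows "f \<in> carrier M \<rightarrow>\<^sub>E carrier N" "x \<in> carrier M \<Longrightarrow> f x \<in> carrier N"
    "x \<in> carrier M \<Longrightarrow> y \<in> carrier M \<Longrightarrow> f (x \<oplus>\<^bsub>M\<^esub> y) = f x \<oplus>\<^bsub>N\<^esub> f y"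
    "r \<in> carrier R \<Longrightarrow> x \<in> carrier M \<Longrightarrow> f (r \<odot>\<^bsub>M\<^esub> x) = r \<odot>\<^bsub>N\<^esub> f x"
  using assms unfolding mod_hom_def by auto

lemma mod_hom_zero:
  assumes "f \<in> mod_hom R M N" "module R M" "module R N"
  shows "f \<zero>\<^bsub>M\<^esub> = \<zero>\<^bsub>N\<^esub>"
proof -
  interpret M: module R M by fact
  interpret N: module R N by fact
  have "f (\<zero>\<^bsub>R\<^esub> \<odot>\<^bsub>M\<^esub> \<zero>\<^bsub>M\<^esub>) = \<zero>\<^bsub>R\<^esub> \<odot>\<^bsub>N\<^esub> f \<zero>\<^bsub>M\<^esub>"
    by (rule mod_homD(4)[OF assms(1)]) auto
  then show ?thesis using mod_homD(2)[OF assms(1), of "\<zero>\<^bsub>M\<^esub>"] by simp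
qed

lemma mod_hom_minus:
  assumes "f \<in> mod_hom R M N" "module R M" "module R N" "x \<in> carrier M"
  shows "f (\<ominus>\<^bsub>M\<^esub> x) = \<ominus>\<^bsub>N\<^esub> f x"
proof -
  interpret M: module R M by fact
  interpret N: module R N by fact
  have "f ((\<ominus>\<^bsub>R\<^esub> \<one>\<^bsub>R\<^esub>) \<odot>\<^bsub>M\<^esub> x) = (\<ominus>\<^bsub>R\<^esub> \<one>\<^bsub>R\<^esub>) \<odot>\<^bsub>N\<^esub> f x" using mod_homD[OF assms(1)] assms(4) by simp
  then show ?thesis using mod_homD(2)[OF assms(1,4)] assms(4)
    by (simp add: M.minus_one_smult N.minus_one_smult)
qed

lemma hom_of_degreeD:
  assumes "f \<in> hom_of_degree R M GM N GN a"
  shows "f \<in> mod_hom R M N" "x \<in> GM d \<Longrightarrow> f x \<in> GN (d + a)"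
  using assms unfolding hom_of_degree_def by auto

lemma (in graded_cring) hom_component:
  assumes "graded_module R G M GM" "graded_module R G N GN" "f \<in> hom_of_degree R M GM N GN a"
    and "x \<in> carrier M"
  shows "component N GN (f x) (d + a) = f (component M GM x d)"
proof -
  interpret M: graded_mod R M G GM using assms(1) by (rule graded_modI)
  interpret N: graded_mod R N G GN using assms(2) by (rule graded_modI)
  note f = hom_of_degreeD[OF assms(3)]
  show ?thesis using assms(4)
  proof (induction x rule: M.homog_induct)
    case (homog x e)
    have "M.cp x d = (if d = e then x else \<zero>\<^bsub>M\<^esub>)" "N.cp (f x) (d + a) = (if d = e then f x else \<zero>\<^bsub>N\<^esub>)"
      using M.cp_homog[OF homog] N.cp_homog[OF f(2)[OF homog]] by auto
    then show ?case using mod_hom_zero[OF f(1) M.module_axioms N.module_axioms] by simp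
  qed (simp_all add: mod_hom_zero[OF f(1) M.module_axioms N.module_axioms] M.cp_add N.cp_add mod_homD[OF f(1)])
qed

subsection \<open>Graded injective modules\<close>

context graded_cring
begin

text \<open>The domain of the graph is a homogeneous ideal, hence a test module in the type of the
  ring once its grading is shifted by \<open>b\<close>. The element \<open>e\<close> is the image of
  1 under the extension to \<open>R\<close>.\<close>

lemma star_injective_baer:
  assumes inj: "star_injective R G E GE"
    and \<Phi>: "linear_graph R (regular_module R) G E GE b \<Phi>"
  shows "\<exists>e\<in>GE b. \<forall>(r, z)\<in>\<Phi>. z = r \<odot>\<^bsub>E\<^esub> e"
proof -
  have Egr: "graded_module R G E GE" using inj unfolding star_injective_def by blast
  interpret E: graded_mod R E G GE using Egr by (rule graded_modI)
  note D = linear_graphD[OF \<Phi>, simplified]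
  note sv = linear_graph_single_valued[OF \<Phi> reg.module_axioms E.module_axioms]
  define U where "U = fst ` \<Phi>"
  have Uc: "U \<subseteq> carrier R" unfolding U_def using D(1) by auto
  have UI: "r \<in> U \<longleftrightarrow> (\<exists>z. (r, z) \<in> \<Phi>)" for r unfolding U_def by force
  have U: "submodule U R (regular_module R)"
  proof (rule reg.submoduleI)
    show "\<ominus>\<^bsub>regular_module R\<^esub> a \<in> U" if "a \<in> U" for a
      using linear_graph_minus[OF \<Phi> reg.module_axioms E.module_axioms] that UI by blast
    show "\<zero>\<^bsub>regular_module R\<^esub> \<in> U" using D(2) UI by auto
    show "a \<oplus>\<^bsub>regular_module R\<^esub> b \<in> U" if "a \<in> U" "b \<in> U" for a b
      using D(3) that UI by (metis regular_simps(3))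
    show "r \<odot>\<^bsub>regular_module R\<^esub> a \<in> U" if "r \<in> carrier R" "a \<in> U" for r a
      using D(4) that UI by (metis regular_simps(4))
  qed (use Uc in simp)
  have Ucl: "rc x d \<in> U" if "x \<in> U" for x d using D(5) that unfolding UI by blast
  define M where "M = (regular_module R)\<lparr>carrier := U\<rparr>"
  have Gc: "G d \<subseteq> carrier R" for d using G_carrier by blast
  have Mgr: "graded_module R G M (\<lambda>d. U \<inter> G (d - b))"
    unfolding M_def by (rule reg.graded_module_shift[OF U Ucl Gc])
  have Ngr: "graded_module R G (regular_module R) (\<lambda>d. G (d - b))"
    using reg.graded_module_shift[OF reg.carrier_is_submodule _ Gc, of b] Gc rc_carrier
    by (simp add: Int_absorb1 regular_module_def)
  define g where "g = (\<lambda>r\<in>U. THE z. (r, z) \<in> \<Phi>)"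
  have g: "(r, g r) \<in> \<Phi>" if r: "r \<in> U" for r
  proof -
    have "\<exists>!z. (r, z) \<in> \<Phi>" using r UI sv by blast
    then show ?thesis unfolding g_def using r theI'[of "\<lambda>z. (r, z) \<in> \<Phi>"] by auto
  qed
  have geq: "g r = z" if "(r, z) \<in> \<Phi>" for r z using g[of r] sv that UI by blast
  have g_hom: "g \<in> mod_hom R M E"
    unfolding mod_hom_def
  proof (intro CollectI conjI ballI)
    show "g \<in> carrier M \<rightarrow>\<^sub>E carrier E" using g D(1) by (auto simp: g_def M_def)
    show "g (x \<oplus>\<^bsub>M\<^esub> y) = g x \<oplus>\<^bsub>E\<^esub> g y" if "x \<in> carrier M" "y \<in> carrier M" for x y
      using geq[OF D(3)[OF g g]] that by (simp add: M_def)
    show "g (r \<odot>\<^bsub>M\<^esub> x) = r \<odot>\<^bsub>E\<^esub> g x" if "r \<in> carrier R" "x \<in> carrier M" for r x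
      using geq[OF D(4)[OF _ g]] that by (simp add: M_def)
  qed
  \<comment> \<open>The graph is closed under components, so single-valuedness forces the value at a
    homogeneous element to be homogeneous.\<close>
  have g_deg: "g r \<in> GE d" if "r \<in> U \<inter> G (d - b)" for r d
  proof -
    have "(rc r (d - b), component E GE (g r) (d - b + b)) \<in> \<Phi>" using D(5)[OF g, of r "d - b"] that
      by simp
    moreover have "rc r (d - b) = r" using that rc_homog by auto
    ultimately have "g r = component E GE (g r) d" using geq[of r "component E GE (g r) d"] by simp
    then show ?thesis using E.cp_in[of "g r" d] g[of r] that D(1) by auto
  qed
  have "g \<in> hom_of_degree R M (\<lambda>d. U \<inter> G (d - b)) E GE 0"
    unfolding hom_of_degree_def using g_hom g_deg by auto
  moreover have "(\<lambda>r\<in>U. r) \<in> hom_of_degree R M (\<lambda>d. U \<inter> G (d - b)) (regular_module R) (\<lambda>d. G (d - b)) 0"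
    unfolding hom_of_degree_def mod_hom_def M_def using Uc reg.submoduleE[OF U] by auto
  moreover have "inj_on (\<lambda>r\<in>U. r) (carrier M)" unfolding M_def by (auto simp: inj_on_def)
  ultimately obtain h where h: "h \<in> hom_of_degree R (regular_module R) (\<lambda>d. G (d - b)) E GE 0"
    "\<forall>x\<in>carrier M. h ((\<lambda>r\<in>U. r) x) = g x"
    using inj Mgr Ngr unfolding star_injective_def by blast
  have "h \<one> \<in> GE b" using hom_of_degreeD(2)[OF h(1), of \<one> b] one_degree by simp
  moreover have "z = r \<odot>\<^bsub>E\<^esub> h \<one>" if "(r, z) \<in> \<Phi>" for r z
  proof -
    have r: "r \<in> U" "r \<in> carrier R" using that Uc UI by auto
    have "z = h r" using h(2) r geq[OF that] unfolding M_def by simp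
    also have "\<dots> = h (r \<otimes> \<one>)" using r by simp
    also have "\<dots> = r \<odot>\<^bsub>E\<^esub> h \<one>" using mod_homD(4)[OF hom_of_degreeD(1)[OF h(1)], of r \<one>] r by simp
    finally show ?thesis .
  qed
  ultimately show ?thesis by blast
qed

text \<open>Here \<open>M\<close> may have any type, in contrast to the test modules of the
  definition. Zorn's lemma gives a maximal graph; Baer's criterion, applied to the multipliers of a
  homogeneous \<open>x\<close> into its domain, supplies a value at \<open>x\<close>, so maximality
  makes the domain everything.\<close>

lemma star_injective_extend:
  assumes inj: "star_injective R G E GE" and M: "graded_module R G M GM"
    and \<Phi>: "linear_graph R M GM E GE b \<Phi>"
  shows "\<exists>\<phi>\<in>hom_of_degree R M GM E GE b. \<forall>(x, z)\<in>\<Phi>. \<phi> x = z"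
proof -
  have E: "graded_module R G E GE" using inj unfolding star_injective_def by blast
  interpret M: graded_mod R M G GM using M by (rule graded_modI)
  interpret E: graded_mod R E G GE using E by (rule graded_modI)
  let ?A = "{\<Psi>. linear_graph R M GM E GE b \<Psi> \<and> \<Phi> \<subseteq> \<Psi>}"
  have "\<exists>\<Psi>\<in>?A. \<forall>X\<in>?A. \<Psi> \<subseteq> X \<longrightarrow> X = \<Psi>"
  proof (rule subset_Zorn_nonempty)
    show "?A \<noteq> {}" using \<Phi> by blast
  next
    fix \<C> assume ne: "\<C> \<noteq> {}" and ch: "subset.chain ?A \<C>"
    have C: "linear_graph R M GM E GE b X" "\<Phi> \<subseteq> X" if "X \<in> \<C>" for X
      using ch that unfolding subset_chain_def by auto
    have dir: "\<exists>X\<in>\<C>. p \<in> X \<and> q \<in> X" if "p \<in> \<Union>\<C>" "q \<in> \<Union>\<C>" for p q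
      using that ch unfolding subset_chain_def by blast
    have "linear_graph R M GM E GE b (\<Union>\<C>)"
      unfolding linear_graph_def
    proof (intro conjI allI impI ballI)
      show "\<Union>\<C> \<subseteq> carrier M \<times> carrier E" using linear_graphD(1)[OF C(1)] by blast
      show "(\<zero>\<^bsub>M\<^esub>, \<zero>\<^bsub>E\<^esub>) \<in> \<Union>\<C>" using ne linear_graphD(2)[OF C(1)] by blast
      show "(x \<oplus>\<^bsub>M\<^esub> y, z \<oplus>\<^bsub>E\<^esub> w) \<in> \<Union>\<C>" if "(x, z) \<in> \<Union>\<C>" "(y, w) \<in> \<Union>\<C>" for x y z w
        using dir[OF that] linear_graphD(3)[OF C(1)] by blast
      show "(r \<odot>\<^bsub>M\<^esub> x, r \<odot>\<^bsub>E\<^esub> z) \<in> \<Union>\<C>" if "(x, z) \<in> \<Union>\<C>" "r \<in> carrier R" for x z r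
        using that linear_graphD(4)[OF C(1)] by blast
      show "(M.cp x d, E.cp z (d + b)) \<in> \<Union>\<C>" if "(x, z) \<in> \<Union>\<C>" for x z d
        using that linear_graphD(5)[OF C(1)] by blast
      show "z = \<zero>\<^bsub>E\<^esub>" if "(\<zero>\<^bsub>M\<^esub>, z) \<in> \<Union>\<C>" for z
        using that linear_graphD(6)[OF C(1)] by blast
    qed
    then show "\<Union>\<C> \<in> ?A" using ne C(2) by blast
  qed
  then obtain \<Psi> where \<Psi>: "linear_graph R M GM E GE b \<Psi>" and sub: "\<Phi> \<subseteq> \<Psi>"
    and mx: "\<And>X. linear_graph R M GM E GE b X \<Longrightarrow> \<Psi> \<subseteq> X \<Longrightarrow> X = \<Psi>"
    by (smt (verit, best) mem_Collect_eq order_trans)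
  note D = linear_graphD[OF \<Psi>]
  note sv = linear_graph_single_valued[OF \<Psi> M.module_axioms E.module_axioms]
  have dom_homog: "\<exists>z. (x, z) \<in> \<Psi>" if x: "x \<in> GM d" for x d
  proof -
    have xc: "x \<in> carrier M" using x M.GM_carrier by blast
    \<comment> \<open>The ideal of all \<open>r\<close> with \<open>r x\<close> in the domain of
      \<open>\<Psi>\<close>, each sent to the value at \<open>r x\<close>; as \<open>x\<close> has
      degree \<open>d\<close>, the degree of this map is \<open>d + b\<close>.\<close>
    let ?\<Theta> = "{(r, z). r \<in> carrier R \<and> (r \<odot>\<^bsub>M\<^esub> x, z) \<in> \<Psi>}"
    have "linear_graph R (regular_module R) G E GE (d + b) ?\<Theta>"
      unfolding linear_graph_def
    proof (intro conjI allI impI ballI)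
      show "?\<Theta> \<subseteq> carrier (regular_module R) \<times> carrier E" using D(1) by auto
      show "(\<zero>\<^bsub>regular_module R\<^esub>, \<zero>\<^bsub>E\<^esub>) \<in> ?\<Theta>" using D(2) xc by simp
      show "(r \<oplus>\<^bsub>regular_module R\<^esub> s, z \<oplus>\<^bsub>E\<^esub> w) \<in> ?\<Theta>" if "(r, z) \<in> ?\<Theta>" "(s, w) \<in> ?\<Theta>" for r s z w
        using that D(3) xc by (auto simp: M.smult_l_distr)
      show "(s \<odot>\<^bsub>regular_module R\<^esub> r, s \<odot>\<^bsub>E\<^esub> z) \<in> ?\<Theta>" if "(r, z) \<in> ?\<Theta>" "s \<in> carrier R" for r z s
        using that D(4) xc by (auto simp: M.smult_assoc1)
      show "(rc r i, E.cp z (i + (d + b))) \<in> ?\<Theta>" if "(r, z) \<in> ?\<Theta>" for r z i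
        using that D(5)[of "r \<odot>\<^bsub>M\<^esub> x" z "i + d"] cp_smult_homog[OF M x, of r "i + d"] rc_carrier
        by (auto simp: add.assoc)
      show "z = \<zero>\<^bsub>E\<^esub>" if "(\<zero>\<^bsub>regular_module R\<^esub>, z) \<in> ?\<Theta>" for z
        using that D(6) xc by simp
    qed
    from star_injective_baer[OF inj this]
    obtain e where e: "e \<in> GE (d + b)" "\<And>r z. r \<in> carrier R \<Longrightarrow> (r \<odot>\<^bsub>M\<^esub> x, z) \<in> \<Psi> \<Longrightarrow> z = r \<odot>\<^bsub>E\<^esub> e"
      by blast
    note ext = linear_graph_extend[OF M E \<Psi> x e]
    show ?thesis using mx[OF ext(1,2)] ext(3) by blast
  qed
  have dom: "\<exists>z. (x, z) \<in> \<Psi>" if "x \<in> carrier M" for x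
    using that
  proof (induction x rule: M.homog_induct)
    case zero then show ?case using D(2) by blast
  next
    case (homog x d) then show ?case by (rule dom_homog)
  next
    case (add x y) then show ?case using D(3) by blast
  qed
  define \<phi> where "\<phi> = (\<lambda>x\<in>carrier M. THE z. (x, z) \<in> \<Psi>)"
  have \<phi>: "(x, \<phi> x) \<in> \<Psi>" if x: "x \<in> carrier M" for x
  proof -
    have "\<exists>!z. (x, z) \<in> \<Psi>" using dom[OF x] sv by blast
    then show ?thesis unfolding \<phi>_def using x theI'[of "\<lambda>z. (x, z) \<in> \<Psi>"] by auto
  qed
  have eq: "\<phi> x = z" if "(x, z) \<in> \<Psi>" for x z
    using that sv[OF \<phi> that] D(1) by blast
  have hom: "\<phi> \<in> mod_hom R M E"
    unfolding mod_hom_def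
  proof (intro CollectI conjI ballI)
    show "\<phi> \<in> carrier M \<rightarrow>\<^sub>E carrier E" using \<phi> D(1) by (auto simp: \<phi>_def)
    show "\<phi> (x \<oplus>\<^bsub>M\<^esub> y) = \<phi> x \<oplus>\<^bsub>E\<^esub> \<phi> y" if "x \<in> carrier M" "y \<in> carrier M" for x y
      using eq[OF D(3)[OF \<phi> \<phi>]] that by simp
    show "\<phi> (r \<odot>\<^bsub>M\<^esub> x) = r \<odot>\<^bsub>E\<^esub> \<phi> x" if "r \<in> carrier R" "x \<in> carrier M" for r x
      using eq[OF D(4)[OF _ \<phi>]] that by simp
  qed
  have "\<phi> x \<in> GE (d + b)" if x: "x \<in> GM d" for x d
  proof -
    have xc: "x \<in> carrier M" using x M.GM_carrier by blast
    have "(x, E.cp (\<phi> x) (d + b)) \<in> \<Psi>" using D(5)[OF \<phi>[OF xc], of d] M.cp_homog[OF x] by simp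
    from eq[OF this] show ?thesis using E.cp_in[of "\<phi> x" "d + b"] mod_homD(2)[OF hom xc] by simp
  qed
  then have "\<phi> \<in> hom_of_degree R M GM E GE b" using hom unfolding hom_of_degree_def by auto
  then show ?thesis using eq sub by blast
qed

lemma homogeneous_pow:
  assumes "f \<in> homogeneous_elements G" shows "f [^] (n::nat) \<in> homogeneous_elements G"
  using assms G_pow unfolding homogeneous_elements_def by blast

end

text \<open>If \<open>F\<close> generates the ideal \<open>I\<close>, this is the \<open>I\<close>-torsion part.  In contrast to powers of \<open>I\<close>, the
  elements of \<open>F\<close> can be treated one at a time.\<close>

definition tors :: "('r, 'x) ring_scheme \<Rightarrow> 'r set \<Rightarrow> ('r, 'm, 'y) module_scheme \<Rightarrow> 'm set" where
  "tors R F M = {x \<in> carrier M. \<forall>f\<in>F. \<exists>n::nat. (f [^]\<^bsub>R\<^esub> n) \<odot>\<^bsub>M\<^esub> x = \<zero>\<^bsub>M\<^esub>}"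

section \<open>Torsion with respect to sets of elements, and division in graded injective
  modules\<close>

context module
begin

lemma smult_pow_le:
  assumes "f \<in> carrier R" "x \<in> carrier M" "(f [^] n) \<odot>\<^bsub>M\<^esub> x = \<zero>\<^bsub>M\<^esub>" "n \<le> (m::nat)"
  shows "(f [^] m) \<odot>\<^bsub>M\<^esub> x = \<zero>\<^bsub>M\<^esub>"
proof -
  have "f [^] m = f [^] (m - n) \<otimes> f [^] n" using assms by (simp add: R.nat_pow_mult)
  then show ?thesis using assms by (simp add: smult_assoc1)
qed

lemma smult_swap:
  assumes "r \<in> carrier R" "s \<in> carrier R" "x \<in> carrier M"
  shows "r \<odot>\<^bsub>M\<^esub> (s \<odot>\<^bsub>M\<^esub> x) = s \<odot>\<^bsub>M\<^esub> (r \<odot>\<^bsub>M\<^esub> x)"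
  using assms by (metis smult_assoc1 R.m_comm)

lemma submodule_tors:
  assumes "F \<subseteq> carrier R" shows "submodule (tors R F M) R M"
proof (rule submoduleI)
  fix x y assume "x \<in> tors R F M" "y \<in> tors R F M"
  then have xy: "x \<in> carrier M" "y \<in> carrier M" "\<forall>f\<in>F. \<exists>n::nat. (f [^] n) \<odot>\<^bsub>M\<^esub> x = \<zero>\<^bsub>M\<^esub>"
    "\<forall>f\<in>F. \<exists>n::nat. (f [^] n) \<odot>\<^bsub>M\<^esub> y = \<zero>\<^bsub>M\<^esub>" unfolding tors_def by auto
  have "\<exists>n::nat. (f [^] n) \<odot>\<^bsub>M\<^esub> (x \<oplus>\<^bsub>M\<^esub> y) = \<zero>\<^bsub>M\<^esub>" if f: "f \<in> F" for f
  proof -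
    obtain n m :: nat where "(f [^] n) \<odot>\<^bsub>M\<^esub> x = \<zero>\<^bsub>M\<^esub>" "(f [^] m) \<odot>\<^bsub>M\<^esub> y = \<zero>\<^bsub>M\<^esub>"
      using bspec[OF xy(3) f] bspec[OF xy(4) f] by auto
    then have "(f [^] max n m) \<odot>\<^bsub>M\<^esub> x = \<zero>\<^bsub>M\<^esub>" "(f [^] max n m) \<odot>\<^bsub>M\<^esub> y = \<zero>\<^bsub>M\<^esub>"
      using smult_pow_le[OF subsetD[OF assms f] xy(1), of n "max n m"]
        smult_pow_le[OF subsetD[OF assms f] xy(2), of m "max n m"] by auto
    then show ?thesis using xy subsetD[OF assms f]
      by (auto simp: smult_r_distr intro: exI[of _ "max n m"])
  qed
  then show "x \<oplus>\<^bsub>M\<^esub> y \<in> tors R F M" using xy unfolding tors_def by simp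
next
  fix x assume "x \<in> tors R F M"
  then show "\<ominus>\<^bsub>M\<^esub> x \<in> tors R F M"
    using assms unfolding tors_def by (force simp: smult_r_minus subset_iff)
next
  fix a x assume "a \<in> carrier R" "x \<in> tors R F M"
  then show "a \<odot>\<^bsub>M\<^esub> x \<in> tors R F M"
    using assms smult_swap[of _ a x] unfolding tors_def subset_iff
      by simp (metis R.nat_pow_closed smult_r_null)
qed (use assms in \<open>auto simp: tors_def subset_iff\<close>)

lemma ideal_annihilator:
  assumes y: "y \<in> carrier M" shows "ideal (annihilator R M y) R"
proof (rule idealI)
  have "annihilator R M y \<noteq> {}" unfolding annihilator_def using y by force
  moreover have "\<ominus> a \<in> annihilator R M y" if "a \<in> annihilator R M y" for a
    using that y by (simp add: annihilator_def smult_l_minus)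
  moreover have "a \<oplus> b \<in> annihilator R M y" if "a \<in> annihilator R M y" "b \<in> annihilator R M y" for a b
    using that y by (simp add: annihilator_def smult_l_distr)
  ultimately show "subgroup (annihilator R M y) (add_monoid R)"
    using R.add.subgroupI[of "annihilator R M y"] unfolding a_inv_def
      by (auto simp: annihilator_def)
  show *: "x \<otimes> a \<in> annihilator R M y" if "a \<in> annihilator R M y" "x \<in> carrier R" for a x
    using that y by (simp add: annihilator_def smult_assoc1)
  show "a \<otimes> x \<in> annihilator R M y" if "a \<in> annihilator R M y" "x \<in> carrier R" for a x
    using *[OF that] that by (simp add: annihilator_def R.m_comm)
qed (rule R.ring_axioms)

end

text \<open>Powers of homogeneous elements merely shift degrees, so \<open>f^n x = 0\<close> can be
  read off component by component.\<close>

lemma (in graded_cring) tors_component: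
  assumes M: "graded_module R G M GM" and "F \<subseteq> homogeneous_elements G" "x \<in> tors R F M"
  shows "component M GM x d \<in> tors R F M"
proof -
  interpret M: graded_mod R M G GM using M by (rule graded_modI)
  have x: "x \<in> carrier M" using assms(3) unfolding tors_def by blast
  have "\<exists>n::nat. (f [^] n) \<odot>\<^bsub>M\<^esub> M.cp x d = \<zero>\<^bsub>M\<^esub>" if f: "f \<in> F" for f
  proof -
    obtain n :: nat where n: "(f [^] n) \<odot>\<^bsub>M\<^esub> x = \<zero>\<^bsub>M\<^esub>" using assms(3) f unfolding tors_def by auto
    obtain e where e: "f [^] n \<in> G e" using homogeneous_pow[of f n] assms(2) f
      unfolding homogeneous_elements_def by auto
    show ?thesis using M.cp_smult[OF x e G_carrier[OF e], of "d + e"] n by auto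
  qed
  then show ?thesis using x unfolding tors_def by simp
qed

text \<open>Noetherianity as the maximal condition: this form passes directly to quotient rings and
  is applied to colon ideals, annihilators and finitely generated ideals.\<close>

locale noeth_graded_cring = graded_cring +
  assumes noeth: "\<A> \<noteq> {} \<Longrightarrow> (\<And>J. J \<in> \<A> \<Longrightarrow> ideal J R) \<Longrightarrow> \<exists>J\<in>\<A>. \<forall>K\<in>\<A>. J \<subseteq> K \<longrightarrow> K = J"
begin

text \<open>The colon ideals \<open>(I : f^k)\<close> form an ascending chain; \<open>k\<close> is
  the index of a maximal one.\<close>

lemma colon_stabilizes:
  assumes I: "ideal I R" and f: "f \<in> carrier R"
  shows "\<exists>k::nat. \<forall>r\<in>carrier R. r \<otimes> f [^] Suc k \<in> I \<longrightarrow> r \<otimes> f [^] k \<in> I"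
proof -
  interpret I: ideal I R by fact
  define q where "q k = {r \<in> carrier R. r \<otimes> f [^] (k::nat) \<in> I}" for k
  have "ideal (q k) R" for k
  proof (rule idealI)
    have "\<zero> \<in> q k" unfolding q_def using f I.zero_closed by simp
    moreover have "\<ominus> a \<in> q k" if "a \<in> q k" for a
      using that f I.a_inv_closed by (simp add: q_def l_minus)
    moreover have "a \<oplus> b \<in> q k" if "a \<in> q k" "b \<in> q k" for a b
      using that f by (simp add: q_def l_distr)
    ultimately show "subgroup (q k) (add_monoid R)"
      using R.add.subgroupI[of "q k"] unfolding a_inv_def by (auto simp: q_def)
    show *: "x \<otimes> a \<in> q k" if "a \<in> q k" "x \<in> carrier R" for a x
      using that f I.I_l_closed[of "a \<otimes> f [^] k" x] by (simp add: q_def m_assoc)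
    show "a \<otimes> x \<in> q k" if "a \<in> q k" "x \<in> carrier R" for a x
      using *[OF that] that by (simp add: q_def m_comm)
  qed (rule R.ring_axioms)
  then have "\<exists>J\<in>range q. \<forall>K\<in>range q. J \<subseteq> K \<longrightarrow> K = J" by (intro noeth) auto
  then obtain k where k: "\<And>K. K \<in> range q \<Longrightarrow> q k \<subseteq> K \<Longrightarrow> K = q k" by auto
  have "q k \<subseteq> q (Suc k)"
    unfolding q_def using f I.I_r_closed by (auto simp: m_assoc[symmetric])
  then have "q (Suc k) = q k" using k by blast
  then show ?thesis unfolding q_def by blast
qed

text \<open>Surjectivity of the localization of a graded injective module at \<open>f\<close>, on
  homogeneous elements: \<open>y'\<close> plays the role of \<open>y / f\<close>. The inclusion of
  annihilators keeps \<open>y'\<close> in every torsion part that contains \<open>y\<close>, so that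
  division is possible inside a layer of the torsion filtration.\<close>

lemma star_injective_divide_homogeneous:
  assumes inj: "star_injective R G E GE" and f: "f \<in> G e" and y: "y \<in> GE d"
  shows "\<exists>y'\<in>carrier E. annihilator R E y \<subseteq> annihilator R E y' \<and>
    (\<exists>k::nat. (f [^] Suc k) \<odot>\<^bsub>E\<^esub> y' = (f [^] k) \<odot>\<^bsub>E\<^esub> y)"
proof -
  have E: "graded_module R G E GE" using inj unfolding star_injective_def by blast
  interpret E: graded_mod R E G GE using E by (rule graded_modI)
  have fc: "f \<in> carrier R" and yc: "y \<in> carrier E" using f y G_carrier E.GM_carrier by auto
  let ?I = "annihilator R E y"
  from colon_stabilizes[OF E.ideal_annihilator[OF yc] fc] obtain k :: nat
    where k: "\<And>r. r \<in> carrier R \<Longrightarrow> r \<otimes> f [^] Suc k \<in> ?I \<Longrightarrow> r \<otimes> f [^] k \<in> ?I" by blast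
  obtain d0 where d0: "f [^] k \<in> G d0" using G_pow[OF f] by blast
  \<comment> \<open>The map to be extended kills \<open>?I = ann y\<close> and sends
    \<open>f^(k+1)\<close> to \<open>f^k y\<close>. It is consistent because
    \<open>r f^(k+1) y = 0\<close> implies \<open>r f^k y = 0\<close> by the choice of
    \<open>k\<close>. Its degree \<open>d - e\<close> is that of \<open>y / f\<close>.\<close>
  let ?\<Psi> = "?I \<times> {\<zero>\<^bsub>E\<^esub>}" and ?b = "d - e"
  have \<Psi>: "linear_graph R (regular_module R) G E GE ?b ?\<Psi>"
    unfolding linear_graph_def
  proof (intro conjI allI impI ballI)
    show "(rc r i, E.cp z (i + ?b)) \<in> ?\<Psi>" if "(r, z) \<in> ?\<Psi>" for r z i
      using cp_smult_homog[OF E y, of r "i + d", symmetric] that rc_carrier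
        by (auto simp: annihilator_def)
  qed (use yc in \<open>auto simp: annihilator_def E.smult_l_distr E.smult_assoc1\<close>)
  have x: "f [^] Suc k \<in> G (e + d0)" using G_mult[OF f d0] fc by (simp add: m_comm)
  have z: "(f [^] k) \<odot>\<^bsub>E\<^esub> y \<in> GE (e + d0 + ?b)" using E.GM_smult[OF d0 y]
    by (simp add: algebra_simps)
  have "z = r \<odot>\<^bsub>E\<^esub> ((f [^] k) \<odot>\<^bsub>E\<^esub> y)" if "r \<in> carrier R" "(r \<odot>\<^bsub>regular_module R\<^esub> (f [^] Suc k), z) \<in> ?\<Psi>" for r z
    using k[OF that(1)] that yc fc by (auto simp: annihilator_def E.smult_assoc1)
  note ext = linear_graph_extend[OF graded_regular E \<Psi> x z this]
  obtain e' where e': "e' \<in> GE ?b"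
    "\<And>r w. (r, w) \<in> {(v \<oplus>\<^bsub>regular_module R\<^esub> r \<odot>\<^bsub>regular_module R\<^esub> f [^] Suc k, z \<oplus>\<^bsub>E\<^esub> r \<odot>\<^bsub>E\<^esub> (f [^] k \<odot>\<^bsub>E\<^esub> y)) |v z r.
      (v, z) \<in> ?\<Psi> \<and> r \<in> carrier R} \<Longrightarrow> w = r \<odot>\<^bsub>E\<^esub> e'"
    using star_injective_baer[OF inj ext(1)] by blast
  have "annihilator R E y \<subseteq> annihilator R E e'"
    using e'(2)[OF subsetD[OF ext(2)]] unfolding annihilator_def by auto
  moreover have "(f [^] Suc k) \<odot>\<^bsub>E\<^esub> e' = (f [^] k) \<odot>\<^bsub>E\<^esub> y" using e'(2)[OF ext(3)] by simp
  ultimately show ?thesis using E.GM_carrier[OF e'(1)] by blast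
qed

text \<open>Written as \<open>f^k (f y' - y) = 0\<close>, the condition on \<open>y'\<close> is
  additive up to taking the larger exponent, so it passes from the components of \<open>y\<close> to
  \<open>y\<close> itself.\<close>

lemma star_injective_divide:
  assumes inj: "star_injective R G E GE" and F: "F \<subseteq> homogeneous_elements G"
    and f: "f \<in> homogeneous_elements G" and y: "y \<in> tors R F E"
  shows "\<exists>y'\<in>tors R F E. \<exists>k::nat. (f [^] k) \<odot>\<^bsub>E\<^esub> ((f \<odot>\<^bsub>E\<^esub> y') \<ominus>\<^bsub>E\<^esub> y) = \<zero>\<^bsub>E\<^esub>"
proof -
  have E: "graded_module R G E GE" using inj unfolding star_injective_def by blast
  interpret E: graded_mod R E G GE using E by (rule graded_modI)
  have Fc: "F \<subseteq> carrier R" and fc: "f \<in> carrier R"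
    using F f G_carrier unfolding homogeneous_elements_def by auto
  have TE: "tors R F E \<subseteq> carrier E" unfolding tors_def by blast
  note TS = E.submoduleE[OF E.submodule_tors[OF Fc]]
  let ?U = "{y \<in> carrier E. \<exists>y'\<in>tors R F E. \<exists>k::nat. (f [^] k) \<odot>\<^bsub>E\<^esub> ((f \<odot>\<^bsub>E\<^esub> y') \<ominus>\<^bsub>E\<^esub> y) = \<zero>\<^bsub>E\<^esub>}"
  have "y \<in> ?U"
  proof (rule E.in_if_cp_in)
    show "y \<in> carrier E" using y TE by blast
    show "E.cp y d \<in> ?U" for d
    proof -
      have t: "E.cp y d \<in> tors R F E" by (rule tors_component[OF E F y])
      obtain e where e: "f \<in> G e" using f unfolding homogeneous_elements_def by blast
      have c: "E.cp y d \<in> carrier E" using t TE by blast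
      obtain y' k where y': "y' \<in> carrier E" "annihilator R E (E.cp y d) \<subseteq> annihilator R E y'"
        "(f [^] Suc k) \<odot>\<^bsub>E\<^esub> y' = (f [^] k) \<odot>\<^bsub>E\<^esub> E.cp y d"
        using star_injective_divide_homogeneous[OF inj e E.cp_in[of y d]] y TE by blast
      have "y' \<in> tors R F E" using t y'(1,2) Fc unfolding tors_def annihilator_def by blast
      moreover have "(f [^] k) \<odot>\<^bsub>E\<^esub> ((f \<odot>\<^bsub>E\<^esub> y') \<ominus>\<^bsub>E\<^esub> E.cp y d) = \<zero>\<^bsub>E\<^esub>"
        using y'(1,3) c fc
          by (simp add: a_minus_def E.smult_r_distr E.smult_r_minus E.smult_assoc1 E.M.r_neg)
      ultimately show ?thesis using c by blast
    qed
    show "\<zero>\<^bsub>E\<^esub> \<in> ?U"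
    proof -
      have "\<zero>\<^bsub>E\<^esub> \<in> tors R F E"
        using E.submodule_tors[OF Fc] subgroup.one_closed[OF submodule.axioms(1)] by fastforce
      moreover have "\<zero>\<^bsub>E\<^esub> \<ominus>\<^bsub>E\<^esub> \<zero>\<^bsub>E\<^esub> = \<zero>\<^bsub>E\<^esub>" by (simp add: E.M.minus_zero_iff)
      ultimately show ?thesis using fc by (auto intro!: bexI[of _ "\<zero>\<^bsub>E\<^esub>"])
    qed
    show "x \<oplus>\<^bsub>E\<^esub> z \<in> ?U" if xz: "x \<in> ?U" "z \<in> ?U" for x z
    proof -
      obtain x' z' and k l :: nat
        where *: "x' \<in> tors R F E" "(f [^] k) \<odot>\<^bsub>E\<^esub> ((f \<odot>\<^bsub>E\<^esub> x') \<ominus>\<^bsub>E\<^esub> x) = \<zero>\<^bsub>E\<^esub>"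
        "z' \<in> tors R F E" "(f [^] l) \<odot>\<^bsub>E\<^esub> ((f \<odot>\<^bsub>E\<^esub> z') \<ominus>\<^bsub>E\<^esub> z) = \<zero>\<^bsub>E\<^esub>" "x \<in> carrier E" "z \<in> carrier E"
        using xz by blast
      have c: "x' \<in> carrier E" "z' \<in> carrier E" using * TE by auto
      have "(f [^] max k l) \<odot>\<^bsub>E\<^esub> ((f \<odot>\<^bsub>E\<^esub> x') \<ominus>\<^bsub>E\<^esub> x) = \<zero>\<^bsub>E\<^esub>"
        by (rule E.smult_pow_le[OF fc _ *(2)]) (use * c fc in auto)
      moreover have "(f [^] max k l) \<odot>\<^bsub>E\<^esub> ((f \<odot>\<^bsub>E\<^esub> z') \<ominus>\<^bsub>E\<^esub> z) = \<zero>\<^bsub>E\<^esub>"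
        by (rule E.smult_pow_le[OF fc _ *(4)]) (use * c fc in auto)
      moreover have "(f \<odot>\<^bsub>E\<^esub> (x' \<oplus>\<^bsub>E\<^esub> z')) \<ominus>\<^bsub>E\<^esub> (x \<oplus>\<^bsub>E\<^esub> z) =
        ((f \<odot>\<^bsub>E\<^esub> x') \<ominus>\<^bsub>E\<^esub> x) \<oplus>\<^bsub>E\<^esub> ((f \<odot>\<^bsub>E\<^esub> z') \<ominus>\<^bsub>E\<^esub> z)"
        using * c fc by (simp add: E.smult_r_distr E.M.minus_add_distrib)
      ultimately have "(f [^] max k l) \<odot>\<^bsub>E\<^esub> ((f \<odot>\<^bsub>E\<^esub> (x' \<oplus>\<^bsub>E\<^esub> z')) \<ominus>\<^bsub>E\<^esub> (x \<oplus>\<^bsub>E\<^esub> z)) = \<zero>\<^bsub>E\<^esub>"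
        using * c fc by (simp add: E.smult_r_distr)
      then show ?thesis using TS(5)[OF *(1,3)] * by blast
    qed
  qed blast
  then show ?thesis by blast
qed

end

section \<open>Iterated mapping cones\<close>

lemma (in abelian_group) add_cancel_rearrange:
  assumes "p \<in> carrier G" "q \<in> carrier G" "b \<in> carrier G" "c \<in> carrier G"
  shows "p \<oplus> b \<oplus> q = (p \<oplus> (q \<oplus> (b \<oplus> c))) \<oplus> \<ominus> c"
proof -
  have "(p \<oplus> (q \<oplus> (b \<oplus> c))) \<oplus> \<ominus> c = p \<oplus> (q \<oplus> (b \<oplus> (c \<oplus> \<ominus> c)))"
    using assms by (simp add: a_assoc del: r_neg)
  then show ?thesis using assms by (simp add: r_neg a_ac)
qed

text \<open>Every cone doubles the components of an element; binary trees give all iterated cones the same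
  type, so that one can induct on the number of cones.\<close>

datatype 'c tree = Leaf (leaf: 'c) | Node (left: "'c tree") (right: "'c tree")

definition leaf_module :: "('r, 'c) module \<Rightarrow> ('r, 'c tree) module" where
  "leaf_module M = \<lparr>carrier = Leaf ` carrier M, mult = undefined, one = undefined,
     zero = Leaf \<zero>\<^bsub>M\<^esub>, add = (\<lambda>u v. Leaf (leaf u \<oplus>\<^bsub>M\<^esub> leaf v)), smult = (\<lambda>r u. Leaf (r \<odot>\<^bsub>M\<^esub> leaf u))\<rparr>"

definition node_module :: "('r, 'c tree) module \<Rightarrow> ('r, 'c tree) module \<Rightarrow> ('r, 'c tree) module" where
  "node_module M N = \<lparr>carrier = {Node u v |u v. u \<in> carrier M \<and> v \<in> carrier N},
     mult = undefined, one = undefined, zero = Node \<zero>\<^bsub>M\<^esub> \<zero>\<^bsub>N\<^esub>,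
     add = (\<lambda>u v. Node (left u \<oplus>\<^bsub>M\<^esub> left v) (right u \<oplus>\<^bsub>N\<^esub> right v)),
     smult = (\<lambda>r u. Node (r \<odot>\<^bsub>M\<^esub> left u) (r \<odot>\<^bsub>N\<^esub> right u))\<rparr>"

lemma leaf_module_simps [simp]:
  "Leaf x \<in> carrier (leaf_module M) \<longleftrightarrow> x \<in> carrier M"
  "\<zero>\<^bsub>leaf_module M\<^esub> = Leaf \<zero>\<^bsub>M\<^esub>" "Leaf x \<oplus>\<^bsub>leaf_module M\<^esub> Leaf y = Leaf (x \<oplus>\<^bsub>M\<^esub> y)"
  "r \<odot>\<^bsub>leaf_module M\<^esub> Leaf x = Leaf (r \<odot>\<^bsub>M\<^esub> x)"
  by (auto simp: leaf_module_def)

lemma node_module_simps [simp]: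
  "Node u v \<in> carrier (node_module M N) \<longleftrightarrow> u \<in> carrier M \<and> v \<in> carrier N"
  "\<zero>\<^bsub>node_module M N\<^esub> = Node \<zero>\<^bsub>M\<^esub> \<zero>\<^bsub>N\<^esub>"
  "Node u v \<oplus>\<^bsub>node_module M N\<^esub> Node u' v' = Node (u \<oplus>\<^bsub>M\<^esub> u') (v \<oplus>\<^bsub>N\<^esub> v')"
  "r \<odot>\<^bsub>node_module M N\<^esub> Node u v = Node (r \<odot>\<^bsub>M\<^esub> u) (r \<odot>\<^bsub>N\<^esub> v)"
  by (auto simp: node_module_def)

lemma leaf_moduleE:
  assumes "u \<in> carrier (leaf_module M)" obtains x where "u = Leaf x" "x \<in> carrier M"
  using assms unfolding leaf_module_def by auto

lemma node_moduleE:
  assumes "u \<in> carrier (node_module M N)"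
  obtains a b where "u = Node a b" "a \<in> carrier M" "b \<in> carrier N"
  using assms unfolding node_module_def by auto

lemma module_leaf_module:
  assumes "module R M" shows "module R (leaf_module M)"
proof -
  interpret M: module R M by fact
  show ?thesis
  proof (rule moduleI)
    show "abelian_group (leaf_module M)"
    proof (rule abelian_groupI)
      show "\<exists>y\<in>carrier (leaf_module M). y \<oplus>\<^bsub>leaf_module M\<^esub> x = \<zero>\<^bsub>leaf_module M\<^esub>"
        if "x \<in> carrier (leaf_module M)" for x
        using that
          by (elim leaf_moduleE) (auto intro!: bexI[of _ "Leaf (\<ominus>\<^bsub>M\<^esub> leaf x)"] simp: M.M.l_neg)
    qed (auto elim!: leaf_moduleE simp: M.M.a_ac)
  qed (auto elim!: leaf_moduleE simp: M.smult_l_distr M.smult_r_distr M.smult_assoc1 M.R.is_cring)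
qed

lemma module_node_module:
  assumes "module R M" "module R N" shows "module R (node_module M N)"
proof -
  interpret M: module R M by fact
  interpret N: module R N by fact
  show ?thesis
  proof (rule moduleI)
    show "abelian_group (node_module M N)"
    proof (rule abelian_groupI)
      show "\<exists>y\<in>carrier (node_module M N). y \<oplus>\<^bsub>node_module M N\<^esub> x = \<zero>\<^bsub>node_module M N\<^esub>"
        if "x \<in> carrier (node_module M N)" for x
        using that by (elim node_moduleE)
          (auto intro!: bexI[of _ "Node (\<ominus>\<^bsub>M\<^esub> left x) (\<ominus>\<^bsub>N\<^esub> right x)"] simp: M.M.l_neg N.M.l_neg)
    qed (auto elim!: node_moduleE simp: M.M.a_ac N.M.a_ac)
  qed (auto elim!: node_moduleE simp: M.smult_l_distr M.smult_r_distr M.smult_assoc1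
      N.smult_l_distr N.smult_r_distr N.smult_assoc1 M.R.is_cring)
qed

lemma tors_leaf_module [simp]: "Leaf x \<in> tors R F (leaf_module M) \<longleftrightarrow> x \<in> tors R F M"
  unfolding tors_def by simp

lemma tors_node_module [simp]:
  assumes "module R M" "module R N" "F \<subseteq> carrier R"
  shows "Node u v \<in> tors R F (node_module M N) \<longleftrightarrow> u \<in> tors R F M \<and> v \<in> tors R F N"
proof -
  interpret M: module R M by fact
  interpret N: module R N by fact
  have "(\<exists>n::nat. f [^]\<^bsub>R\<^esub> n \<odot>\<^bsub>M\<^esub> u = \<zero>\<^bsub>M\<^esub> \<and> f [^]\<^bsub>R\<^esub> n \<odot>\<^bsub>N\<^esub> v = \<zero>\<^bsub>N\<^esub>) \<longleftrightarrow>
      (\<exists>n::nat. f [^]\<^bsub>R\<^esub> n \<odot>\<^bsub>M\<^esub> u = \<zero>\<^bsub>M\<^esub>) \<and> (\<exists>n::nat. f [^]\<^bsub>R\<^esub> n \<odot>\<^bsub>N\<^esub> v = \<zero>\<^bsub>N\<^esub>)"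
    if "f \<in> F" "u \<in> carrier M" "v \<in> carrier N" for f
  proof safe
    fix n m :: nat
    assume "f [^]\<^bsub>R\<^esub> n \<odot>\<^bsub>M\<^esub> u = \<zero>\<^bsub>M\<^esub>" "f [^]\<^bsub>R\<^esub> m \<odot>\<^bsub>N\<^esub> v = \<zero>\<^bsub>N\<^esub>"
    then have "f [^]\<^bsub>R\<^esub> (max n m) \<odot>\<^bsub>M\<^esub> u = \<zero>\<^bsub>M\<^esub> \<and> f [^]\<^bsub>R\<^esub> (max n m) \<odot>\<^bsub>N\<^esub> v = \<zero>\<^bsub>N\<^esub>"
      using M.smult_pow_le[of f u n "max n m"] N.smult_pow_le[of f v m "max n m"] that assms(3)
        by auto
    then show "\<exists>n::nat. f [^]\<^bsub>R\<^esub> n \<odot>\<^bsub>M\<^esub> u = \<zero>\<^bsub>M\<^esub> \<and> f [^]\<^bsub>R\<^esub> n \<odot>\<^bsub>N\<^esub> v = \<zero>\<^bsub>N\<^esub>" by blast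
  qed auto
  then show ?thesis unfolding tors_def by auto
qed

locale cochain_complex = R?: cring R for R :: "'r ring" (structure) +
  fixes X :: "nat \<Rightarrow> ('r, 'c) module" and D :: "nat \<Rightarrow> 'c \<Rightarrow> 'c"
  assumes modules: "module R (X n)"
    and D_closed [simp]: "x \<in> carrier (X n) \<Longrightarrow> D n x \<in> carrier (X (Suc n))"
    and D_add [simp]: "x \<in> carrier (X n) \<Longrightarrow> y \<in> carrier (X n) \<Longrightarrow>
      D n (x \<oplus>\<^bsub>X n\<^esub> y) = D n x \<oplus>\<^bsub>X (Suc n)\<^esub> D n y"
    and D_smult [simp]: "r \<in> carrier R \<Longrightarrow> x \<in> carrier (X n) \<Longrightarrow>
      D n (r \<odot>\<^bsub>X n\<^esub> x) = r \<odot>\<^bsub>X (Suc n)\<^esub> D n x"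
    and D_D [simp]: "x \<in> carrier (X n) \<Longrightarrow> D (Suc n) (D n x) = \<zero>\<^bsub>X (Suc (Suc n))\<^esub>"
begin

sublocale X: module R "X n" for n by (rule modules)

lemma D_zero [simp]: "D n \<zero>\<^bsub>X n\<^esub> = \<zero>\<^bsub>X (Suc n)\<^esub>"
proof -
  have "D n (\<zero> \<odot>\<^bsub>X n\<^esub> \<zero>\<^bsub>X n\<^esub>) = \<zero> \<odot>\<^bsub>X (Suc n)\<^esub> D n \<zero>\<^bsub>X n\<^esub>" by (rule D_smult) auto
  then show ?thesis by simp
qed

lemma D_minus [simp]: "x \<in> carrier (X n) \<Longrightarrow> D n (\<ominus>\<^bsub>X n\<^esub> x) = \<ominus>\<^bsub>X (Suc n)\<^esub> D n x"
  using D_smult[of "\<ominus> \<one>" x n] by (simp add: X.minus_one_smult)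

lemma D_tors:
  assumes "x \<in> tors R F (X n)" "F \<subseteq> carrier R" shows "D n x \<in> tors R F (X (Suc n))"
proof -
  have x: "x \<in> carrier (X n)" using assms unfolding tors_def by blast
  have "\<exists>k::nat. f [^] k \<odot>\<^bsub>X (Suc n)\<^esub> D n x = \<zero>\<^bsub>X (Suc n)\<^esub>" if f: "f \<in> F" for f
  proof -
    obtain k :: nat where "f [^] k \<odot>\<^bsub>X n\<^esub> x = \<zero>\<^bsub>X n\<^esub>" using assms f unfolding tors_def by auto
    then have "f [^] k \<odot>\<^bsub>X (Suc n)\<^esub> D n x = \<zero>\<^bsub>X (Suc n)\<^esub>"
      using D_smult[of "f [^] k" x n] x assms f by auto
    then show ?thesis by blast
  qed
  then show ?thesis using x unfolding tors_def by simp
qed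

end

text \<open>Mapping cone of multiplication by \<open>f\<close>: the left entry belongs to the
  target, the right entry to the source shifted by one. Position 0 of the cone thus contains a copy
  of \<open>X 1\<close>, even if \<open>X 0\<close> vanishes.\<close>

definition cone :: "'r \<Rightarrow> (nat \<Rightarrow> ('r, 'c tree) module) \<Rightarrow> nat \<Rightarrow> ('r, 'c tree) module" where
  "cone f X n = node_module (X n) (X (Suc n))"

definition coneD :: "'r \<Rightarrow> (nat \<Rightarrow> ('r, 'c tree) module) \<Rightarrow> (nat \<Rightarrow> 'c tree \<Rightarrow> 'c tree) \<Rightarrow>
    nat \<Rightarrow> 'c tree \<Rightarrow> 'c tree" where
  "coneD f X D n u = Node (D n (left u) \<oplus>\<^bsub>X (Suc n)\<^esub> f \<odot>\<^bsub>X (Suc n)\<^esub> right u)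
     (\<ominus>\<^bsub>X (Suc (Suc n))\<^esub> D (Suc n) (right u))"

lemma coneD_Node [simp]: "coneD f X D n (Node b a) =
    Node (D n b \<oplus>\<^bsub>X (Suc n)\<^esub> f \<odot>\<^bsub>X (Suc n)\<^esub> a) (\<ominus>\<^bsub>X (Suc (Suc n))\<^esub> D (Suc n) a)"
  by (simp add: coneD_def)


text \<open>The elements \<open>f \<in> H\<close> are surjective, hence bijective, on \<open>tors R F\<close> modulo \<open>tors R (insert f F)\<close>;
  the injective modules of a resolution have this property.\<close>

definition divisible :: "'r ring \<Rightarrow> 'r set \<Rightarrow> (nat \<Rightarrow> ('r, 'c) module) \<Rightarrow> bool" where
  "divisible R H X \<longleftrightarrow> (\<forall>f\<in>H. \<forall>F\<subseteq>H. \<forall>n. \<forall>y\<in>tors R F (X n).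
     \<exists>y'\<in>tors R F (X n). \<exists>c\<in>tors R (insert f F) (X n). f \<odot>\<^bsub>X n\<^esub> y' = y \<oplus>\<^bsub>X n\<^esub> c)"

text \<open>Exactness of \<open>X\<close> modulo \<open>F\<close>-torsion at all positions from 1
  on; the summand \<open>t\<close> replaces the passage to the quotient. For empty \<open>F\<close>
  everything is torsion, which starts the induction over the cones.\<close>

definition acyclic_mod :: "'r ring \<Rightarrow> 'r set \<Rightarrow> (nat \<Rightarrow> ('r, 'c) module) \<Rightarrow> (nat \<Rightarrow> 'c \<Rightarrow> 'c) \<Rightarrow> bool" where
  "acyclic_mod R F X D \<longleftrightarrow> (\<forall>n. \<forall>u\<in>carrier (X (Suc n)). D (Suc n) u \<in> tors R F (X (Suc (Suc n))) \<longrightarrow>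
     (\<exists>v\<in>carrier (X n). \<exists>t\<in>tors R F (X (Suc n)). u = D n v \<oplus>\<^bsub>X (Suc n)\<^esub> t))"

locale tree_complex = cochain_complex R X D for R :: "'r ring" (structure)
    and X :: "nat \<Rightarrow> ('r, 'c tree) module" and D
begin

lemma cone_complex:
  assumes f: "f \<in> carrier R"
  shows "tree_complex R (cone f X) (coneD f X D)"
proof (intro tree_complex.intro cochain_complex.intro cochain_complex_axioms.intro R.is_cring)
  fix n
  show "module R (cone f X n)" unfolding cone_def by (intro module_node_module modules)
next
  fix x n assume "x \<in> carrier (cone f X n)"
  then show "coneD f X D n x \<in> carrier (cone f X (Suc n))"
    using f unfolding cone_def by (auto elim!: node_moduleE)
  show "coneD f X D (Suc n) (coneD f X D n x) = \<zero>\<^bsub>cone f X (Suc (Suc n))\<^esub>"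
    using \<open>x \<in> carrier (cone f X n)\<close> f unfolding cone_def
    by (auto elim!: node_moduleE simp: X.smult_r_minus X.M.r_neg)
next
  fix x y n assume "x \<in> carrier (cone f X n)" "y \<in> carrier (cone f X n)"
  then show "coneD f X D n (x \<oplus>\<^bsub>cone f X n\<^esub> y) = coneD f X D n x \<oplus>\<^bsub>cone f X (Suc n)\<^esub> coneD f X D n y"
    using f unfolding cone_def
    by (auto elim!: node_moduleE simp: X.smult_r_distr X.M.a_ac X.M.minus_add)
next
  fix x r n assume "x \<in> carrier (cone f X n)" "r \<in> carrier R"
  then show "coneD f X D n (r \<odot>\<^bsub>cone f X n\<^esub> x) = r \<odot>\<^bsub>cone f X (Suc n)\<^esub> coneD f X D n x"
    using f unfolding cone_def
    by (auto elim!: node_moduleE simp: X.smult_r_distr X.smult_r_minus X.smult_swap)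
qed

lemma cone_divisible:
  assumes H: "H \<subseteq> carrier R" and div: "divisible R H X"
  shows "divisible R H (cone f X)"
  unfolding divisible_def
proof (intro ballI allI impI)
  fix g F n y assume g: "g \<in> H" and F: "F \<subseteq> H" and y: "y \<in> tors R F (cone f X n)"
  have Fc: "F \<subseteq> carrier R" "insert g F \<subseteq> carrier R" using F g H by auto
  note [simp] = tors_node_module[OF modules modules]
  obtain b a where ba: "y = Node b a" using y unfolding tors_def cone_def
    by (auto elim: node_moduleE)
  have "b \<in> tors R F (X n)" "a \<in> tors R F (X (Suc n))" using ba y Fc by (auto simp: cone_def)
  note d = div[unfolded divisible_def, rule_format, OF g F]
  obtain b' c where "b' \<in> tors R F (X n)" "c \<in> tors R (insert g F) (X n)"
    "g \<odot>\<^bsub>X n\<^esub> b' = b \<oplus>\<^bsub>X n\<^esub> c" using d[OF \<open>b \<in> tors R F (X n)\<close>] by auto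
  moreover obtain a' e where "a' \<in> tors R F (X (Suc n))" "e \<in> tors R (insert g F) (X (Suc n))"
    "g \<odot>\<^bsub>X (Suc n)\<^esub> a' = a \<oplus>\<^bsub>X (Suc n)\<^esub> e" using d[OF \<open>a \<in> tors R F (X (Suc n))\<close>] by auto
  ultimately show "\<exists>y'\<in>tors R F (cone f X n). \<exists>c\<in>tors R (insert g F) (cone f X n).
      g \<odot>\<^bsub>cone f X n\<^esub> y' = y \<oplus>\<^bsub>cone f X n\<^esub> c"
    by (intro bexI[of _ "Node b' a'"] bexI[of _ "Node c e"]) (use Fc ba in \<open>auto simp: cone_def\<close>)
qed

text \<open>Modulo \<open>F\<close>-torsion \<open>X\<close> is exact, and so is its cone. On the
  remaining layer, \<open>F\<close>-torsion modulo torsion for \<open>insert f F\<close>, the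
  element \<open>f\<close> is bijective, so the cone over this layer is exact too. The proof
  performs both steps on elements: exactness of \<open>X\<close> is used twice, divisibility
  once.\<close>

lemma cone_acyclic:
  assumes H: "H \<subseteq> carrier R" and div: "divisible R H X" and f: "f \<in> H" and F: "F \<subseteq> H"
    and ac: "acyclic_mod R F X D"
  shows "acyclic_mod R (insert f F) (cone f X) (coneD f X D)"
  unfolding acyclic_mod_def
proof (intro ballI allI impI)
  fix n u assume u: "u \<in> carrier (cone f X (Suc n))"
    and Du: "coneD f X D (Suc n) u \<in> tors R (insert f F) (cone f X (Suc (Suc n)))"
  have Fc: "F \<subseteq> carrier R" "insert f F \<subseteq> carrier R" and fc [simp]: "f \<in> carrier R" using F f H
    by auto
  note [simp] = tors_node_module[OF modules modules]
  note T1 = X.submoduleE[OF X.submodule_tors[OF Fc(1)]]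
  note T2 = X.submoduleE[OF X.submodule_tors[OF Fc(2)]]
  have mono: "tors R (insert f F) (X m) \<subseteq> tors R F (X m)" for m unfolding tors_def by auto
  obtain b a where ba: "u = Node b a"
    and bc [simp]: "b \<in> carrier (X (Suc n))" "a \<in> carrier (X (Suc (Suc n)))"
    using u unfolding cone_def by (auto elim: node_moduleE)
  have Db: "D (Suc n) b \<oplus>\<^bsub>X (Suc (Suc n))\<^esub> f \<odot>\<^bsub>X (Suc (Suc n))\<^esub> a \<in> tors R (insert f F) (X (Suc (Suc n)))"
    and Da: "\<ominus>\<^bsub>X (Suc (Suc (Suc n)))\<^esub> D (Suc (Suc n)) a \<in> tors R (insert f F) (X (Suc (Suc (Suc n))))"
    using Du Fc unfolding ba cone_def by auto
  \<comment> \<open>The right entry is a cocycle modulo \<open>F\<close>-torsion, hence a coboundary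
    \<open>D v\<close> up to \<open>a'\<close>; adding \<open>f v\<close> to \<open>b\<close>
    compensates for \<open>D v\<close>.\<close>
  have "D (Suc (Suc n)) a \<in> tors R F (X (Suc (Suc (Suc n))))"
    using T2(3)[OF Da] mono by auto
  then obtain v a' where v [simp]: "v \<in> carrier (X (Suc n))"
    and a': "a' \<in> tors R F (X (Suc (Suc n)))"
    and a_eq: "a = D (Suc n) v \<oplus>\<^bsub>X (Suc (Suc n))\<^esub> a'"
    using ac bc unfolding acyclic_mod_def by blast
  have a'c [simp]: "a' \<in> carrier (X (Suc (Suc n)))" using a' T1(1) by blast
  have "D (Suc n) (b \<oplus>\<^bsub>X (Suc n)\<^esub> f \<odot>\<^bsub>X (Suc n)\<^esub> v) =
      (D (Suc n) b \<oplus>\<^bsub>X (Suc (Suc n))\<^esub> f \<odot>\<^bsub>X (Suc (Suc n))\<^esub> a) \<oplus>\<^bsub>X (Suc (Suc n))\<^esub>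
      \<ominus>\<^bsub>X (Suc (Suc n))\<^esub> (f \<odot>\<^bsub>X (Suc (Suc n))\<^esub> a')"
    unfolding a_eq by (simp add: X.smult_r_distr X.M.a_assoc X.M.r_neg)
  also have "\<dots> \<in> tors R F (X (Suc (Suc n)))"
    by (rule T1(5)[OF subsetD[OF mono Db] T1(3)[OF T1(4)[OF fc a']]])
  finally have Dbf: "D (Suc n) (b \<oplus>\<^bsub>X (Suc n)\<^esub> f \<odot>\<^bsub>X (Suc n)\<^esub> v) \<in> tors R F (X (Suc (Suc n)))" .
  obtain v' b' where v' [simp]: "v' \<in> carrier (X n)" and b': "b' \<in> tors R F (X (Suc n))"
    and bfv: "b \<oplus>\<^bsub>X (Suc n)\<^esub> f \<odot>\<^bsub>X (Suc n)\<^esub> v = D n v' \<oplus>\<^bsub>X (Suc n)\<^esub> b'"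
    using ac[unfolded acyclic_mod_def, rule_format, OF _ Dbf] by auto
  have b'c [simp]: "b' \<in> carrier (X (Suc n))" using b' T1(1) by blast
  have b_eq: "b = D n v' \<oplus>\<^bsub>X (Suc n)\<^esub> b' \<oplus>\<^bsub>X (Suc n)\<^esub> \<ominus>\<^bsub>X (Suc n)\<^esub> (f \<odot>\<^bsub>X (Suc n)\<^esub> v)"
    using bfv
      by (metis X.M.a_assoc X.M.add.inv_closed X.M.r_neg X.M.r_zero X.smult_closed bc(1) fc v)
  \<comment> \<open>The error \<open>b'\<close> is only known to be \<open>F\<close>-torsion.
    Dividing it by \<open>f\<close> moves it into the right entry and leaves the error
    \<open>c\<close>, which is torsion for \<open>insert f F\<close>.\<close>
  obtain g c where g: "g \<in> tors R F (X (Suc n))" and c: "c \<in> tors R (insert f F) (X (Suc n))"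
    and fg: "f \<odot>\<^bsub>X (Suc n)\<^esub> g = b' \<oplus>\<^bsub>X (Suc n)\<^esub> c"
    using div f F b' unfolding divisible_def by blast
  have gc [simp]: "g \<in> carrier (X (Suc n))" "c \<in> carrier (X (Suc n))" using g c T1(1) T2(1) by auto
  \<comment> \<open>The injective half of bijectivity on the layer: \<open>?t\<close> is
    \<open>F\<close>-torsion and \<open>f ?t\<close> is torsion for \<open>insert f F\<close>, so a
    power of \<open>f\<close> kills \<open>?t\<close>.\<close>
  let ?t = "a' \<oplus>\<^bsub>X (Suc (Suc n))\<^esub> D (Suc n) g"
  have tF: "?t \<in> tors R F (X (Suc (Suc n)))" using T1(5) a' D_tors[OF g Fc(1)] by blast
  have "f \<odot>\<^bsub>X (Suc (Suc n))\<^esub> ?t = (D (Suc n) b \<oplus>\<^bsub>X (Suc (Suc n))\<^esub> f \<odot>\<^bsub>X (Suc (Suc n))\<^esub> a)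
      \<oplus>\<^bsub>X (Suc (Suc n))\<^esub> D (Suc n) c"
  proof -
    have "f \<odot>\<^bsub>X (Suc (Suc n))\<^esub> ?t = f \<odot>\<^bsub>X (Suc (Suc n))\<^esub> a' \<oplus>\<^bsub>X (Suc (Suc n))\<^esub> D (Suc n) (f \<odot>\<^bsub>X (Suc n)\<^esub> g)"
      by (simp add: X.smult_r_distr)
    also have "\<dots> = f \<odot>\<^bsub>X (Suc (Suc n))\<^esub> a' \<oplus>\<^bsub>X (Suc (Suc n))\<^esub> (D (Suc n) b' \<oplus>\<^bsub>X (Suc (Suc n))\<^esub> D (Suc n) c)"
      unfolding fg by simp
    also have "\<dots> = (D (Suc n) b \<oplus>\<^bsub>X (Suc (Suc n))\<^esub> f \<odot>\<^bsub>X (Suc (Suc n))\<^esub> a) \<oplus>\<^bsub>X (Suc (Suc n))\<^esub> D (Suc n) c"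
      unfolding a_eq b_eq
      by (simp add: X.smult_r_distr X.M.a_ac X.M.r_neg2 X.M.r_neg1)
        (simp only: X.M.r_neg X.M.r_zero X.smult_closed D_closed fc v)
    finally show ?thesis .
  qed
  also have "\<dots> \<in> tors R (insert f F) (X (Suc (Suc n)))" using T2(5)[OF Db D_tors[OF c Fc(2)]] .
  finally obtain k :: nat
    where "f [^] k \<odot>\<^bsub>X (Suc (Suc n))\<^esub> (f \<odot>\<^bsub>X (Suc (Suc n))\<^esub> ?t) = \<zero>\<^bsub>X (Suc (Suc n))\<^esub>"
    unfolding tors_def by auto
  then have "f [^] Suc k \<odot>\<^bsub>X (Suc (Suc n))\<^esub> ?t = \<zero>\<^bsub>X (Suc (Suc n))\<^esub>" by (simp add: X.smult_assoc1)
  then have t: "?t \<in> tors R (insert f F) (X (Suc (Suc n)))" using tF unfolding tors_def by blast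
  let ?w = "Node v' (\<ominus>\<^bsub>X (Suc n)\<^esub> v \<oplus>\<^bsub>X (Suc n)\<^esub> g)" and ?s = "Node (\<ominus>\<^bsub>X (Suc n)\<^esub> c) ?t"
  have "?w \<in> carrier (cone f X n)" by (simp add: cone_def)
  moreover have "?s \<in> tors R (insert f F) (cone f X (Suc n))" using t T2(3)[OF c] Fc
    by (simp add: cone_def)
  moreover have "u = coneD f X D n ?w \<oplus>\<^bsub>cone f X (Suc n)\<^esub> ?s"
  proof -
    have "b = (D n v' \<oplus>\<^bsub>X (Suc n)\<^esub> (\<ominus>\<^bsub>X (Suc n)\<^esub> (f \<odot>\<^bsub>X (Suc n)\<^esub> v) \<oplus>\<^bsub>X (Suc n)\<^esub> (b' \<oplus>\<^bsub>X (Suc n)\<^esub> c)))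
        \<oplus>\<^bsub>X (Suc n)\<^esub> \<ominus>\<^bsub>X (Suc n)\<^esub> c"
      unfolding b_eq by (intro X.M.add_cancel_rearrange) auto
    moreover have "a = \<ominus>\<^bsub>X (Suc (Suc n))\<^esub> (\<ominus>\<^bsub>X (Suc (Suc n))\<^esub> D (Suc n) v \<oplus>\<^bsub>X (Suc (Suc n))\<^esub> D (Suc n) g)
        \<oplus>\<^bsub>X (Suc (Suc n))\<^esub> ?t"
      unfolding a_eq by (simp add: X.M.minus_add X.M.a_ac X.M.r_neg2 X.M.r_neg1 X.M.r_neg)
    ultimately show ?thesis
      unfolding ba cone_def by (simp add: X.smult_r_distr fg X.smult_r_minus)
  qed
  ultimately show "\<exists>v\<in>carrier (cone f X n). \<exists>t\<in>tors R (insert f F) (cone f X (Suc n)).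
      u = coneD f X D n v \<oplus>\<^bsub>cone f X (Suc n)\<^esub> t" by blast
qed

end

text \<open>Modulo \<open>F\<close>-torsion, cohomology vanishes from position 2 on and is generated
  by the classes of \<open>Z\<close> at position 1. In the application positions are shifted by one,
  so position 1 is cohomological degree 0.\<close>

definition generated_mod :: "'r ring \<Rightarrow> 'r set \<Rightarrow> (nat \<Rightarrow> ('r, 'c) module) \<Rightarrow> (nat \<Rightarrow> 'c \<Rightarrow> 'c) \<Rightarrow>
    'c set \<Rightarrow> bool" where
  "generated_mod R F X D Z \<longleftrightarrow>
     (\<forall>n. \<forall>u\<in>carrier (X (Suc (Suc n))). D (Suc (Suc n)) u \<in> tors R F (X (Suc (Suc (Suc n)))) \<longrightarrow>
       (\<exists>v\<in>carrier (X (Suc n)). \<exists>t\<in>tors R F (X (Suc (Suc n))). u = D (Suc n) v \<oplus>\<^bsub>X (Suc (Suc n))\<^esub> t)) \<and>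
     (\<forall>u\<in>carrier (X (Suc 0)). D (Suc 0) u \<in> tors R F (X (Suc (Suc 0))) \<longrightarrow>
       (\<exists>z\<in>Z. \<exists>v\<in>carrier (X 0). \<exists>t\<in>tors R F (X (Suc 0)).
          u = z \<oplus>\<^bsub>X (Suc 0)\<^esub> (D 0 v \<oplus>\<^bsub>X (Suc 0)\<^esub> t)))"

lemma (in abelian_group) move_right:
  assumes "a \<in> carrier G" "b \<in> carrier G" "c \<in> carrier G" "a \<oplus> b = c"
  shows "a = c \<oplus> \<ominus> b"
  using assms by (metis a_assoc a_inv_closed r_neg r_zero)

lemma (in abelian_group) add_cancel_rearrange2:
  assumes "p \<in> carrier G" "e \<in> carrier G" "q \<in> carrier G" "s \<in> carrier G" "t \<in> carrier G"
  shows "p \<oplus> (e \<oplus> (q \<oplus> s)) \<oplus> t \<oplus> \<ominus> e = p \<oplus> q \<oplus> (s \<oplus> t)"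
proof -
  have "p \<oplus> (e \<oplus> (q \<oplus> s)) \<oplus> t \<oplus> \<ominus> e = p \<oplus> q \<oplus> (s \<oplus> t) \<oplus> (e \<oplus> \<ominus> e)"
    using assms by (simp add: a_ac del: r_neg)
  then show ?thesis using assms by (simp add: r_neg)
qed

context tree_complex
begin

text \<open>\<open>Node b (D v + a')\<close> differs from \<open>Node (b + f v) a'\<close> by the
  coboundary of \<open>Node 0 (- v)\<close>; since \<open>a'\<close> is torsion, the left entry is a
  cocycle modulo torsion.\<close>

lemma cone_cycle:
  assumes "F \<subseteq> carrier R" "f \<in> carrier R" "b \<in> carrier (X n)" "v \<in> carrier (X n)" "a' \<in> tors R F (X (Suc n))"
    and "D n b \<oplus>\<^bsub>X (Suc n)\<^esub> f \<odot>\<^bsub>X (Suc n)\<^esub> (D n v \<oplus>\<^bsub>X (Suc n)\<^esub> a') \<in> tors R F (X (Suc n))"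
  shows "D n (b \<oplus>\<^bsub>X n\<^esub> f \<odot>\<^bsub>X n\<^esub> v) \<in> tors R F (X (Suc n))"
proof -
  note T1 = X.submoduleE[OF X.submodule_tors[OF assms(1)]]
  have a' [simp]: "a' \<in> carrier (X (Suc n))" using assms(5) T1(1) by blast
  have "D n (b \<oplus>\<^bsub>X n\<^esub> f \<odot>\<^bsub>X n\<^esub> v) =
      (D n b \<oplus>\<^bsub>X (Suc n)\<^esub> f \<odot>\<^bsub>X (Suc n)\<^esub> (D n v \<oplus>\<^bsub>X (Suc n)\<^esub> a')) \<oplus>\<^bsub>X (Suc n)\<^esub>
      \<ominus>\<^bsub>X (Suc n)\<^esub> (f \<odot>\<^bsub>X (Suc n)\<^esub> a')"
    using assms(2-4) by (simp add: X.smult_r_distr X.M.a_assoc X.M.r_neg)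
  also have "\<dots> \<in> tors R F (X (Suc n))"
    by (rule T1(5)[OF assms(6) T1(3)[OF T1(4)[OF assms(2,5)]]])
  finally show ?thesis .
qed

text \<open>In the long exact sequence, the cohomology of the cone sits between that of
  \<open>X\<close> in the same position and in the next one. From position 1 on the latter vanishes,
  so the cohomology of the cone is a quotient of that of \<open>X\<close>.\<close>

lemma cone_generated:
  assumes F: "F \<subseteq> carrier R" and f [simp]: "f \<in> carrier R" and Z: "Z \<subseteq> carrier (X (Suc 0))"
    and gen: "generated_mod R F X D Z"
  shows "generated_mod R F (cone f X) (coneD f X D) ((\<lambda>z. Node z \<zero>\<^bsub>X (Suc (Suc 0))\<^esub>) ` Z)"
proof -
  note [simp] = tors_node_module[OF modules modules]
  note T = X.submoduleE[OF X.submodule_tors[OF F]]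
  note gen1 = gen[unfolded generated_mod_def, THEN conjunct1, rule_format]
  note gen2 = gen[unfolded generated_mod_def, THEN conjunct2, rule_format]
  have *: "\<exists>b v a'. u = Node b (D n v \<oplus>\<^bsub>X (Suc n)\<^esub> a') \<and> b \<in> carrier (X n) \<and>
      v \<in> carrier (X n) \<and> a' \<in> tors R F (X (Suc n)) \<and>
      D n (b \<oplus>\<^bsub>X n\<^esub> f \<odot>\<^bsub>X n\<^esub> v) \<in> tors R F (X (Suc n))"
    if u: "u \<in> carrier (cone f X n)" and Du: "coneD f X D n u \<in> tors R F (cone f X (Suc n))"
      and n: "n = Suc m" for u n m
  proof -
    obtain b a where ba: "u = Node b a" and bc: "b \<in> carrier (X n)" "a \<in> carrier (X (Suc n))"
      using u unfolding cone_def by (auto elim: node_moduleE)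
    have Db: "D n b \<oplus>\<^bsub>X (Suc n)\<^esub> f \<odot>\<^bsub>X (Suc n)\<^esub> a \<in> tors R F (X (Suc n))"
      and Da: "\<ominus>\<^bsub>X (Suc (Suc n))\<^esub> D (Suc n) a \<in> tors R F (X (Suc (Suc n)))"
      using Du F unfolding ba cone_def by auto
    have "D (Suc n) a \<in> tors R F (X (Suc (Suc n)))" using T(3)[OF Da] bc by auto
    then obtain v a' where v: "v \<in> carrier (X n)" and a': "a' \<in> tors R F (X (Suc n))"
      and a_eq: "a = D n v \<oplus>\<^bsub>X (Suc n)\<^esub> a'" using gen1[of a m] bc unfolding n by auto
    have "D n (b \<oplus>\<^bsub>X n\<^esub> f \<odot>\<^bsub>X n\<^esub> v) \<in> tors R F (X (Suc n))"
      by (rule cone_cycle[OF F f bc(1) v a']) (use Db a_eq in simp)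
    then show ?thesis using ba bc v a' a_eq by blast
  qed
  have **: "b = D n v' \<oplus>\<^bsub>X (Suc n)\<^esub> f \<odot>\<^bsub>X (Suc n)\<^esub> (\<ominus>\<^bsub>X (Suc n)\<^esub> v) \<oplus>\<^bsub>X (Suc n)\<^esub> b'"
    if "b \<in> carrier (X (Suc n))" "v \<in> carrier (X (Suc n))" "v' \<in> carrier (X n)" "b' \<in> carrier (X (Suc n))"
      "b \<oplus>\<^bsub>X (Suc n)\<^esub> f \<odot>\<^bsub>X (Suc n)\<^esub> v = D n v' \<oplus>\<^bsub>X (Suc n)\<^esub> b'" for b v v' b' n
    using X.M.move_right[OF _ _ _ that(5)] that(1-4) by (simp add: X.smult_r_minus X.M.a_ac)
  show ?thesis unfolding generated_mod_def
  proof (intro conjI ballI allI impI)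
    fix n u assume u: "u \<in> carrier (cone f X (Suc (Suc n)))"
      and Du: "coneD f X D (Suc (Suc n)) u \<in> tors R F (cone f X (Suc (Suc (Suc n))))"
    obtain b v a' where ba: "u = Node b (D (Suc (Suc n)) v \<oplus>\<^bsub>X (Suc (Suc (Suc n)))\<^esub> a')"
      and c [simp]: "b \<in> carrier (X (Suc (Suc n)))" "v \<in> carrier (X (Suc (Suc n)))"
      and a': "a' \<in> tors R F (X (Suc (Suc (Suc n))))"
      and Dbf: "D (Suc (Suc n)) (b \<oplus>\<^bsub>X (Suc (Suc n))\<^esub> f \<odot>\<^bsub>X (Suc (Suc n))\<^esub> v) \<in> tors R F (X (Suc (Suc (Suc n))))"
      using *[OF u Du refl] by blast
    obtain v' b' where v' [simp]: "v' \<in> carrier (X (Suc n))"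
      and b': "b' \<in> tors R F (X (Suc (Suc n)))"
      and eq: "b \<oplus>\<^bsub>X (Suc (Suc n))\<^esub> f \<odot>\<^bsub>X (Suc (Suc n))\<^esub> v = D (Suc n) v' \<oplus>\<^bsub>X (Suc (Suc n))\<^esub> b'"
      using gen1[OF _ Dbf] by auto
    have b'c [simp]: "b' \<in> carrier (X (Suc (Suc n)))" "a' \<in> carrier (X (Suc (Suc (Suc n))))"
      using b' a' T(1) by auto
    have "u = coneD f X D (Suc n) (Node v' (\<ominus>\<^bsub>X (Suc (Suc n))\<^esub> v)) \<oplus>\<^bsub>cone f X (Suc (Suc n))\<^esub> Node b' a'"
      unfolding ba cone_def using **[OF _ _ _ _ eq] by simp
    moreover have "Node v' (\<ominus>\<^bsub>X (Suc (Suc n))\<^esub> v) \<in> carrier (cone f X (Suc n))"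
      by (simp add: cone_def)
    moreover have "Node b' a' \<in> tors R F (cone f X (Suc (Suc n)))" using F a' b'
      by (simp add: cone_def)
    ultimately show "\<exists>v\<in>carrier (cone f X (Suc n)). \<exists>t\<in>tors R F (cone f X (Suc (Suc n))).
        u = coneD f X D (Suc n) v \<oplus>\<^bsub>cone f X (Suc (Suc n))\<^esub> t" by blast
  next
    fix u assume u: "u \<in> carrier (cone f X (Suc 0))"
      and Du: "coneD f X D (Suc 0) u \<in> tors R F (cone f X (Suc (Suc 0)))"
    obtain b v a' where ba: "u = Node b (D (Suc 0) v \<oplus>\<^bsub>X (Suc (Suc 0))\<^esub> a')"
      and c [simp]: "b \<in> carrier (X (Suc 0))" "v \<in> carrier (X (Suc 0))"
      and a': "a' \<in> tors R F (X (Suc (Suc 0)))"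
      and Dbf: "D (Suc 0) (b \<oplus>\<^bsub>X (Suc 0)\<^esub> f \<odot>\<^bsub>X (Suc 0)\<^esub> v) \<in> tors R F (X (Suc (Suc 0)))"
      using *[OF u Du refl] by blast
    obtain z v' b' where z: "z \<in> Z" and v' [simp]: "v' \<in> carrier (X 0)"
      and b': "b' \<in> tors R F (X (Suc 0))"
      and eq: "b \<oplus>\<^bsub>X (Suc 0)\<^esub> f \<odot>\<^bsub>X (Suc 0)\<^esub> v = z \<oplus>\<^bsub>X (Suc 0)\<^esub> (D 0 v' \<oplus>\<^bsub>X (Suc 0)\<^esub> b')"
      using gen2[OF _ Dbf] by auto
    have b'c [simp]: "b' \<in> carrier (X (Suc 0))" "a' \<in> carrier (X (Suc (Suc 0)))" "z \<in> carrier (X (Suc 0))"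
      using b' a' T(1) z Z by auto
    have "b = z \<oplus>\<^bsub>X (Suc 0)\<^esub> (D 0 v' \<oplus>\<^bsub>X (Suc 0)\<^esub> f \<odot>\<^bsub>X (Suc 0)\<^esub> (\<ominus>\<^bsub>X (Suc 0)\<^esub> v) \<oplus>\<^bsub>X (Suc 0)\<^esub> b')"
      using X.M.move_right[OF _ _ _ eq] by (simp add: X.smult_r_minus X.M.a_ac)
    then have "u = Node z \<zero>\<^bsub>X (Suc (Suc 0))\<^esub> \<oplus>\<^bsub>cone f X (Suc 0)\<^esub>
        (coneD f X D 0 (Node v' (\<ominus>\<^bsub>X (Suc 0)\<^esub> v)) \<oplus>\<^bsub>cone f X (Suc 0)\<^esub> Node b' a')"
      unfolding ba cone_def by simp
    moreover have "Node v' (\<ominus>\<^bsub>X (Suc 0)\<^esub> v) \<in> carrier (cone f X 0)" by (simp add: cone_def)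
    moreover have "Node b' a' \<in> tors R F (cone f X (Suc 0))" using F a' b' by (simp add: cone_def)
    ultimately show "\<exists>z\<in>(\<lambda>z. Node z \<zero>\<^bsub>X (Suc (Suc 0))\<^esub>) ` Z. \<exists>v\<in>carrier (cone f X 0).
        \<exists>t\<in>tors R F (cone f X (Suc 0)).
        u = z \<oplus>\<^bsub>cone f X (Suc 0)\<^esub> (coneD f X D 0 v \<oplus>\<^bsub>cone f X (Suc 0)\<^esub> t)" using z by blast
  qed
qed

end

text \<open>Up to signs and indexing, the tensor product of \<open>M\<close> with the Koszul complex
  of the list, whose head gives the outermost cone.\<close>

primrec kosX :: "'r list \<Rightarrow> (nat \<Rightarrow> ('r, 'c) module) \<Rightarrow> nat \<Rightarrow> ('r, 'c tree) module" where
  "kosX [] M = (\<lambda>n. leaf_module (M n))"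
| "kosX (f # fs) M = cone f (kosX fs M)"

primrec kosD :: "'r list \<Rightarrow> (nat \<Rightarrow> ('r, 'c) module) \<Rightarrow> (nat \<Rightarrow> 'c \<Rightarrow> 'c) \<Rightarrow> nat \<Rightarrow> 'c tree \<Rightarrow> 'c tree" where
  "kosD [] M d = (\<lambda>n u. Leaf (d n (leaf u)))"
| "kosD (f # fs) M d = coneD f (kosX fs M) (kosD fs M d)"

text \<open>Inclusion of position 1 of \<open>M\<close> as the innermost left entry. The right entry
  of a cone at position 1 lives at position 2, whence the index of the zero.\<close>

primrec kos_emb :: "'r list \<Rightarrow> (nat \<Rightarrow> ('r, 'c) module) \<Rightarrow> 'c \<Rightarrow> 'c tree" where
  "kos_emb [] M y = Leaf y"
| "kos_emb (f # fs) M y = Node (kos_emb fs M y) \<zero>\<^bsub>kosX fs M (Suc (Suc 0))\<^esub>"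

text \<open>\<open>f_1 Y + ... + f_s Y + T\<close>, written recursively so that removing one
  multiple corresponds to removing one cone.\<close>

primrec lin_comb :: "('r, 'c) module \<Rightarrow> 'c set \<Rightarrow> 'c set \<Rightarrow> 'r list \<Rightarrow> 'c set" where
  "lin_comb M Y T [] = T"
| "lin_comb M Y T (f # fs) = {y \<in> carrier M. \<exists>y'\<in>Y. y \<ominus>\<^bsub>M\<^esub> f \<odot>\<^bsub>M\<^esub> y' \<in> lin_comb M Y T fs}"

context cochain_complex
begin

lemma kos_complex:
  assumes "set fs \<subseteq> carrier R" shows "tree_complex R (kosX fs X) (kosD fs X D)"
  using assms
proof (induction fs)
  case Nil
  show ?case
    unfolding kosX.simps kosD.simps
    by (intro tree_complex.intro cochain_complex.intro cochain_complex_axioms.intro R.is_cring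
        module_leaf_module modules) (auto elim!: leaf_moduleE)
next
  case (Cons f fs)
  then interpret K: tree_complex R "kosX fs X" "kosD fs X D" by simp
  show ?case using K.cone_complex[of f] Cons by simp
qed

lemma kos_divisible:
  assumes "set fs \<subseteq> carrier R" "H \<subseteq> carrier R" "divisible R H X"
  shows "divisible R H (kosX fs X)"
  using assms(1)
proof (induction fs)
  case Nil
  show ?case unfolding divisible_def kosX.simps
  proof (intro ballI allI impI)
    fix f F n y assume fF: "f \<in> H" "F \<subseteq> H" and y: "y \<in> tors R F (leaf_module (X n))"
    obtain x where x: "y = Leaf x" using y unfolding tors_def by (auto elim: leaf_moduleE)
    then have "x \<in> tors R F (X n)" using y by simp
    from assms(3)[unfolded divisible_def, rule_format, OF fF this] obtain y' c where
      "y' \<in> tors R F (X n)" "c \<in> tors R (insert f F) (X n)" "f \<odot>\<^bsub>X n\<^esub> y' = x \<oplus>\<^bsub>X n\<^esub> c" by auto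
    then show "\<exists>y'\<in>tors R F (leaf_module (X n)). \<exists>c\<in>tors R (insert f F) (leaf_module (X n)).
        f \<odot>\<^bsub>leaf_module (X n)\<^esub> y' = y \<oplus>\<^bsub>leaf_module (X n)\<^esub> c"
      using x by (intro bexI[of _ "Leaf y'"] bexI[of _ "Leaf c"]) auto
  qed
next
  case (Cons f fs)
  interpret K: tree_complex R "kosX fs X" "kosD fs X D" using Cons kos_complex by simp
  show ?case using K.cone_divisible[of H f] assms Cons by simp
qed

text \<open>The torsion set grows with the list: each further cone improves exactness modulo
  \<open>set fs\<close>-torsion to exactness modulo the smaller torsion part for \<open>f\<close>
  and \<open>set fs\<close>.\<close>

lemma kos_acyclic:
  assumes "set fs \<subseteq> H" "H \<subseteq> carrier R" "divisible R H X"
  shows "acyclic_mod R (set fs) (kosX fs X) (kosD fs X D)"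
  using assms(1)
proof (induction fs)
  case Nil
  interpret K: tree_complex R "kosX [] X" "kosD [] X D" by (rule kos_complex) simp
  show ?case unfolding acyclic_mod_def
  proof (intro allI ballI impI)
    fix n u assume "u \<in> carrier (kosX [] X (Suc n))"
    \<comment> \<open>The empty set imposes no torsion condition, so \<open>u\<close> serves as its
      own torsion summand.\<close>
    then show "\<exists>v\<in>carrier (kosX [] X n). \<exists>t\<in>tors R (set []) (kosX [] X (Suc n)).
        u = kosD [] X D n v \<oplus>\<^bsub>kosX [] X (Suc n)\<^esub> t"
      by (intro bexI[of _ "\<zero>\<^bsub>kosX [] X n\<^esub>"] bexI[of _ u])
        (use K.D_zero[of n] K.X.M.l_zero[of u "Suc n"] K.X.M.zero_closed[of n] in \<open>auto simp: tors_def\<close>)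
  qed
next
  case (Cons f fs)
  interpret K: tree_complex R "kosX fs X" "kosD fs X D"
    by (rule kos_complex) (use Cons.prems assms(2) in auto)
  show ?case
    using K.cone_acyclic[OF assms(2) kos_divisible[OF _ assms(2,3)], of f "set fs"] assms(2) Cons
      by auto
qed

lemma kos_emb_hom:
  assumes "set fs \<subseteq> carrier R" "x \<in> carrier (X (Suc 0))"
  shows "kos_emb fs X x \<in> carrier (kosX fs X (Suc 0))"
    "y \<in> carrier (X (Suc 0)) \<Longrightarrow> kos_emb fs X (x \<oplus>\<^bsub>X (Suc 0)\<^esub> y) = kos_emb fs X x \<oplus>\<^bsub>kosX fs X (Suc 0)\<^esub> kos_emb fs X y"
    "r \<in> carrier R \<Longrightarrow> kos_emb fs X (r \<odot>\<^bsub>X (Suc 0)\<^esub> x) = r \<odot>\<^bsub>kosX fs X (Suc 0)\<^esub> kos_emb fs X x"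
    "F \<subseteq> carrier R \<Longrightarrow> D (Suc 0) x \<in> tors R F (X (Suc (Suc 0))) \<Longrightarrow>
      kosD fs X D (Suc 0) (kos_emb fs X x) \<in> tors R F (kosX fs X (Suc (Suc 0)))"
  using assms(1)
proof (induction fs)
  case Nil
  { case 1 then show ?case using assms by simp next case 2 then show ?case by simp next
    case 3 then show ?case by simp next case 4 then show ?case by simp }
next
  case (Cons f fs)
  have K: "tree_complex R (kosX fs X) (kosD fs X D)" if "set (f # fs) \<subseteq> carrier R"
    using that kos_complex by simp
  { case 1
    then interpret K: tree_complex R "kosX fs X" "kosD fs X D" using K by blast
    show ?case using 1 Cons by (simp add: cone_def)
  next case 2
    then interpret K: tree_complex R "kosX fs X" "kosD fs X D" using K by blast
    show ?case using 2 Cons by (simp add: cone_def)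
  next case 3
    then interpret K: tree_complex R "kosX fs X" "kosD fs X D" using K by blast
    show ?case using 3 Cons by (simp add: cone_def)
  next case 4
    then interpret K: tree_complex R "kosX fs X" "kosD fs X D" using K by blast
    have "\<zero>\<^bsub>kosX fs X (Suc (Suc (Suc 0)))\<^esub> \<in> tors R F (kosX fs X (Suc (Suc (Suc 0))))"
      using 4 by (auto simp: tors_def subset_iff)
    moreover have "kos_emb fs X x \<in> carrier (kosX fs X (Suc 0))" using Cons(1) 4 by simp
    moreover have "kosD fs X D (Suc 0) (kos_emb fs X x) \<in> tors R F (kosX fs X (Suc (Suc 0)))"
      using Cons(4) 4 by simp
    moreover have "F \<subseteq> carrier R" using 4 by simp
    note K.X.submoduleE(3)[OF K.X.submodule_tors[OF this] calculation(1)]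
    ultimately show ?case using 4 by (simp add: cone_def tors_node_module[OF K.modules K.modules]) }
qed

lemma kos_generated:
  assumes "set fs \<subseteq> carrier R" "F \<subseteq> carrier R" "Y \<subseteq> carrier (X (Suc 0))"
    and "generated_mod R F X D Y"
  shows "generated_mod R F (kosX fs X) (kosD fs X D) (kos_emb fs X ` Y)"
  using assms(1)
proof (induction fs)
  case Nil
  note gen1 = assms(4)[unfolded generated_mod_def, THEN conjunct1, rule_format]
  note gen2 = assms(4)[unfolded generated_mod_def, THEN conjunct2, rule_format]
  show ?case unfolding generated_mod_def
  proof (intro conjI allI ballI impI)
    fix n u assume *: "u \<in> carrier (kosX [] X (Suc (Suc n)))"
      "kosD [] X D (Suc (Suc n)) u \<in> tors R F (kosX [] X (Suc (Suc (Suc n))))"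
    then obtain x where x: "u = Leaf x" by (auto elim: leaf_moduleE)
    then obtain v t where "v \<in> carrier (X (Suc n))" "t \<in> tors R F (X (Suc (Suc n)))"
      "x = D (Suc n) v \<oplus>\<^bsub>X (Suc (Suc n))\<^esub> t" using gen1[of x n] * by auto
    then show "\<exists>v\<in>carrier (kosX [] X (Suc n)). \<exists>t\<in>tors R F (kosX [] X (Suc (Suc n))).
        u = kosD [] X D (Suc n) v \<oplus>\<^bsub>kosX [] X (Suc (Suc n))\<^esub> t"
      using x by (intro bexI[of _ "Leaf v"] bexI[of _ "Leaf t"]) auto
  next
    fix u assume *: "u \<in> carrier (kosX [] X (Suc 0))"
      "kosD [] X D (Suc 0) u \<in> tors R F (kosX [] X (Suc (Suc 0)))"
    then obtain x where x: "u = Leaf x" by (auto elim: leaf_moduleE)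
    then obtain z v t where "z \<in> Y" "v \<in> carrier (X 0)" "t \<in> tors R F (X (Suc 0))"
      "x = z \<oplus>\<^bsub>X (Suc 0)\<^esub> (D 0 v \<oplus>\<^bsub>X (Suc 0)\<^esub> t)" using gen2[of x] * by auto
    then show "\<exists>z\<in>kos_emb [] X ` Y. \<exists>v\<in>carrier (kosX [] X 0). \<exists>t\<in>tors R F (kosX [] X (Suc 0)).
        u = z \<oplus>\<^bsub>kosX [] X (Suc 0)\<^esub> (kosD [] X D 0 v \<oplus>\<^bsub>kosX [] X (Suc 0)\<^esub> t)"
      using x by (intro bexI[of _ "Leaf z"] bexI[of _ "Leaf v"] bexI[of _ "Leaf t"]) auto
  qed
next
  case (Cons f fs)
  then interpret K: tree_complex R "kosX fs X" "kosD fs X D" using kos_complex by simp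
  have "kos_emb fs X ` Y \<subseteq> carrier (kosX fs X (Suc 0))" using kos_emb_hom(1)[of fs] Cons assms(3)
    by auto
  then show ?case using K.cone_generated[OF assms(2), of f "kos_emb fs X ` Y"] Cons
    by (simp add: image_image)
qed

text \<open>Injectivity, modulo torsion, of the map from \<open>Y / (f_1 Y + ... + f_s Y)\<close> to
  the cohomology of the iterated cone. A coboundary of the outermost cone has left entry
  \<open>D v' + f a\<close> with \<open>a\<close> a cocycle modulo torsion, hence represented by
  some \<open>y'\<close> in \<open>Y\<close>; subtracting \<open>f y'\<close> leaves a coboundary of
  the inner cones.\<close>

lemma kos_boundary_lin_comb:
  assumes "set fs \<subseteq> carrier R" "F \<subseteq> carrier R" and Y: "submodule Y R (X (Suc 0))"
    and gen: "generated_mod R F X D Y" and X0: "carrier (X 0) = {\<zero>\<^bsub>X 0\<^esub>}"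
    and "y \<in> Y" "v \<in> carrier (kosX fs X 0)" "t \<in> tors R F (kosX fs X (Suc 0))"
      "kos_emb fs X y = kosD fs X D 0 v \<oplus>\<^bsub>kosX fs X (Suc 0)\<^esub> t"
  shows "y \<in> lin_comb (X (Suc 0)) Y (tors R F (X (Suc 0))) fs"
  using assms(1,6-)
proof (induction fs arbitrary: y v t)
  case Nil
  then obtain x where "t = Leaf x" unfolding tors_def by (auto elim: leaf_moduleE)
  \<comment> \<open>As \<open>X 0\<close> is zero, there are no nonzero coboundaries at position 1
    and only the torsion summand remains.\<close>
  moreover have "v = Leaf \<zero>\<^bsub>X 0\<^esub>" using Nil X0 by (auto elim: leaf_moduleE)
  ultimately show ?case using Nil by (simp add: tors_def)
next
  case (Cons f fs)
  have fs: "set fs \<subseteq> carrier R" and f [simp]: "f \<in> carrier R" using Cons.prems by auto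
  interpret K: tree_complex R "kosX fs X" "kosD fs X D" using kos_complex[OF fs] .
  note [simp] = tors_node_module[OF K.modules K.modules]
  note T = K.X.submoduleE[OF K.X.submodule_tors[OF assms(2)]]
  note YS = X.submoduleE[OF Y]
  obtain v' a where v: "v = Node v' a"
    and c [simp]: "v' \<in> carrier (kosX fs X 0)" "a \<in> carrier (kosX fs X (Suc 0))"
    using Cons.prems(3) by (auto simp: cone_def elim: node_moduleE)
  obtain t1 t2
    where t: "t = Node t1 t2" "t1 \<in> tors R F (kosX fs X (Suc 0))" "t2 \<in> tors R F (kosX fs X (Suc (Suc 0)))"
    using Cons.prems(4) assms(2)
      by (auto simp: cone_def tors_def[of _ _ "node_module _ _"] elim!: node_moduleE) (auto simp: tors_def)
  have tc [simp]: "t1 \<in> carrier (kosX fs X (Suc 0))" "t2 \<in> carrier (kosX fs X (Suc (Suc 0)))"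
    using t T(1) by auto
  have e1: "kos_emb fs X y = kosD fs X D 0 v' \<oplus>\<^bsub>kosX fs X (Suc 0)\<^esub> f \<odot>\<^bsub>kosX fs X (Suc 0)\<^esub> a \<oplus>\<^bsub>kosX fs X (Suc 0)\<^esub> t1"
    and e2: "\<zero>\<^bsub>kosX fs X (Suc (Suc 0))\<^esub> = \<ominus>\<^bsub>kosX fs X (Suc (Suc 0))\<^esub> kosD fs X D (Suc 0) a \<oplus>\<^bsub>kosX fs X (Suc (Suc 0))\<^esub> t2"
    using Cons.prems(5) unfolding v t by (auto simp: cone_def)
  \<comment> \<open>The right entry of the embedded \<open>y\<close> is zero, which forces
    \<open>a\<close> to be a cocycle modulo torsion.\<close>
  have "kosD fs X D (Suc 0) a = t2"
    using e2
      by (metis K.D_closed K.X.M.minus_equality K.X.M.minus_minus K.X.M.add.inv_closed c(2) tc(2) K.X.M.a_comm)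
  then have "kosD fs X D (Suc 0) a \<in> tors R F (kosX fs X (Suc (Suc 0)))" using t by simp
  from kos_generated[OF fs assms(2) YS(1) gen, unfolded generated_mod_def, THEN conjunct2, rule_format, OF _ this]
  obtain y' v'' t3 where y': "y' \<in> Y" and c2 [simp]: "v'' \<in> carrier (kosX fs X 0)"
    and t3: "t3 \<in> tors R F (kosX fs X (Suc 0))"
    and a: "a = kos_emb fs X y' \<oplus>\<^bsub>kosX fs X (Suc 0)\<^esub> (kosD fs X D 0 v'' \<oplus>\<^bsub>kosX fs X (Suc 0)\<^esub> t3)"
      by auto
  have t3c [simp]: "t3 \<in> carrier (kosX fs X (Suc 0))" using t3 T(1) by blast
  have yc [simp]: "y \<in> carrier (X (Suc 0))" "y' \<in> carrier (X (Suc 0))" using Cons.prems(2) y' YS(1)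
    by auto
  note E = kos_emb_hom[OF fs]
  have ec [simp]: "kos_emb fs X y \<in> carrier (kosX fs X (Suc 0))" "kos_emb fs X y' \<in> carrier (kosX fs X (Suc 0))"
    using E(1) by auto
  have "kos_emb fs X (y \<ominus>\<^bsub>X (Suc 0)\<^esub> f \<odot>\<^bsub>X (Suc 0)\<^esub> y') =
      kos_emb fs X y \<oplus>\<^bsub>kosX fs X (Suc 0)\<^esub> \<ominus>\<^bsub>kosX fs X (Suc 0)\<^esub> (f \<odot>\<^bsub>kosX fs X (Suc 0)\<^esub> kos_emb fs X y')"
    unfolding a_minus_def X.minus_one_smult[symmetric, OF X.smult_closed[OF f yc(2)]]
    by (simp add: E(2,3) K.X.minus_one_smult)
  also have "\<dots> = kosD fs X D 0 (v' \<oplus>\<^bsub>kosX fs X 0\<^esub> f \<odot>\<^bsub>kosX fs X 0\<^esub> v'') \<oplus>\<^bsub>kosX fs X (Suc 0)\<^esub>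
      (f \<odot>\<^bsub>kosX fs X (Suc 0)\<^esub> t3 \<oplus>\<^bsub>kosX fs X (Suc 0)\<^esub> t1)"
    unfolding e1 a
    using K.X.M.add_cancel_rearrange2[of "kosD fs X D 0 v'" "Suc 0" "f \<odot>\<^bsub>kosX fs X (Suc 0)\<^esub> kos_emb fs X y'"
        "f \<odot>\<^bsub>kosX fs X (Suc 0)\<^esub> kosD fs X D 0 v''" "f \<odot>\<^bsub>kosX fs X (Suc 0)\<^esub> t3" t1]
    by (simp add: K.X.smult_r_distr)
  finally have eq: "kos_emb fs X (y \<ominus>\<^bsub>X (Suc 0)\<^esub> f \<odot>\<^bsub>X (Suc 0)\<^esub> y') = \<dots>" .
  have "y \<ominus>\<^bsub>X (Suc 0)\<^esub> f \<odot>\<^bsub>X (Suc 0)\<^esub> y' \<in> Y"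
    unfolding a_minus_def by (rule YS(5)[OF Cons.prems(2) YS(3)[OF YS(4)[OF f y']]])
  from Cons.IH[OF fs this _ _ eq] have "y \<ominus>\<^bsub>X (Suc 0)\<^esub> f \<odot>\<^bsub>X (Suc 0)\<^esub> y' \<in> lin_comb (X (Suc 0)) Y (tors R F (X (Suc 0))) fs"
    using T(4)[OF f t3] T(5) t by simp
  then show ?case using y' by auto
qed

text \<open>The embedded \<open>y\<close> is a cocycle modulo torsion, hence a coboundary modulo
  torsion by \<open>kos_acyclic\<close>; then \<open>kos_boundary_lin_comb\<close> applies. For all
  \<open>y\<close> in \<open>Y\<close> together this is the equation \<open>I T = T\<close>.\<close>

proposition lin_comb_if_acyclic:
  assumes "set fs \<subseteq> carrier R" "divisible R (set fs) X" "generated_mod R (set fs) X D Y"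
    and "submodule Y R (X (Suc 0))" "carrier (X 0) = {\<zero>\<^bsub>X 0\<^esub>}"
    and "y \<in> Y" "D (Suc 0) y \<in> tors R (set fs) (X (Suc (Suc 0)))"
  shows "y \<in> lin_comb (X (Suc 0)) Y (tors R (set fs) (X (Suc 0))) fs"
proof -
  have y: "y \<in> carrier (X (Suc 0))" using X.submoduleE(1)[OF assms(4)] assms(6) by blast
  from kos_acyclic[OF order_refl assms(1,2), unfolded acyclic_mod_def, rule_format,
      OF kos_emb_hom(1)[OF assms(1) y] kos_emb_hom(4)[OF assms(1) y assms(1,7)]]
  show ?thesis using kos_boundary_lin_comb[OF assms(1,1,4,3,5,6)] by auto
qed

end

section \<open>Quotients, homomorphisms and associated primes\<close>

lemma (in abelian_group) a_inv_zero: "\<ominus> \<zero> = \<zero>"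
  by (simp add: a_inv_def)

lemma quot_module_simps [simp]:
  "\<zero>\<^bsub>quot_module M U\<^esub> = U"
  "carrier (quot_module M U) = (\<lambda>x. U +>\<^bsub>M\<^esub> x) ` carrier M"
  by (auto simp: quot_module_def A_RCOSETS_def')

context module
begin

lemma abelian_subgroup_submodule:
  assumes "submodule U R M" shows "abelian_subgroup U M"
  by (rule abelian_subgroupI3)
    (use submodule.axioms(1)[OF assms] M.abelian_group_axioms in \<open>auto simp: additive_subgroup_def\<close>)

lemma quot_module_add:
  assumes "submodule U R M" "x \<in> carrier M" "y \<in> carrier M"
  shows "(U +>\<^bsub>M\<^esub> x) \<oplus>\<^bsub>quot_module M U\<^esub> (U +>\<^bsub>M\<^esub> y) = U +>\<^bsub>M\<^esub> (x \<oplus>\<^bsub>M\<^esub> y)"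
  using abelian_subgroup.a_rcos_sum[OF abelian_subgroup_submodule[OF assms(1)] assms(2,3)]
  by (simp add: quot_module_def)

lemma coset_eq_iff:
  assumes "submodule U R M" "x \<in> carrier M" "y \<in> carrier M"
  shows "U +>\<^bsub>M\<^esub> x = U +>\<^bsub>M\<^esub> y \<longleftrightarrow> x \<ominus>\<^bsub>M\<^esub> y \<in> U"
proof -
  interpret U: abelian_subgroup U M by (rule abelian_subgroup_submodule[OF assms(1)])
  show ?thesis
    using U.a_rcos_module[OF assms(3,2)] U.a_repr_independence'[of x y] U.a_rcos_self[of x] assms
    by (auto simp: a_minus_def)
qed

lemma quot_module_smult:
  assumes U: "submodule U R M" and "r \<in> carrier R" "x \<in> carrier M"
  shows "r \<odot>\<^bsub>quot_module M U\<^esub> (U +>\<^bsub>M\<^esub> x) = U +>\<^bsub>M\<^esub> (r \<odot>\<^bsub>M\<^esub> x)"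
proof -
  interpret U: abelian_subgroup U M by (rule abelian_subgroup_submodule[OF U])
  note S = submoduleE[OF U]
  have "U +>\<^bsub>M\<^esub> (r \<odot>\<^bsub>M\<^esub> y) = U +>\<^bsub>M\<^esub> (r \<odot>\<^bsub>M\<^esub> x)" if y: "y \<in> U +>\<^bsub>M\<^esub> x" for y
  proof -
    have yc: "y \<in> carrier M" using U.a_elemrcos_carrier[OF assms(3) y] .
    have "y \<ominus>\<^bsub>M\<^esub> x \<in> U" using U.a_rcos_module[OF assms(3) yc] y by (simp add: a_minus_def)
    then have "r \<odot>\<^bsub>M\<^esub> (y \<ominus>\<^bsub>M\<^esub> x) \<in> U" using S(4) assms(2) by blast
    then show ?thesis
      using coset_eq_iff[OF U, of "r \<odot>\<^bsub>M\<^esub> y" "r \<odot>\<^bsub>M\<^esub> x"] assms yc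
      by (simp add: a_minus_def smult_r_distr smult_r_minus)
  qed
  then have "(\<Union>y\<in>U +>\<^bsub>M\<^esub> x. U +>\<^bsub>M\<^esub> (r \<odot>\<^bsub>M\<^esub> y)) = (\<Union>y\<in>U +>\<^bsub>M\<^esub> x. U +>\<^bsub>M\<^esub> (r \<odot>\<^bsub>M\<^esub> x))" by simp
  also have "\<dots> = U +>\<^bsub>M\<^esub> (r \<odot>\<^bsub>M\<^esub> x)" using U.a_rcos_self[OF assms(3)] by blast
  finally show ?thesis by (simp add: quot_module_def)
qed

lemma coset_zero: "submodule U R M \<Longrightarrow> U +>\<^bsub>M\<^esub> \<zero>\<^bsub>M\<^esub> = U"
  using submoduleE(1) M.a_coset_add_zero by auto

lemma coset_eq_zero_iff:
  assumes "submodule U R M" "x \<in> carrier M"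
  shows "U +>\<^bsub>M\<^esub> x = U \<longleftrightarrow> x \<in> U"
  using coset_eq_iff[OF assms M.zero_closed] coset_zero[OF assms(1)] assms(2)
    by (simp add: a_minus_def M.a_inv_zero)

lemma module_quot_module:
  assumes U: "submodule U R M" shows "module R (quot_module M U)"
proof (rule moduleI)
  note [simp] = quot_module_add[OF U] quot_module_smult[OF U]
  show "abelian_group (quot_module M U)"
  proof (rule abelian_groupI)
    show "\<exists>y\<in>carrier (quot_module M U). y \<oplus>\<^bsub>quot_module M U\<^esub> x = \<zero>\<^bsub>quot_module M U\<^esub>"
      if x: "x \<in> carrier (quot_module M U)" for x
    proof -
      obtain a where a: "a \<in> carrier M" "x = U +>\<^bsub>M\<^esub> a" using x by auto
      have "(U +>\<^bsub>M\<^esub> (\<ominus>\<^bsub>M\<^esub> a)) \<oplus>\<^bsub>quot_module M U\<^esub> x = \<zero>\<^bsub>quot_module M U\<^esub>"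
        unfolding a(2) using a(1) coset_zero[OF U] by (simp add: M.l_neg)
      moreover have "U +>\<^bsub>M\<^esub> (\<ominus>\<^bsub>M\<^esub> a) \<in> carrier (quot_module M U)" using a(1) by simp
      ultimately show ?thesis by blast
    qed
    show "\<zero>\<^bsub>quot_module M U\<^esub> \<in> carrier (quot_module M U)" using coset_zero[OF U] by force
    show "\<zero>\<^bsub>quot_module M U\<^esub> \<oplus>\<^bsub>quot_module M U\<^esub> x = x" if x: "x \<in> carrier (quot_module M U)" for x
    proof -
      obtain a where a: "a \<in> carrier M" "x = U +>\<^bsub>M\<^esub> a" using x by auto
      then show ?thesis using quot_module_add[OF U M.zero_closed a(1)] coset_zero[OF U] by simp
    qed
  qed (auto simp: M.a_ac)
qed (auto simp: quot_module_add[OF U] quot_module_smult[OF U] smult_l_distr smult_r_distr smult_assoc1 R.is_cring)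

end

lemma Hom_module_simps [simp]:
  "carrier (Hom_module R M N) = mod_hom R M N" "\<zero>\<^bsub>Hom_module R M N\<^esub> = (\<lambda>x\<in>carrier M. \<zero>\<^bsub>N\<^esub>)"
  "f \<oplus>\<^bsub>Hom_module R M N\<^esub> g = (\<lambda>x\<in>carrier M. f x \<oplus>\<^bsub>N\<^esub> g x)"
  "r \<odot>\<^bsub>Hom_module R M N\<^esub> f = (\<lambda>x\<in>carrier M. r \<odot>\<^bsub>N\<^esub> f x)"
  by (auto simp: Hom_module_def)

lemma mod_homI:
  assumes "f \<in> carrier M \<rightarrow>\<^sub>E carrier N"
    "\<And>x y. x \<in> carrier M \<Longrightarrow> y \<in> carrier M \<Longrightarrow> f (x \<oplus>\<^bsub>M\<^esub> y) = f x \<oplus>\<^bsub>N\<^esub> f y"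
    "\<And>r x. r \<in> carrier R \<Longrightarrow> x \<in> carrier M \<Longrightarrow> f (r \<odot>\<^bsub>M\<^esub> x) = r \<odot>\<^bsub>N\<^esub> f x"
  shows "f \<in> mod_hom R M N"
  using assms unfolding mod_hom_def by auto

lemma module_Hom_module:
  assumes "module R M" "module R N" shows "module R (Hom_module R M N)"
proof -
  interpret M: module R M by fact
  interpret N: module R N by fact
  note D = mod_homD[of _ R M N]
  have ext: "f = g" if "f \<in> mod_hom R M N" "g \<in> mod_hom R M N" "\<And>x. x \<in> carrier M \<Longrightarrow> f x = g x" for f g
    using D(1)[OF that(1)] D(1)[OF that(2)] that(3) by (rule PiE_ext)
  have add: "(\<lambda>x\<in>carrier M. f x \<oplus>\<^bsub>N\<^esub> g x) \<in> mod_hom R M N" if "f \<in> mod_hom R M N" "g \<in> mod_hom R M N" for f g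
    by (rule mod_homI) (use D[OF that(1)] D[OF that(2)] in \<open>auto simp: N.M.a_ac N.smult_r_distr\<close>)
  have smult: "(\<lambda>x\<in>carrier M. r \<odot>\<^bsub>N\<^esub> f x) \<in> mod_hom R M N" if "r \<in> carrier R" "f \<in> mod_hom R M N" for f r
    by (rule mod_homI) (use D[OF that(2)] that in \<open>auto simp: N.smult_r_distr N.smult_swap\<close>)
  have zero: "(\<lambda>x\<in>carrier M. \<zero>\<^bsub>N\<^esub>) \<in> mod_hom R M N" by (rule mod_homI) auto
  show ?thesis
  proof (rule moduleI)
    show "abelian_group (Hom_module R M N)"
    proof (rule abelian_groupI)
      show "\<exists>g\<in>carrier (Hom_module R M N). g \<oplus>\<^bsub>Hom_module R M N\<^esub> f = \<zero>\<^bsub>Hom_module R M N\<^esub>"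
        if "f \<in> carrier (Hom_module R M N)" for f
      proof (rule bexI[of _ "\<lambda>x\<in>carrier M. (\<ominus>\<^bsub>R\<^esub> \<one>\<^bsub>R\<^esub>) \<odot>\<^bsub>N\<^esub> f x"])
        show "(\<lambda>x\<in>carrier M. (\<ominus>\<^bsub>R\<^esub> \<one>\<^bsub>R\<^esub>) \<odot>\<^bsub>N\<^esub> f x) \<oplus>\<^bsub>Hom_module R M N\<^esub> f = \<zero>\<^bsub>Hom_module R M N\<^esub>"
          using that D(2)[of f] by (auto simp: N.minus_one_smult N.M.l_neg fun_eq_iff restrict_def)
      qed (use smult that in auto)
      show "f \<oplus>\<^bsub>Hom_module R M N\<^esub> g \<in> carrier (Hom_module R M N)"
        if "f \<in> carrier (Hom_module R M N)" "g \<in> carrier (Hom_module R M N)" for f g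
        using add[of f g] that by simp
      show "\<zero>\<^bsub>Hom_module R M N\<^esub> \<in> carrier (Hom_module R M N)" using zero by simp
      show "\<zero>\<^bsub>Hom_module R M N\<^esub> \<oplus>\<^bsub>Hom_module R M N\<^esub> f = f" if "f \<in> carrier (Hom_module R M N)" for f
        using D(1,2)[of f] that by (auto simp: fun_eq_iff restrict_def PiE_def extensional_def)
    qed (auto intro!: restrict_ext simp: N.M.a_ac D(2))
  next
    show "r \<odot>\<^bsub>Hom_module R M N\<^esub> f \<in> carrier (Hom_module R M N)"
      if "r \<in> carrier R" "f \<in> carrier (Hom_module R M N)" for r f using smult[of r f] that by simp
    show "\<one>\<^bsub>R\<^esub> \<odot>\<^bsub>Hom_module R M N\<^esub> f = f" if "f \<in> carrier (Hom_module R M N)" for f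
      using D(1,2)[of f] that by (auto simp: fun_eq_iff restrict_def PiE_def extensional_def)
  qed (auto intro!: restrict_ext simp: N.smult_l_distr N.smult_r_distr N.smult_assoc1 M.R.is_cring D(2))
qed

lemma star_Hom_simps [simp]:
  "\<zero>\<^bsub>star_Hom R M GM N GN\<^esub> = (\<lambda>x\<in>carrier M. \<zero>\<^bsub>N\<^esub>)"
  "f \<oplus>\<^bsub>star_Hom R M GM N GN\<^esub> g = (\<lambda>x\<in>carrier M. f x \<oplus>\<^bsub>N\<^esub> g x)"
  "r \<odot>\<^bsub>star_Hom R M GM N GN\<^esub> f = (\<lambda>x\<in>carrier M. r \<odot>\<^bsub>N\<^esub> f x)"
  by (auto simp: star_Hom_def)

text \<open>\<open>star_Hom\<close> is generated as a group only. Scalars preserve it because a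
  homogeneous scalar shifts the degree of a homogeneous map, and every scalar is a sum of
  homogeneous ones.\<close>

lemma (in graded_cring) submodule_star_Hom:
  assumes M: "module R M" and N: "graded_module R G N GN"
    and GM: "\<And>d. GM d \<subseteq> carrier M"
  shows "submodule (carrier (star_Hom R M GM N GN)) R (Hom_module R M N)"
    and "hom_of_degree R M GM N GN a \<subseteq> carrier (star_Hom R M GM N GN)"
proof -
  interpret N: graded_mod R N G GN using N by (rule graded_modI)
  interpret H: module R "Hom_module R M N" by (rule module_Hom_module[OF M N.module_axioms])
  let ?S = "\<Union>a. hom_of_degree R M GM N GN a" and ?H = "Hom_module R M N"
  have c: "carrier (star_Hom R M GM N GN) = generate (add_monoid ?H) ?S" by (simp add: star_Hom_def)
  show "hom_of_degree R M GM N GN a \<subseteq> carrier (star_Hom R M GM N GN)" unfolding c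
    by (auto intro: generate.incl)
  have S: "?S \<subseteq> carrier (add_monoid ?H)" by (auto simp: hom_of_degree_def)
  have sg: "subgroup (generate (add_monoid ?H) ?S) (add_monoid ?H)"
    by (rule group.generate_is_subgroup[OF H.M.a_group S])
  have gc: "\<psi> \<in> carrier ?H" if "\<psi> \<in> generate (add_monoid ?H) ?S" for \<psi>
    using subgroup.mem_carrier[OF sg that] by simp
  have one: "\<zero>\<^bsub>?H\<^esub> \<in> generate (add_monoid ?H) ?S"
    using subgroup.one_closed[OF sg] by (simp del: Hom_module_simps)
  have add: "f \<oplus>\<^bsub>?H\<^esub> g \<in> generate (add_monoid ?H) ?S"
    if "f \<in> generate (add_monoid ?H) ?S" "g \<in> generate (add_monoid ?H) ?S" for f g
    using subgroup.m_closed[OF sg that] by (simp del: Hom_module_simps)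
  have hom: "r \<odot>\<^bsub>?H\<^esub> h \<in> ?S" if r: "r \<in> G d" and h: "h \<in> ?S" for r d h
  proof -
    obtain a where a: "h \<in> hom_of_degree R M GM N GN a" using h by blast
    have hm: "h \<in> mod_hom R M N" using hom_of_degreeD(1)[OF a] .
    have "r \<odot>\<^bsub>?H\<^esub> h \<in> mod_hom R M N" using H.smult_closed[OF G_carrier[OF r], of h] hm by simp
    moreover have "(r \<odot>\<^bsub>?H\<^esub> h) x \<in> GN (e + (d + a))" if x: "x \<in> GM e" for x e
    proof -
      have "r \<odot>\<^bsub>N\<^esub> h x \<in> GN (d + (e + a))" by (rule N.GM_smult[OF r hom_of_degreeD(2)[OF a x]])
      then show ?thesis using GM x by (auto simp: algebra_simps)
    qed
    ultimately show ?thesis unfolding hom_of_degree_def by blast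
  qed
  have "\<forall>\<psi>\<in>generate (add_monoid ?H) ?S. r \<odot>\<^bsub>?H\<^esub> \<psi> \<in> generate (add_monoid ?H) ?S"
    if r: "r \<in> carrier R" for r
  proof -
    from r have "r \<in> carrier (regular_module R)" by simp
    then show ?thesis
    proof (induction r rule: reg.homog_induct)
      case zero
      then show ?case using gc one by (simp del: Hom_module_simps)
    next
      case (homog r d)
      show ?case
      proof
        fix \<psi> assume "\<psi> \<in> generate (add_monoid ?H) ?S"
        then show "r \<odot>\<^bsub>?H\<^esub> \<psi> \<in> generate (add_monoid ?H) ?S"
        proof (induction \<psi> rule: generate.induct)
          case one
          then show ?case using H.smult_r_null[OF G_carrier[OF homog]] \<open>\<zero>\<^bsub>?H\<^esub> \<in> _\<close>
            by (simp del: Hom_module_simps)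
        next
          case (incl h)
          then show ?case using generate.incl[OF hom[OF homog]] by blast
        next
          case (inv h)
          have hc: "h \<in> carrier ?H" using inv S by auto
          have "r \<odot>\<^bsub>?H\<^esub> (\<ominus>\<^bsub>?H\<^esub> h) = \<ominus>\<^bsub>?H\<^esub> (r \<odot>\<^bsub>?H\<^esub> h)"
            by (rule H.smult_r_minus[OF G_carrier[OF homog] hc])
          then show ?case using generate.inv[OF hom[OF homog inv], of "add_monoid ?H"]
            by (simp add: a_inv_def del: Hom_module_simps)
        next
          case (eng h1 h2)
          then show ?case using H.smult_r_distr[OF G_carrier[OF homog] gc gc, of h1 h2] add
            by (simp del: Hom_module_simps)
        qed
      qed
    next
      case (add r s)
      then show ?case using gc H.smult_l_distr[of r s] \<open>\<And>f g. f \<in> _ \<Longrightarrow> g \<in> _ \<Longrightarrow> f \<oplus>\<^bsub>?H\<^esub> g \<in> _\<close>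
        by (simp del: Hom_module_simps)
    qed
  qed
  then show "submodule (carrier (star_Hom R M GM N GN)) R ?H"
    unfolding c submodule_def submodule_axioms_def using sg by (simp del: Hom_module_simps)
qed

text \<open>Among the annihilators of nonzero elements that contain
  \<open>annihilator R M x\<close>, a maximal one is prime: if \<open>b y\<close> is nonzero, its
  annihilator contains that of \<open>y\<close> and thus equals it.\<close>

lemma (in noeth_graded_cring) Ass_exists:
  assumes M: "module R M" and x: "x \<in> carrier M" "x \<noteq> \<zero>\<^bsub>M\<^esub>"
  shows "\<exists>p\<in>Ass R M. annihilator R M x \<subseteq> p"
proof -
  interpret M: module R M by fact
  let ?A = "{annihilator R M y |y. y \<in> carrier M \<and> y \<noteq> \<zero>\<^bsub>M\<^esub> \<and> annihilator R M x \<subseteq> annihilator R M y}"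
  have "\<exists>J\<in>?A. \<forall>K\<in>?A. J \<subseteq> K \<longrightarrow> K = J"
    by (rule noeth) (use x M.ideal_annihilator in auto)
  then obtain y where y: "y \<in> carrier M" "y \<noteq> \<zero>\<^bsub>M\<^esub>" "annihilator R M x \<subseteq> annihilator R M y"
    and mx: "\<And>z. z \<in> carrier M \<Longrightarrow> z \<noteq> \<zero>\<^bsub>M\<^esub> \<Longrightarrow> annihilator R M y \<subseteq> annihilator R M z \<Longrightarrow>
      annihilator R M z = annihilator R M y" by (auto intro: order_trans) (metis (no_types, lifting) order_trans)
  have "primeideal (annihilator R M y) R"
  proof (rule primeidealI)
    show "ideal (annihilator R M y) R" by (rule M.ideal_annihilator[OF y(1)])
    show "carrier R \<noteq> annihilator R M y"
    proof
      assume "carrier R = annihilator R M y"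
      then have "\<one> \<in> annihilator R M y" using R.one_closed by simp
      then show False using y by (simp add: annihilator_def)
    qed
    fix a b assume ab: "a \<in> carrier R" "b \<in> carrier R" "a \<otimes> b \<in> annihilator R M y"
    show "a \<in> annihilator R M y \<or> b \<in> annihilator R M y"
    proof (rule disjCI)
      assume "b \<notin> annihilator R M y"
      then have "b \<odot>\<^bsub>M\<^esub> y \<noteq> \<zero>\<^bsub>M\<^esub>" using ab unfolding annihilator_def by simp
      moreover have "annihilator R M y \<subseteq> annihilator R M (b \<odot>\<^bsub>M\<^esub> y)"
        unfolding annihilator_def using ab y M.smult_swap[of _ b y] by auto
      ultimately have "annihilator R M (b \<odot>\<^bsub>M\<^esub> y) = annihilator R M y" using mx ab y by simp
      moreover have "a \<in> annihilator R M (b \<odot>\<^bsub>M\<^esub> y)"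
        using ab y by (simp add: annihilator_def M.smult_assoc1)
      ultimately show "a \<in> annihilator R M y" by simp
    qed
  qed (rule R.is_cring)
  then show ?thesis using y unfolding Ass_def by blast
qed

section \<open>Homogeneous ideals and torsion\<close>

context graded_cring
begin

lemma homogeneous_carrier: "homogeneous_elements G \<subseteq> carrier R"
  using G_carrier unfolding homogeneous_elements_def by auto

lemma rc_minus: "x \<in> carrier R \<Longrightarrow> rc (\<ominus> x) d = \<ominus> rc x d"
  using rc_add[of x "\<ominus> x" d] rc_zero rc_carrier[of x d] rc_carrier[of "\<ominus> x" d]
  by (metis R.add.inv_closed R.add.inv_equality R.a_comm R.r_neg a_inv_def)

text \<open>Homogeneity is defined through generators. The elements with all components in
  \<open>J\<close> form an ideal that contains these generators, hence all of
  \<open>J\<close>.\<close>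

lemma homogeneous_ideal_component:
  assumes J: "homogeneous_ideal R G J" and x: "x \<in> J"
  shows "rc x d \<in> J"
proof -
  obtain S where S: "S \<subseteq> homogeneous_elements G" "J = Idl S" and id: "ideal J R"
    using J unfolding homogeneous_ideal_def by blast
  interpret J: ideal J R by (rule id)
  let ?K = "{x \<in> carrier R. \<forall>d. rc x d \<in> J}"
  have mult: "\<forall>x\<in>?K. r \<otimes> x \<in> ?K" if "r \<in> carrier R" for r
  proof -
    from that have "r \<in> carrier (regular_module R)" by simp
    then show ?thesis
    proof (induction r rule: reg.homog_induct)
      case (homog r e)
      then show ?case using G_carrier[OF homog] by (auto simp: rc_mult intro!: J.I_l_closed)
    qed (auto simp: l_distr rc_add rc_zero intro!: J.a_closed)
  qed
  have "ideal ?K R"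
  proof (rule idealI)
    have "\<zero> \<in> ?K" by (simp add: rc_zero J.zero_closed)
    moreover have "\<ominus> a \<in> ?K" if "a \<in> ?K" for a
      using that by (simp add: rc_minus J.a_inv_closed)
    moreover have "a \<oplus> b \<in> ?K" if "a \<in> ?K" "b \<in> ?K" for a b
      using that by (simp add: rc_add J.a_closed)
    ultimately show "subgroup ?K (add_monoid R)"
      using R.add.subgroupI[of ?K] unfolding a_inv_def by auto
    show "x \<otimes> a \<in> ?K" if "a \<in> ?K" "x \<in> carrier R" for a x using mult that by blast
    show "a \<otimes> x \<in> ?K" if "a \<in> ?K" "x \<in> carrier R" for a x
      using mult[OF that(2)] that by (simp add: m_comm)
  qed (rule R.ring_axioms)
  moreover have "S \<subseteq> ?K"
  proof
    fix s assume s: "s \<in> S"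
    then obtain e where e: "s \<in> G e" using S unfolding homogeneous_elements_def by blast
    have "s \<in> J" using s S homogeneous_carrier genideal_self[of S] by auto
    then show "s \<in> ?K" using G_carrier[OF e] rc_homog[OF e] J.zero_closed by simp
  qed
  ultimately have "J \<subseteq> ?K" unfolding S(2) by (rule genideal_minimal)
  then show ?thesis using x by blast
qed

lemma homogeneous_ideal_genideal:
  assumes "S \<subseteq> homogeneous_elements G" shows "homogeneous_ideal R G (Idl S)"
  unfolding homogeneous_ideal_def using assms genideal_ideal[of S] homogeneous_carrier by blast

lemma ideal_component_sum:
  assumes "ideal J R" "x \<in> carrier R" "\<And>d. rc x d \<in> J" shows "x \<in> J"
proof -
  interpret J: ideal J R by fact
  show ?thesis
    by (rule reg.in_if_cp_in) (use assms(2,3) J.zero_closed J.a_closed J.Icarr in auto)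
qed

end

lemma (in cring) genideal_singleton_iff:
  "f \<in> carrier R \<Longrightarrow> x \<in> Idl {f} \<longleftrightarrow> (\<exists>r\<in>carrier R. x = r \<otimes> f)"
  using cgenideal_eq_genideal[of f] unfolding cgenideal_def by blast

section \<open>Powers and radicals of finitely generated ideals\<close>

context cring
begin

lemma ideal_pow_ideal:
  assumes "ideal I R" shows "ideal (I [^]\<^bsub>ideals_set R\<^esub> (n::nat)) R"
proof -
  interpret S: comm_monoid "ideals_set R" by (rule ideals_set_is_comm_monoid)
  show ?thesis using S.nat_pow_closed[of I n] assms by (simp add: ideals_set_def)
qed

lemma ideal_pow_0: "I [^]\<^bsub>ideals_set R\<^esub> (0::nat) = carrier R"
  by (simp add: ideals_set_def nat_pow_def)

lemma ideal_pow_Suc: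
  "I [^]\<^bsub>ideals_set R\<^esub> Suc n = ideal_prod R (I [^]\<^bsub>ideals_set R\<^esub> (n::nat)) I"
  by (simp add: ideals_set_def nat_pow_def)

lemma ideal_pow_mono:
  assumes "ideal I R" "n \<le> (m::nat)"
  shows "I [^]\<^bsub>ideals_set R\<^esub> m \<subseteq> I [^]\<^bsub>ideals_set R\<^esub> n"
  using assms(2)
proof (induction m rule: dec_induct)
  case (step k)
  then show ?case using ideal_prod_inter[OF ideal_pow_ideal[OF assms(1), of k] assms(1)]
    unfolding ideal_pow_Suc by blast
qed simp

lemma pow_in_ideal_pow:
  assumes "ideal I R" "x \<in> I" shows "x [^] (n::nat) \<in> I [^]\<^bsub>ideals_set R\<^esub> n"
proof (induction n)
  case (Suc n)
  then show ?case unfolding ideal_pow_Suc nat_pow_Suc using assms(2) by (rule ideal_prod.prod)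
qed (simp only: ideal_pow_0 nat_pow_0 one_closed)

text \<open>Induction on the sum of the exponents replaces an expansion of the power of the ideal
  into monomials: passing from \<open>x\<close> to \<open>f x\<close> lowers the exponent of
  \<open>f\<close> by one.\<close>

lemma genideal_pow_smult_subset:
  assumes F: "finite F" "F \<subseteq> carrier R" and K: "ideal K R"
  shows "x \<in> carrier R \<Longrightarrow> (\<And>f. f \<in> F \<Longrightarrow> f [^] (ex f :: nat) \<otimes> x \<in> K) \<Longrightarrow>
    \<exists>N::nat. \<forall>b\<in>(Idl F) [^]\<^bsub>ideals_set R\<^esub> N. b \<otimes> x \<in> K"
proof (induction "\<Sum>f\<in>F. ex f" arbitrary: ex x rule: less_induct)
  case less
  interpret K: ideal K R by (rule K)
  have I: "ideal (Idl F) R" by (rule genideal_ideal[OF F(2)])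
  note x [simp] = less.prems(1)
  show ?case
  proof (cases "\<exists>f\<in>F. ex f = 0")
    case True
    then have "x \<in> K" using less.prems(2) by force
    then have "\<forall>b\<in>(Idl F) [^]\<^bsub>ideals_set R\<^esub> (0::nat). b \<otimes> x \<in> K"
      unfolding ideal_pow_0 using K.I_l_closed by blast
    then show ?thesis by blast
  next
    case False
    have "\<forall>f\<in>F. \<exists>N::nat. \<forall>b\<in>(Idl F) [^]\<^bsub>ideals_set R\<^esub> N. b \<otimes> (f \<otimes> x) \<in> K"
    proof
      fix f assume f: "f \<in> F"
      have fc [simp]: "f \<in> carrier R" using f F by blast
      let ?ex = "ex(f := ex f - 1)"
      have "sum ?ex F < sum ex F"
        by (rule sum_strict_mono_ex1[OF F(1)]) (use f False in auto)
      moreover have "g [^] ?ex g \<otimes> (f \<otimes> x) \<in> K" if g: "g \<in> F" for g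
      proof -
        have gc [simp]: "g \<in> carrier R" using g F by blast
        show ?thesis
        proof (cases "g = f")
          case True
          have "Suc (ex f - 1) = ex f" using \<open>\<not> (\<exists>f\<in>F. ex f = 0)\<close> f by auto
          then have "f [^] ex f = f [^] (ex f - 1) \<otimes> f" by (metis nat_pow_Suc)
          then have "f [^] (ex f - 1) \<otimes> (f \<otimes> x) = f [^] ex f \<otimes> x" by (simp add: m_assoc)
          then show ?thesis using less.prems(2)[OF f] True by simp
        next
          case False
          have "g [^] ex g \<otimes> (f \<otimes> x) = f \<otimes> (g [^] ex g \<otimes> x)" by (simp add: m_lcomm)
          then show ?thesis using less.prems(2)[OF g] False K.I_l_closed by simp
        qed
      qed
      ultimately show "\<exists>N::nat. \<forall>b\<in>(Idl F) [^]\<^bsub>ideals_set R\<^esub> N. b \<otimes> (f \<otimes> x) \<in> K"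
        using less.hyps[of ?ex "f \<otimes> x"] by simp
    qed
    then obtain N :: "'a \<Rightarrow> nat"
      where N: "\<And>f b. f \<in> F \<Longrightarrow> b \<in> (Idl F) [^]\<^bsub>ideals_set R\<^esub> N f \<Longrightarrow> b \<otimes> (f \<otimes> x) \<in> K"
      by metis
    \<comment> \<open>A common exponent for all \<open>f x\<close>, since powers of an ideal
      decrease; one further factor from \<open>Idl F\<close> then supplies the multipliers
      \<open>f\<close>.\<close>
    define M where "M = (\<Sum>f\<in>F. N f)"
    have Mf: "b \<otimes> (f \<otimes> x) \<in> K" if "f \<in> F" "b \<in> (Idl F) [^]\<^bsub>ideals_set R\<^esub> M" for f b
      using N[OF that(1)] ideal_pow_mono[OF I, of "N f" M] member_le_sum[of f F N] that F(1)
        unfolding M_def by auto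
    have "b \<otimes> a \<otimes> x \<in> K" if b: "b \<in> (Idl F) [^]\<^bsub>ideals_set R\<^esub> M" and a: "a \<in> Idl F" for a b
    proof -
      have bc [simp]: "b \<in> carrier R" using ideal.Icarr[OF ideal_pow_ideal[OF I] b] .
      let ?L = "{a \<in> carrier R. b \<otimes> a \<otimes> x \<in> K}"
      have "ideal ?L R"
      proof (rule idealI)
        have "\<zero> \<in> ?L" by simp
        then have "?L \<noteq> {}" by blast
        moreover have "\<ominus> a \<in> ?L" if "a \<in> ?L" for a
          using that K.a_inv_closed by (simp add: l_minus r_minus)
        moreover have "a \<oplus> c \<in> ?L" if "a \<in> ?L" "c \<in> ?L" for a c
          using that by (simp add: l_distr r_distr)
        ultimately show "subgroup ?L (add_monoid R)"
          using add.subgroupI[of ?L] unfolding a_inv_def by auto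
        show *: "c \<otimes> a \<in> ?L" if "a \<in> ?L" "c \<in> carrier R" for a c
        proof -
          have "b \<otimes> (c \<otimes> a) \<otimes> x = c \<otimes> (b \<otimes> a \<otimes> x)" using that by (simp add: m_ac)
          then show ?thesis using that K.I_l_closed[of "b \<otimes> a \<otimes> x" c] by simp
        qed
        show "a \<otimes> c \<in> ?L" if "a \<in> ?L" "c \<in> carrier R" for a c
          using *[OF that] that by (simp add: m_comm)
      qed (rule ring_axioms)
      moreover have "F \<subseteq> ?L" using Mf[OF _ b] F by (auto simp: m_assoc subset_iff)
      ultimately have "Idl F \<subseteq> ?L" by (rule genideal_minimal)
      then show ?thesis using a by blast
    qed
    then have ba: "b \<otimes> a \<otimes> x \<in> K" if "b \<in> (Idl F) [^]\<^bsub>ideals_set R\<^esub> M" "a \<in> Idl F" for a b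
      using that by blast
    have "c \<otimes> x \<in> K" if "c \<in> ideal_prod R ((Idl F) [^]\<^bsub>ideals_set R\<^esub> M) (Idl F)" for c
      using that
    proof (induction rule: ideal_prod.induct)
      case (sum s1 s2)
      have "s1 \<in> carrier R" "s2 \<in> carrier R"
        using ideal_prod_in_carrier[OF ideal_pow_ideal[OF I, of M] I] sum.hyps by blast+
      then show ?case using sum by (simp add: l_distr)
    qed (rule ba)
    then show ?thesis by (metis ideal_pow_Suc)
  qed
qed

lemma genideal_pow_subset:
  assumes "finite F" "F \<subseteq> carrier R" "ideal K R" "\<And>f. f \<in> F \<Longrightarrow> \<exists>n::nat. f [^] n \<in> K"
  shows "\<exists>N::nat. (Idl F) [^]\<^bsub>ideals_set R\<^esub> N \<subseteq> K"
proof -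
  obtain ex :: "'a \<Rightarrow> nat" where ex: "\<And>f. f \<in> F \<Longrightarrow> f [^] ex f \<in> K" using assms(4) by metis
  then obtain N :: nat where N: "\<forall>b\<in>(Idl F) [^]\<^bsub>ideals_set R\<^esub> N. b \<otimes> \<one> \<in> K"
    using genideal_pow_smult_subset[OF assms(1-3) one_closed, of ex] assms(2) by force
  have "b \<in> K" if "b \<in> (Idl F) [^]\<^bsub>ideals_set R\<^esub> N" for b
    using N that ideal.Icarr[OF ideal_pow_ideal[OF genideal_ideal[OF assms(2)]] that] by force
  then show ?thesis by blast
qed

lemma genideal_subset_radical:
  assumes "finite F" "F \<subseteq> carrier R" "ideal K R" "\<And>f. f \<in> F \<Longrightarrow> \<exists>n::nat. f [^] n \<in> K"
  shows "radical R (Idl F) \<subseteq> radical R K"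
proof
  fix x assume x: "x \<in> radical R (Idl F)"
  then obtain n :: nat where n: "x [^] n \<in> Idl F" and xc: "x \<in> carrier R" unfolding radical_def
    by blast
  obtain N :: nat where "(Idl F) [^]\<^bsub>ideals_set R\<^esub> N \<subseteq> K" using genideal_pow_subset[OF assms]
    by blast
  then have "(x [^] n) [^] N \<in> K" using pow_in_ideal_pow[OF genideal_ideal[OF assms(2)] n] by blast
  then show "x \<in> radical R K" using xc by (auto simp: radical_def nat_pow_pow)
qed

end

text \<open>Torsion depends on the radical only, since an ideal lies in the radical of the
  annihilator as soon as its generators do. Thus \<open>F\<close> may be a generating set of
  \<open>I\<close> or a single element with the same radical.\<close>

lemma (in module) torsion_part_eq_tors:
  assumes F': "finite F'" "F' \<subseteq> carrier R" "I = Idl F'" and F: "finite F" "F \<subseteq> carrier R"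
    and rad: "radical R I = radical R (Idl F)"
  shows "torsion_part R I M = tors R F M"
proof
  have I: "ideal I R" using F' genideal_ideal by simp
  show "torsion_part R I M \<subseteq> tors R F M"
  proof
    fix x assume "x \<in> torsion_part R I M"
    then obtain n :: nat where x: "x \<in> carrier M"
      and n: "\<And>a. a \<in> I [^]\<^bsub>ideals_set R\<^esub> n \<Longrightarrow> a \<odot>\<^bsub>M\<^esub> x = \<zero>\<^bsub>M\<^esub>"
      unfolding torsion_part_def by auto
    have "\<exists>n::nat. f [^] n \<odot>\<^bsub>M\<^esub> x = \<zero>\<^bsub>M\<^esub>" if f: "f \<in> F" for f
    proof -
      have fc: "f \<in> carrier R" using f F by blast
      have "f [^] (1::nat) \<in> Idl F" using genideal_self[OF F(2)] f fc by auto
      then have "f \<in> radical R (Idl F)" unfolding radical_def using fc by blast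
      then have "f \<in> radical R I" unfolding rad .
      then obtain m :: nat where "f [^] m \<in> I" unfolding radical_def by blast
      then have "(f [^] m) [^] n \<in> I [^]\<^bsub>ideals_set R\<^esub> n" by (rule pow_in_ideal_pow[OF I])
      then show ?thesis using n fc by (auto simp: R.nat_pow_pow)
    qed
    then show "x \<in> tors R F M" using x unfolding tors_def by blast
  qed
  show "tors R F M \<subseteq> torsion_part R I M"
  proof
    fix x assume x: "x \<in> tors R F M"
    then have xc: "x \<in> carrier M" unfolding tors_def by blast
    let ?K = "annihilator R M x"
    have K: "ideal ?K R" by (rule ideal_annihilator[OF xc])
    have FK: "\<exists>n::nat. f [^] n \<in> ?K" if f: "f \<in> F" for f
    proof -
      obtain n :: nat where "f [^] n \<odot>\<^bsub>M\<^esub> x = \<zero>\<^bsub>M\<^esub>" using x f unfolding tors_def by auto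
      then have "f [^] n \<in> ?K" using f F unfolding annihilator_def by auto
      then show ?thesis by blast
    qed
    have "radical R I \<subseteq> radical R ?K" unfolding rad by (rule genideal_subset_radical[OF F K FK])
    moreover have "f \<in> radical R I" if f: "f \<in> F'" for f
    proof -
      have fc: "f \<in> carrier R" using f F' by blast
      have "f [^] (1::nat) \<in> I" using genideal_self[OF F'(2)] f fc F'(3) by auto
      then show ?thesis unfolding radical_def using fc by blast
    qed
    ultimately have "\<exists>n::nat. f [^] n \<in> ?K" if "f \<in> F'" for f using that unfolding radical_def
      by blast
    then obtain N :: nat where "I [^]\<^bsub>ideals_set R\<^esub> N \<subseteq> ?K"
      using genideal_pow_subset[OF F'(1,2) K] F'(3) by blast
    then show "x \<in> torsion_part R I M" using xc unfolding torsion_part_def annihilator_def by blast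
  qed
qed

text \<open>In the family of ideals generated by finite subsets of \<open>S\<close>, a maximal
  member contains \<open>S\<close>. Choosing the generators inside \<open>S\<close> keeps them
  homogeneous.\<close>

lemma (in noeth_graded_cring) finite_generators:
  assumes "S \<subseteq> carrier R"
  shows "\<exists>F. finite F \<and> F \<subseteq> S \<and> Idl F = Idl S"
proof -
  let ?A = "{Idl F |F. finite F \<and> F \<subseteq> S}"
  have "\<exists>J\<in>?A. \<forall>K\<in>?A. J \<subseteq> K \<longrightarrow> K = J"
  proof (rule noeth)
    show "ideal J R" if "J \<in> ?A" for J using that assms genideal_ideal by auto
  qed blast
  then obtain J where J: "J \<in> ?A" "\<And>K. K \<in> ?A \<Longrightarrow> J \<subseteq> K \<Longrightarrow> K = J" by meson
  then obtain F where JF: "J = Idl F" and F: "finite F" "F \<subseteq> S" by auto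
  have mx: "Idl F' = Idl F" if "finite F'" "F' \<subseteq> S" "Idl F \<subseteq> Idl F'" for F'
    using J(2)[of "Idl F'"] that unfolding JF by auto
  have Fc: "F \<subseteq> carrier R" using F assms by blast
  have "s \<in> Idl F" if s: "s \<in> S" for s
  proof -
    have c: "insert s F \<subseteq> carrier R" using s Fc assms by blast
    have "Idl F \<subseteq> Idl (insert s F)"
      using genideal_minimal[OF genideal_ideal[OF c], of F] genideal_self[OF c] by blast
    then have "Idl (insert s F) = Idl F" using mx F s by simp
    then show ?thesis using genideal_self[OF c] by blast
  qed
  then have "Idl S \<subseteq> Idl F" by (intro genideal_minimal[OF genideal_ideal[OF Fc]]) blast
  moreover have "Idl F \<subseteq> Idl S"
    using genideal_minimal[OF genideal_ideal[OF assms], of F] genideal_self[OF assms] F by blast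
  ultimately show ?thesis using F by blast
qed

text \<open>The graded analogue of a local ring: degree 0 is a field and all other degrees lie in
  \<open>mm\<close>. With noetherianity, this is what the criterion uses of the quotient of the
  polynomial ring.\<close>

locale local_graded_cring = noeth_graded_cring +
  fixes mm :: "'a set"
  assumes mm_ideal: "ideal mm R" and one_notin_mm: "\<one> \<notin> mm"
    and degree_nonzero_mm: "d \<noteq> 0 \<Longrightarrow> G d \<subseteq> mm"
    and degree_zero_units: "x \<in> G 0 \<Longrightarrow> x = \<zero> \<or> x \<in> Units R"
begin

text \<open>The core of the graded Nakayama argument. Components of nonzero degree lie in
  \<open>mm\<close>, hence so does the component of degree 0; being 0 or a unit, it is 0.\<close>

lemma rc_mm_zero:
  assumes x: "x \<in> mm" shows "rc x 0 = \<zero>"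
proof -
  interpret mm: ideal mm R by (rule mm_ideal)
  have xc: "x \<in> carrier R" using x mm.Icarr by blast
  let ?A = "{d. rc x d \<noteq> \<zero>} - {0}"
  let ?s = "\<Oplus>\<^bsub>regular_module R\<^esub>d\<in>?A. rc x d"
  have fin: "finite ?A" using reg.cp_finite[of x] xc by simp
  have s: "?s \<in> mm"
    by (rule reg.finsum_in) (use fin reg.cp_in[of x] xc degree_nonzero_mm mm.Icarr in \<open>auto simp: subset_iff\<close>)
  have "x = (\<Oplus>\<^bsub>regular_module R\<^esub>d\<in>insert 0 ?A. rc x d)"
    by (rule reg.cp_sum') (use xc fin in auto)
  also have "\<dots> = rc x 0 \<oplus> ?s"
    using reg.M.finsum_insert[of ?A 0 "rc x"] fin xc rc_carrier by auto
  finally have eq: "rc x 0 \<oplus> ?s = x" by (rule sym)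
  have "rc x 0 = x \<oplus> \<ominus> ?s"
    by (rule R.move_right[OF rc_carrier[OF xc] mm.Icarr[OF s] xc eq])
  moreover have "x \<oplus> \<ominus> ?s \<in> mm" by (rule mm.a_closed[OF x mm.a_inv_closed[OF s]])
  ultimately have "rc x 0 \<in> mm" by (simp only:)
  moreover have "rc x 0 \<in> G 0" using rc_in xc by blast
  ultimately show ?thesis
    using degree_zero_units mm.I_r_closed one_notin_mm
    by (metis R.Units_inv_closed R.Units_r_inv)
qed

end

section \<open>First local cohomology and its graded Matlis dual\<close>

text \<open>\<open>e0\<close> is the image of 1 under the embedding of \<open>R / mm\<close> into
  \<open>E\<close>; maps that take the value \<open>e0\<close> yield nonzero elements of the dual.
  The augmentation of the resolution is \<open>\<epsilon>\<close>.\<close>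

locale local_cohomology_setup = local_graded_cring R G mm
  for R :: "'r ring" (structure) and G :: "'g::ab_group_add \<Rightarrow> 'r set" and mm +
  fixes E :: "('r, 'e) module" and GE :: "'g \<Rightarrow> 'e set" and e0 :: 'e
    and C :: "nat \<Rightarrow> ('r, 'c) module" and GC :: "nat \<Rightarrow> 'g \<Rightarrow> 'c set" and \<delta> :: "nat \<Rightarrow> 'c \<Rightarrow> 'c"
    and \<epsilon> :: "'r \<Rightarrow> 'c" and I :: "'r set"
  assumes E_inj: "star_injective R G E GE"
    and e0: "e0 \<in> GE 0" "e0 \<noteq> \<zero>\<^bsub>E\<^esub>" "\<And>r. r \<in> mm \<Longrightarrow> r \<odot>\<^bsub>E\<^esub> e0 = \<zero>\<^bsub>E\<^esub>"
    and C_inj: "\<And>i. star_injective R G (C i) (GC i)"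
    and \<delta>_hom: "\<And>i. \<delta> i \<in> hom_of_degree R (C i) (GC i) (C (Suc i)) (GC (Suc i)) 0"
    and \<epsilon>_hom: "\<epsilon> \<in> hom_of_degree R (regular_module R) G (C 0) (GC 0) 0"
    and \<epsilon>_inj: "inj_on \<epsilon> (carrier R)"
    and \<epsilon>_exact: "\<epsilon> ` carrier R = {x \<in> carrier (C 0). \<delta> 0 x = \<zero>\<^bsub>C (Suc 0)\<^esub>}"
    and \<delta>_exact: "\<And>i. \<delta> i ` carrier (C i) = {x \<in> carrier (C (Suc i)). \<delta> (Suc i) x = \<zero>\<^bsub>C (Suc (Suc i))\<^esub>}"
    and I_homogeneous: "homogeneous_ideal R G I"
begin

lemma E_graded: "graded_module R G E GE" and C_graded: "graded_module R G (C i) (GC i)"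
  using E_inj C_inj unfolding star_injective_def by blast+

sublocale E: graded_mod R E G GE by (rule graded_modI[OF E_graded])
sublocale C: graded_mod R "C i" G "GC i" for i by (rule graded_modI[OF C_graded])

lemmas \<delta>D [simp] = mod_homD(2-4)[OF hom_of_degreeD(1)[OF \<delta>_hom]]
lemmas \<epsilon>D [simp] = mod_homD(2-4)[OF hom_of_degreeD(1)[OF \<epsilon>_hom], simplified]

lemma \<delta>_zero [simp]: "\<delta> i \<zero>\<^bsub>C i\<^esub> = \<zero>\<^bsub>C (Suc i)\<^esub>"
  by (rule mod_hom_zero[OF hom_of_degreeD(1)[OF \<delta>_hom] C.module_axioms C.module_axioms])

lemma \<delta>_minus [simp]: "x \<in> carrier (C i) \<Longrightarrow> \<delta> i (\<ominus>\<^bsub>C i\<^esub> x) = \<ominus>\<^bsub>C (Suc i)\<^esub> \<delta> i x"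
  by (rule mod_hom_minus[OF hom_of_degreeD(1)[OF \<delta>_hom] C.module_axioms C.module_axioms])

lemma \<epsilon>_zero [simp]: "\<epsilon> \<zero> = \<zero>\<^bsub>C 0\<^esub>"
  using mod_hom_zero[OF hom_of_degreeD(1)[OF \<epsilon>_hom] reg.module_axioms C.module_axioms] by simp

lemma \<epsilon>_minus [simp]: "r \<in> carrier R \<Longrightarrow> \<epsilon> (\<ominus> r) = \<ominus>\<^bsub>C 0\<^esub> \<epsilon> r"
  using mod_hom_minus[OF hom_of_degreeD(1)[OF \<epsilon>_hom] reg.module_axioms C.module_axioms] by simp

lemma \<delta>_component: "x \<in> carrier (C i) \<Longrightarrow> component (C (Suc i)) (GC (Suc i)) (\<delta> i x) d = \<delta> i (component (C i) (GC i) x d)"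
  using hom_component[OF C_graded C_graded \<delta>_hom, of x i d] by simp

lemma \<epsilon>_component: "r \<in> carrier R \<Longrightarrow> component (C 0) (GC 0) (\<epsilon> r) d = \<epsilon> (rc r d)"
  using hom_component[OF graded_regular C_graded \<epsilon>_hom, of r d] by simp

lemma \<delta>_\<epsilon> [simp]: "r \<in> carrier R \<Longrightarrow> \<delta> 0 (\<epsilon> r) = \<zero>\<^bsub>C (Suc 0)\<^esub>"
  using \<epsilon>_exact by auto

lemma \<delta>_\<delta> [simp]: "x \<in> carrier (C i) \<Longrightarrow> \<delta> (Suc i) (\<delta> i x) = \<zero>\<^bsub>C (Suc (Suc i))\<^esub>"
  using \<delta>_exact[of i] by auto

lemma \<epsilon>E:
  assumes "x \<in> carrier (C 0)" "\<delta> 0 x = \<zero>\<^bsub>C (Suc 0)\<^esub>"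
  obtains r where "r \<in> carrier R" "x = \<epsilon> r"
  using \<epsilon>_exact assms by blast

abbreviation "\<Gamma> i \<equiv> torsion_part R I (C i)"

lemma I_ideal: "ideal I R" using I_homogeneous unfolding homogeneous_ideal_def by blast

lemma I_generators: "\<exists>fs. set fs \<subseteq> homogeneous_elements G \<and> I = Idl (set fs)"
proof -
  obtain S where S: "S \<subseteq> homogeneous_elements G" "I = Idl S"
    using I_homogeneous unfolding homogeneous_ideal_def by blast
  then obtain F where "finite F" "F \<subseteq> S" "Idl F = Idl S"
    using finite_generators[of S] homogeneous_carrier by blast
  moreover from this obtain fs where "set fs = F" using finite_list by blast
  ultimately show ?thesis using S by auto
qed

lemma \<Gamma>_eq_tors:
  assumes "finite F" "F \<subseteq> carrier R" "radical R I = radical R (Idl F)"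
  shows "\<Gamma> i = tors R F (C i)"
proof -
  obtain fs where "set fs \<subseteq> homogeneous_elements G" "I = Idl (set fs)" using I_generators by blast
  then show ?thesis using C.torsion_part_eq_tors[of "set fs" I F i] assms homogeneous_carrier
    by auto
qed

lemma \<Gamma>_generators: "\<exists>F. finite F \<and> F \<subseteq> homogeneous_elements G \<and> (\<forall>i. \<Gamma> i = tors R F (C i))"
proof -
  obtain fs where fs: "set fs \<subseteq> homogeneous_elements G" "I = Idl (set fs)" using I_generators
    by blast
  then have "\<forall>i. \<Gamma> i = tors R (set fs) (C i)" using \<Gamma>_eq_tors[of "set fs"] homogeneous_carrier
    by auto
  then show ?thesis using fs by blast
qed

lemma \<Gamma>_submodule: "submodule (\<Gamma> i) R (C i)"
  using \<Gamma>_generators C.submodule_tors homogeneous_carrier by (metis order_trans)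

lemmas \<Gamma>S = C.submoduleE[OF \<Gamma>_submodule]

lemma \<Gamma>_zero [simp]: "\<zero>\<^bsub>C i\<^esub> \<in> \<Gamma> i"
  using subgroup.one_closed[OF submodule.axioms(1)[OF \<Gamma>_submodule]] by simp

lemma \<Gamma>_component: "x \<in> \<Gamma> i \<Longrightarrow> component (C i) (GC i) x d \<in> \<Gamma> i"
  using \<Gamma>_generators tors_component[OF C_graded, of _ x i] by metis

lemma \<delta>_\<Gamma>: "x \<in> \<Gamma> i \<Longrightarrow> \<delta> i x \<in> \<Gamma> (Suc i)"
proof -
  assume x: "x \<in> \<Gamma> i"
  then have "x \<in> carrier (C i)" using \<Gamma>S(1) by blast
  obtain n :: nat where n: "\<And>a. a \<in> I [^]\<^bsub>ideals_set R\<^esub> n \<Longrightarrow> a \<odot>\<^bsub>C i\<^esub> x = \<zero>\<^bsub>C i\<^esub>"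
    using x unfolding torsion_part_def by auto
  have "a \<odot>\<^bsub>C (Suc i)\<^esub> \<delta> i x = \<zero>\<^bsub>C (Suc i)\<^esub>" if a: "a \<in> I [^]\<^bsub>ideals_set R\<^esub> n" for a
  proof -
    have "a \<in> carrier R" using ideal.Icarr[OF ideal_pow_ideal[OF I_ideal] a] .
    from \<delta>D(3)[OF this \<open>x \<in> carrier (C i)\<close>] show ?thesis using n[OF a] by simp
  qed
  then show "\<delta> i x \<in> \<Gamma> (Suc i)" using \<open>x \<in> carrier (C i)\<close> unfolding torsion_part_def by auto
qed

text \<open>The preimage in \<open>C 0\<close> of the zeroth cohomology of \<open>C\<close> modulo
  torsion: \<open>Y / \<Gamma> 0\<close> is the ideal transform of \<open>R\<close> with respect to
  \<open>I\<close>, and its quotient by the image of \<open>R\<close> is the first local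
  cohomology.\<close>

definition Y where "Y = {y \<in> carrier (C 0). \<delta> 0 y \<in> \<Gamma> (Suc 0)}"

lemma Y_carrier: "y \<in> Y \<Longrightarrow> y \<in> carrier (C 0)" unfolding Y_def by blast

lemma Y_submodule: "submodule Y R (C 0)"
  by (rule C.submoduleI) (use \<Gamma>S[where i = "Suc 0"] in \<open>auto simp: Y_def\<close>)

lemmas YS = C.submoduleE[OF Y_submodule]

lemma Y_component: "y \<in> Y \<Longrightarrow> component (C 0) (GC 0) y d \<in> Y"
  using \<Gamma>_component[of "\<delta> 0 y" "Suc 0" d] by (auto simp: Y_def \<delta>_component)

lemma \<epsilon>_in_Y: "r \<in> carrier R \<Longrightarrow> \<epsilon> r \<in> Y" by (simp add: Y_def)

lemma \<Gamma>_in_Y: "t \<in> \<Gamma> 0 \<Longrightarrow> t \<in> Y" using \<Gamma>S(1)[where i = 0] \<delta>_\<Gamma>[of t 0] unfolding Y_def by auto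

text \<open>Since \<open>\<delta> 0\<close> induces an isomorphism from \<open>Y\<close> modulo \<open>\<Gamma> 0 + \<epsilon> R\<close> onto the first local cohomology
  module \<open>H\<close>, the predicate \<open>full J\<close> says that \<open>J H = H\<close>.\<close>

definition N where
  "N J = generate (add_monoid (C 0)) (\<Gamma> 0 \<union> \<epsilon> ` carrier R \<union> {a \<odot>\<^bsub>C 0\<^esub> y |a y. a \<in> J \<and> y \<in> Y})"

definition full where "full J \<longleftrightarrow> Y \<subseteq> N J"

lemma N_induct [consumes 2, case_names torsion ring smult zero add]:
  assumes "x \<in> N J" "J \<subseteq> carrier R" "\<And>t. t \<in> \<Gamma> 0 \<Longrightarrow> P t" "\<And>r. r \<in> carrier R \<Longrightarrow> P (\<epsilon> r)"
    "\<And>a y. a \<in> J \<Longrightarrow> y \<in> Y \<Longrightarrow> P (a \<odot>\<^bsub>C 0\<^esub> y)" "P \<zero>\<^bsub>C 0\<^esub>"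
    "\<And>x y. x \<in> Y \<Longrightarrow> y \<in> Y \<Longrightarrow> P x \<Longrightarrow> P y \<Longrightarrow> P (x \<oplus>\<^bsub>C 0\<^esub> y)"
  shows "P x" "x \<in> Y"
proof -
  have "P x \<and> x \<in> Y" using assms(1) unfolding N_def
  proof (induction x rule: generate.induct)
    case one
    then show ?case using assms(6) YS(2) by (auto simp: Y_def)
  next
    case (incl h)
    then show ?case using assms(2-5) \<epsilon>_in_Y \<Gamma>_in_Y YS(4) by blast
  next
    case (inv h)
    have "\<ominus>\<^bsub>C 0\<^esub> h \<in> Y \<and> P (\<ominus>\<^bsub>C 0\<^esub> h)" if "h \<in> \<Gamma> 0"
      using that assms(3) \<Gamma>S(3) \<Gamma>_in_Y by blast
    moreover have "\<ominus>\<^bsub>C 0\<^esub> \<epsilon> r \<in> Y \<and> P (\<ominus>\<^bsub>C 0\<^esub> \<epsilon> r)" if "r \<in> carrier R" for r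
      using assms(4)[of "\<ominus> r"] \<epsilon>_in_Y[of "\<ominus> r"] that by simp
    moreover have "\<ominus>\<^bsub>C 0\<^esub> (a \<odot>\<^bsub>C 0\<^esub> y) \<in> Y \<and> P (\<ominus>\<^bsub>C 0\<^esub> (a \<odot>\<^bsub>C 0\<^esub> y))" if "a \<in> J" "y \<in> Y" for a y
      using assms(2) assms(5)[OF that(1) YS(3)[OF that(2)]] YS(3)[OF YS(4)[of a y]] that Y_carrier
      by (auto simp: C.smult_r_minus subset_iff)
    ultimately have "\<ominus>\<^bsub>C 0\<^esub> h \<in> Y \<and> P (\<ominus>\<^bsub>C 0\<^esub> h)" using inv by blast
    then show ?case unfolding a_inv_def by blast
  next
    case (eng h1 h2)
    then show ?case using assms(7)[of h1 h2] YS(5)[of h1 h2] by simp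
  qed
  then show "P x" "x \<in> Y" by auto
qed

lemma N_base_carrier:
  "J \<subseteq> carrier R \<Longrightarrow> \<Gamma> 0 \<union> \<epsilon> ` carrier R \<union> {a \<odot>\<^bsub>C 0\<^esub> y |a y. a \<in> J \<and> y \<in> Y} \<subseteq> carrier (add_monoid (C 0))"
  using \<Gamma>S(1)[where i = 0] Y_carrier by (auto simp: subset_iff)

lemma N_intros:
  "t \<in> \<Gamma> 0 \<Longrightarrow> t \<in> N J" "r \<in> carrier R \<Longrightarrow> \<epsilon> r \<in> N J" "a \<in> J \<Longrightarrow> y \<in> Y \<Longrightarrow> a \<odot>\<^bsub>C 0\<^esub> y \<in> N J"
  "\<zero>\<^bsub>C 0\<^esub> \<in> N J" "x \<in> N J \<Longrightarrow> y \<in> N J \<Longrightarrow> x \<oplus>\<^bsub>C 0\<^esub> y \<in> N J"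
  unfolding N_def using generate.one[of "add_monoid (C 0)"] generate.eng[of _ "add_monoid (C 0)"]
  by (auto intro: generate.incl)

text \<open>The generated group is stable under \<open>R\<close> because each kind of generator is.
  It is graded because \<open>J\<close> is homogeneous and \<open>Y\<close>,
  \<open>\<Gamma> 0\<close> and the image of \<open>R\<close> are graded.\<close>

lemma N_submodule:
  assumes J: "homogeneous_ideal R G J"
  shows "submodule (N J) R (C 0)" and "x \<in> N J \<Longrightarrow> component (C 0) (GC 0) x d \<in> N J"
proof -
  have id: "ideal J R" using J unfolding homogeneous_ideal_def by blast
  interpret J: ideal J R by (rule id)
  have Jc: "J \<subseteq> carrier R" using J.Icarr by blast
  have NY: "N J \<subseteq> Y" using N_induct(2)[of _ J "\<lambda>_. True"] Jc by auto
  have sm: "r \<odot>\<^bsub>C 0\<^esub> x \<in> N J" if "r \<in> carrier R" "x \<in> N J" for r x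
    using that(2) Jc
  proof (induction x rule: N_induct(1))
    case (torsion t) then show ?case using \<Gamma>S(4)[OF that(1)] N_intros(1) by blast
  next case (ring s)
    have "r \<odot>\<^bsub>C 0\<^esub> \<epsilon> s = \<epsilon> (r \<otimes> s)" using ring that by simp
    then show ?case using N_intros(2)[of "r \<otimes> s"] ring that by simp
  next case (smult a y)
    have "r \<odot>\<^bsub>C 0\<^esub> (a \<odot>\<^bsub>C 0\<^esub> y) = (r \<otimes> a) \<odot>\<^bsub>C 0\<^esub> y"
      using smult that J.Icarr Y_carrier by (simp add: C.smult_assoc1)
    then show ?case using N_intros(3)[of "r \<otimes> a" J y] smult J.I_l_closed that by simp
  next case zero then show ?case using that N_intros(4) by simp
  next case (add x y) then show ?case using that Y_carrier N_intros(5)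
    by (simp add: C.smult_r_distr)
  qed
  show "submodule (N J) R (C 0)"
    unfolding submodule_def submodule_axioms_def
    using group.generate_is_subgroup[OF C.M.a_group N_base_carrier[OF Jc]] sm unfolding N_def
      by blast
  have "\<forall>d. component (C 0) (GC 0) x d \<in> N J" if x: "x \<in> N J"
    using x Jc
  proof (induction x rule: N_induct(1))
    case (torsion t) then show ?case using \<Gamma>_component N_intros(1) by blast
  next case (ring r) then show ?case using N_intros(2) rc_carrier by (simp add: \<epsilon>_component)
  next case (smult a y)
    \<comment> \<open>Neither \<open>a\<close> nor \<open>y\<close> need be homogeneous; the claim
      is additive in \<open>a\<close>, which may therefore be replaced by its components, and these
      stay in \<open>J\<close>.\<close>
    let ?K = "{a \<in> carrier R. \<forall>d. component (C 0) (GC 0) (a \<odot>\<^bsub>C 0\<^esub> y) d \<in> N J}"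
    note y = Y_carrier[OF smult(2)]
    have "a \<in> ?K"
    proof (rule reg.in_if_cp_in)
      show "a \<in> carrier (regular_module R)" using smult(1) J.Icarr by simp
      show "rc a e \<in> ?K" for e
      proof -
        have a: "rc a e \<in> J" "rc a e \<in> G e" "rc a e \<in> carrier R"
          using homogeneous_ideal_component[OF J smult(1)] rc_in J.Icarr smult(1) by blast+
        show ?thesis
          using C.cp_smult[OF y a(2,3)] N_intros(3)[OF a(1) Y_component[OF smult(2)]] a(3) by simp
      qed
      show "a \<oplus>\<^bsub>regular_module R\<^esub> b \<in> ?K" if "a \<in> ?K" "b \<in> ?K" for a b
        using that y N_intros(5) by (simp add: C.smult_l_distr C.cp_add)
    qed (use y N_intros(4) in auto)
    then show ?case by blast
  next case zero then show ?case using N_intros(4) by simp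
  next case (add x y) then show ?case using Y_carrier N_intros(5) by (simp add: C.cp_add)
  qed
  then show "x \<in> N J \<Longrightarrow> component (C 0) (GC 0) x d \<in> N J" by blast
qed

end

section \<open>The first local cohomology module as a quotient of \<open>Y\<close>\<close>

context local_cohomology_setup
begin

abbreviation "cocycles \<equiv> lc_cocycles R I C \<delta> (Suc 0)"
abbreviation "coboundaries \<equiv> lc_coboundaries R I C \<delta> (Suc 0)"
abbreviation "cocycle_module \<equiv> (C (Suc 0))\<lparr>carrier := cocycles\<rparr>"
abbreviation "H \<equiv> local_cohomology R I C \<delta> (Suc 0)"
abbreviation "GH \<equiv> local_cohomology_grading R I C GC \<delta> (Suc 0)"

text \<open>The map from \<open>Y\<close> onto \<open>H\<close> induced by
  \<open>\<delta> 0\<close>. Statements about \<open>H\<close> are pulled back along it to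
  \<open>C 0\<close>.\<close>

definition q where "q y = coboundaries +>\<^bsub>cocycle_module\<^esub> \<delta> 0 y"

lemma H_def: "H = quot_module cocycle_module coboundaries"
  by (simp add: local_cohomology_def)

lemma coboundaries_eq: "coboundaries = \<delta> 0 ` \<Gamma> 0"
  by (simp add: lc_coboundaries_def)

lemma cocycles_submodule: "submodule cocycles R (C (Suc 0))"
proof (rule C.submoduleI)
  note S = \<Gamma>S[where i = "Suc 0"]
  show "cocycles \<subseteq> carrier (C (Suc 0))" using S(1) by (auto simp: lc_cocycles_def)
  show "\<zero>\<^bsub>C (Suc 0)\<^esub> \<in> cocycles" by (simp add: lc_cocycles_def)
  have c: "a \<in> carrier (C (Suc 0))" if "a \<in> cocycles" for a using that S(1)
    by (auto simp: lc_cocycles_def)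
  show "\<ominus>\<^bsub>C (Suc 0)\<^esub> a \<in> cocycles" if "a \<in> cocycles" for a
    using that c[OF that] S(3) by (simp add: lc_cocycles_def C.M.a_inv_zero)
  show "a \<oplus>\<^bsub>C (Suc 0)\<^esub> b \<in> cocycles" if "a \<in> cocycles" "b \<in> cocycles" for a b
    using that c[OF that(1)] c[OF that(2)] S(5) by (simp add: lc_cocycles_def)
  show "r \<odot>\<^bsub>C (Suc 0)\<^esub> a \<in> cocycles" if "r \<in> carrier R" "a \<in> cocycles" for r a
    using that c[OF that(2)] S(4) by (simp add: lc_cocycles_def)
qed

lemma cocycle_module: "module R cocycle_module"
  by (rule submodule.submodule_is_module[OF cocycles_submodule C.module_axioms])

sublocale Z: module R cocycle_module by (rule cocycle_module)

lemma \<delta>_Y: "y \<in> Y \<Longrightarrow> \<delta> 0 y \<in> cocycles"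
  by (auto simp: Y_def lc_cocycles_def)

lemma cocycle_minus: "x \<in> cocycles \<Longrightarrow> \<ominus>\<^bsub>cocycle_module\<^esub> x = \<ominus>\<^bsub>C (Suc 0)\<^esub> x"
  using Z.minus_one_smult[of x] C.minus_one_smult[of x "Suc 0"] C.submoduleE(1)[OF cocycles_submodule] by auto

lemma coboundaries_submodule: "submodule coboundaries R cocycle_module"
proof (rule Z.submoduleI)
  note S = \<Gamma>S[where i = 0]
  show sub: "coboundaries \<subseteq> carrier cocycle_module"
    unfolding coboundaries_eq using \<delta>_Y[OF \<Gamma>_in_Y] by auto
  show "\<zero>\<^bsub>cocycle_module\<^esub> \<in> coboundaries"
    unfolding coboundaries_eq using imageI[OF \<Gamma>_zero[of 0], of "\<delta> 0"] by simp
  fix a assume a: "a \<in> coboundaries"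
  then obtain t where t: "t \<in> \<Gamma> 0" "a = \<delta> 0 t" unfolding coboundaries_eq by blast
  have tc: "t \<in> carrier (C 0)" using t S(1) by blast
  have "\<delta> 0 (\<ominus>\<^bsub>C 0\<^esub> t) \<in> coboundaries" unfolding coboundaries_eq using S(3) t by blast
  then show "\<ominus>\<^bsub>cocycle_module\<^esub> a \<in> coboundaries" using cocycle_minus[of a] sub a t tc by auto
  show "r \<odot>\<^bsub>cocycle_module\<^esub> a \<in> coboundaries" if "r \<in> carrier R" for r
    using imageI[OF S(4)[OF that t(1)], of "\<delta> 0"] \<delta>D(3)[OF that tc] t unfolding coboundaries_eq
      by simp
  fix b assume "b \<in> coboundaries"
  then obtain s where s: "s \<in> \<Gamma> 0" "b = \<delta> 0 s" unfolding coboundaries_eq by blast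
  have sc: "s \<in> carrier (C 0)" using s S(1) by blast
  show "a \<oplus>\<^bsub>cocycle_module\<^esub> b \<in> coboundaries"
    using imageI[OF S(5)[OF t(1) s(1)], of "\<delta> 0"] \<delta>D(2)[OF tc sc] t s unfolding coboundaries_eq
      by simp
qed

sublocale H: module R H
  unfolding H_def by (rule Z.module_quot_module[OF coboundaries_submodule])

lemma q_add: "x \<in> Y \<Longrightarrow> y \<in> Y \<Longrightarrow> q (x \<oplus>\<^bsub>C 0\<^esub> y) = q x \<oplus>\<^bsub>H\<^esub> q y"
  using Z.quot_module_add[OF coboundaries_submodule, of "\<delta> 0 x" "\<delta> 0 y"] \<delta>_Y Y_carrier
  by (simp add: H_def q_def)

lemma q_smult: "r \<in> carrier R \<Longrightarrow> y \<in> Y \<Longrightarrow> q (r \<odot>\<^bsub>C 0\<^esub> y) = r \<odot>\<^bsub>H\<^esub> q y"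
  using Z.quot_module_smult[OF coboundaries_submodule, of r "\<delta> 0 y"] \<delta>_Y Y_carrier
  by (simp add: H_def q_def)

text \<open>Exactness of the resolution at \<open>C 1\<close>, combined with the definition of
  \<open>Y\<close>.\<close>

lemma cocycleE:
  assumes "z \<in> cocycles" obtains y where "y \<in> Y" "z = \<delta> 0 y"
proof -
  have z: "z \<in> \<Gamma> (Suc 0)" "\<delta> (Suc 0) z = \<zero>\<^bsub>C (Suc (Suc 0))\<^esub>" using assms
    by (auto simp: lc_cocycles_def)
  then have "z \<in> \<delta> 0 ` carrier (C 0)" unfolding \<delta>_exact using \<Gamma>S(1) by blast
  then show ?thesis using that z unfolding Y_def by blast
qed

lemma H_carrier: "carrier H = q ` Y"
proof -
  have "cocycles = \<delta> 0 ` Y" using cocycleE \<delta>_Y by blast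
  then show ?thesis unfolding H_def by (simp add: q_def image_image)
qed

lemma q_zero_iff: "y \<in> Y \<Longrightarrow> q y = \<zero>\<^bsub>H\<^esub> \<longleftrightarrow> (\<exists>t\<in>\<Gamma> 0. \<delta> 0 y = \<delta> 0 t)"
  using Z.coset_eq_zero_iff[OF coboundaries_submodule, of "\<delta> 0 y"] \<delta>_Y
  by (auto simp: H_def q_def coboundaries_eq)

lemma q_torsion: "t \<in> \<Gamma> 0 \<Longrightarrow> q t = \<zero>\<^bsub>H\<^esub>"
  using q_zero_iff[OF \<Gamma>_in_Y] by blast

lemma q_\<epsilon>: "r \<in> carrier R \<Longrightarrow> q (\<epsilon> r) = \<zero>\<^bsub>H\<^esub>"
  using q_zero_iff[OF \<epsilon>_in_Y] \<Gamma>_zero[of 0] \<delta>_zero[of 0] by (metis \<delta>_\<epsilon>)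

text \<open>The kernel of \<open>q\<close> is \<open>\<Gamma> 0 + \<epsilon> R\<close>: if
  \<open>\<delta> 0 y = \<delta> 0 t\<close> with \<open>t\<close> torsion, then
  \<open>y - t\<close> is a cocycle and comes from \<open>R\<close>.\<close>

lemma in_N_if_q_zero:
  assumes "y \<in> Y" "q y = \<zero>\<^bsub>H\<^esub>" shows "y \<in> N J"
proof -
  obtain t where t: "t \<in> \<Gamma> 0" "\<delta> 0 y = \<delta> 0 t" using q_zero_iff assms by blast
  have c: "y \<in> carrier (C 0)" "t \<in> carrier (C 0)" using Y_carrier assms(1) t \<Gamma>S(1) by blast+
  then have "\<delta> 0 (y \<oplus>\<^bsub>C 0\<^esub> \<ominus>\<^bsub>C 0\<^esub> t) = \<zero>\<^bsub>C (Suc 0)\<^esub>" using t by (simp add: C.M.r_neg)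
  then obtain r where r: "r \<in> carrier R" "y \<oplus>\<^bsub>C 0\<^esub> \<ominus>\<^bsub>C 0\<^esub> t = \<epsilon> r" using \<epsilon>E c
    by (metis C.M.a_closed C.M.a_inv_closed)
  have "y = \<epsilon> r \<oplus>\<^bsub>C 0\<^esub> t" unfolding r(2)[symmetric] using c by (simp add: C.M.a_assoc C.M.l_neg)
  then show ?thesis using N_intros(1,2,5) r t by metis
qed

lemma q_minus: "y \<in> Y \<Longrightarrow> q (\<ominus>\<^bsub>C 0\<^esub> y) = \<ominus>\<^bsub>H\<^esub> q y"
  using q_smult[of "\<ominus> \<one>" y] H_carrier by (simp add: C.minus_one_smult H.minus_one_smult Y_carrier)

text \<open>Since \<open>\<delta> 0\<close> commutes with components, any preimage in
  \<open>Y\<close> may be replaced by its component in the right degree.\<close>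

lemma H_gradingE:
  assumes "h \<in> GH d" obtains y where "y \<in> Y" "y \<in> GC 0 d" "h = q y"
proof -
  obtain z where z: "z \<in> cocycles" "z \<in> GC (Suc 0) d" "h = coboundaries +>\<^bsub>cocycle_module\<^esub> z"
    using assms unfolding local_cohomology_grading_def quot_grading_def by auto
  obtain y where y: "y \<in> Y" "z = \<delta> 0 y" using z(1) by (rule cocycleE)
  have "z = component (C (Suc 0)) (GC (Suc 0)) z d" using C.cp_homog[OF z(2)] by simp
  also have "\<dots> = \<delta> 0 (component (C 0) (GC 0) y d)" unfolding y(2) using y Y_carrier
    by (simp add: \<delta>_component)
  finally show ?thesis
    using that[of "component (C 0) (GC 0) y d"] y Y_component C.cp_in Y_carrier z(3) unfolding q_def
      by auto
qed

section \<open>The graded Matlis dual and its associated primes\<close>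

abbreviation "dual \<equiv> star_Hom R H GH E GE"

lemma dual_facts:
  "submodule (carrier dual) R (Hom_module R H E)" "hom_of_degree R H GH E GE a \<subseteq> carrier dual"
  using submodule_star_Hom[OF H.module_axioms E_graded, of GH] H_gradingE H_carrier by blast+

lemma module_dual: "module R dual"
proof -
  have "dual = (Hom_module R H E)\<lparr>carrier := carrier dual\<rparr>" by (simp add: star_Hom_def)
  then show ?thesis
    using submodule.submodule_is_module[OF dual_facts(1) module_Hom_module[OF H.module_axioms E.module_axioms]] by metis
qed

lemma dual_mod_hom: "\<psi> \<in> carrier dual \<Longrightarrow> \<psi> \<in> mod_hom R H E"
  using module.submoduleE(1)[OF module_Hom_module[OF H.module_axioms E.module_axioms] dual_facts(1)]
    by auto

text \<open>If \<open>J\<close> annihilates \<open>\<psi>\<close>, then \<open>\<psi>\<close>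
  vanishes on \<open>J H\<close>. With \<open>J H = H\<close> this gives \<open>\<psi> = 0\<close>,
  whose annihilator is not proper.\<close>

proposition not_full_if_Ass:
  assumes J: "J \<subseteq> p" and p: "p \<in> Ass R dual"
  shows "\<not> full J"
proof
  assume full: "full J"
  obtain \<psi> where \<psi>: "\<psi> \<in> carrier dual" "p = annihilator R dual \<psi>" and prime: "primeideal p R"
    using p unfolding Ass_def by blast
  have Jc: "J \<subseteq> carrier R" using J \<psi>(2) unfolding annihilator_def by blast
  note hom = mod_homD[OF dual_mod_hom[OF \<psi>(1)]]
  have H0: "\<psi> \<zero>\<^bsub>H\<^esub> = \<zero>\<^bsub>E\<^esub>"
    by (rule mod_hom_zero[OF dual_mod_hom[OF \<psi>(1)] H.module_axioms E.module_axioms])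
  have qc: "q y \<in> carrier H" if "y \<in> Y" for y using that H_carrier by blast
  have zero: "\<psi> (q y) = \<zero>\<^bsub>E\<^esub>" if "y \<in> N J" for y
    using that Jc
  proof (induction y rule: N_induct(1))
    case (smult a y)
    have a: "a \<in> carrier R" using smult Jc by blast
    have "(\<lambda>x\<in>carrier H. a \<odot>\<^bsub>E\<^esub> \<psi> x) = (\<lambda>x\<in>carrier H. \<zero>\<^bsub>E\<^esub>)"
      using smult(1) J unfolding \<psi>(2) annihilator_def by auto
    then have "a \<odot>\<^bsub>E\<^esub> \<psi> (q y) = \<zero>\<^bsub>E\<^esub>" using qc[OF smult(2)] by (auto dest: fun_cong[of _ _ "q y"])
    then show ?case using hom(4)[OF a qc[OF smult(2)]] q_smult[OF a smult(2)] by simp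
  next
    case zero then show ?case using q_torsion[OF \<Gamma>_zero] H0 by simp
  next
    case (add x y) then show ?case using q_add hom(3) qc by simp
  qed (simp_all add: q_torsion q_\<epsilon> H0)
  have "\<psi> x = \<zero>\<^bsub>E\<^esub>" if "x \<in> carrier H" for x
    using that zero full unfolding full_def H_carrier by blast
  then have "\<psi> = (\<lambda>x\<in>carrier H. \<zero>\<^bsub>E\<^esub>)"
    using hom(1) by (auto simp: PiE_def extensional_def restrict_def fun_eq_iff)
  then have "annihilator R dual \<psi> = carrier R" unfolding annihilator_def
    by (auto intro: restrict_ext)
  then show False using primeideal.I_notcarr[OF prime] \<psi>(2) by simp
qed

text \<open>A homogeneous \<open>x0\<close> in \<open>Y\<close> outside \<open>N J\<close> generates
  a nonzero cyclic submodule of \<open>H / J H\<close>, which maps onto a shift of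
  \<open>R / mm\<close>. Sending \<open>x0\<close> to \<open>e0\<close> and \<open>N J\<close> to 0,
  and extending to \<open>C 0\<close>, yields a nonzero element of the dual that \<open>J\<close>
  kills; an associated prime contains its annihilator.\<close>

proposition Ass_if_not_full:
  assumes J: "homogeneous_ideal R G J" and nf: "\<not> full J"
  shows "\<exists>p\<in>Ass R dual. J \<subseteq> p"
proof -
  interpret dual: module R dual by (rule module_dual)
  note U = N_submodule[OF J]
  note US = C.submoduleE[OF U(1)]
  have Jc: "J \<subseteq> carrier R"
    using J additive_subgroup.a_subset[OF ideal.axioms(1)] unfolding homogeneous_ideal_def by auto
  obtain y0 where y0: "y0 \<in> Y" "y0 \<notin> N J" using nf unfolding full_def by blast
  have "\<exists>d. component (C 0) (GC 0) y0 d \<notin> N J"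
  proof (rule ccontr)
    assume "\<nexists>d. component (C 0) (GC 0) y0 d \<notin> N J"
    then have "y0 \<in> N J"
      by (intro C.in_if_cp_in[OF Y_carrier[OF y0(1)] _ N_intros(4) US(5) US(1)]) auto
    then show False using y0(2) by blast
  qed
  then obtain d where d: "component (C 0) (GC 0) y0 d \<notin> N J" by blast
  define x0 where "x0 = component (C 0) (GC 0) y0 d"
  have x0: "x0 \<in> Y" "x0 \<in> GC 0 d" "x0 \<notin> N J" "x0 \<in> carrier (C 0)"
    unfolding x0_def using d Y_component y0 C.cp_in Y_carrier by auto
  let ?\<Psi> = "N J \<times> {\<zero>\<^bsub>E\<^esub>}"
  have \<Psi>: "linear_graph R (C 0) (GC 0) E GE (- d) ?\<Psi>"
    unfolding linear_graph_def using US U(2) N_intros(4) by auto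
  \<comment> \<open>If \<open>r x0\<close> lies in \<open>N J\<close>, then so does
    \<open>r_i x0\<close> for every component \<open>r_i\<close>. A unit \<open>r_0\<close> would
    put \<open>x0\<close> itself into \<open>N J\<close>; hence \<open>r\<close> lies in
    \<open>mm\<close> and kills \<open>e0\<close>.\<close>
  have compat: "z = r \<odot>\<^bsub>E\<^esub> e0" if r: "r \<in> carrier R" and rz: "(r \<odot>\<^bsub>C 0\<^esub> x0, z) \<in> ?\<Psi>" for r z
  proof -
    have rx: "rc r i \<odot>\<^bsub>C 0\<^esub> x0 \<in> N J" for i
      using U(2)[of "r \<odot>\<^bsub>C 0\<^esub> x0" "i + d"] rz cp_smult_homog[OF C_graded x0(2) r, of "i + d"]
        by simp
    have "rc r i \<in> mm" for i
    proof (cases "i = 0")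
      case True
      have "rc r 0 \<notin> Units R"
      proof
        assume u: "rc r 0 \<in> Units R"
        have "inv (rc r 0) \<odot>\<^bsub>C 0\<^esub> (rc r 0 \<odot>\<^bsub>C 0\<^esub> x0) = x0"
          using u x0 by (simp add: C.smult_assoc1[symmetric] rc_carrier[OF r])
        then show False using US(4)[OF R.Units_inv_closed[OF u] rx[of 0]] x0(3) by simp
      qed
      then have "rc r 0 = \<zero>" using degree_zero_units[OF rc_in[OF r]] by blast
      then show ?thesis using True additive_subgroup.zero_closed[OF ideal.axioms(1)[OF mm_ideal]]
        by simp
    next
      case False then show ?thesis using degree_nonzero_mm rc_in[OF r] by blast
    qed
    then have "r \<in> mm" by (rule ideal_component_sum[OF mm_ideal r])
    then show ?thesis using e0(3) rz by simp
  qed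
  have e0': "e0 \<in> GE (d + - d)" using e0(1) by simp
  let ?\<Phi> = "{(v \<oplus>\<^bsub>C 0\<^esub> r \<odot>\<^bsub>C 0\<^esub> x0, z \<oplus>\<^bsub>E\<^esub> r \<odot>\<^bsub>E\<^esub> e0) |v z r. (v, z) \<in> ?\<Psi> \<and> r \<in> carrier R}"
  have ext: "linear_graph R (C 0) (GC 0) E GE (- d) ?\<Phi>" "?\<Psi> \<subseteq> ?\<Phi>" "(x0, e0) \<in> ?\<Phi>"
    by (rule linear_graph_extend[OF C_graded E_graded \<Psi> x0(2) e0']; rule compat; assumption)+
  obtain \<phi> where \<phi>: "\<phi> \<in> hom_of_degree R (C 0) (GC 0) E GE (- d)"
    and \<phi>_ext: "\<forall>(x, z)\<in>?\<Phi>. \<phi> x = z"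
    using star_injective_extend[OF E_inj C_graded ext(1)] by (elim bexE)
  have \<phi>x: "\<phi> x0 = e0" using bspec[OF \<phi>_ext ext(3)] by simp
  have \<phi>N: "\<phi> u = \<zero>\<^bsub>E\<^esub>" if "u \<in> N J" for u
    using bspec[OF \<phi>_ext subsetD[OF ext(2), of "(u, \<zero>\<^bsub>E\<^esub>)"]] that by simp
  note h\<phi> = mod_homD[OF hom_of_degreeD(1)[OF \<phi>]]
  \<comment> \<open>\<open>\<phi>\<close> vanishes on \<open>N J\<close>, which contains the kernel
    of \<open>q\<close>, so the chosen preimage does not matter.\<close>
  define \<psi> where "\<psi> = (\<lambda>h\<in>carrier H. \<phi> (SOME y. y \<in> Y \<and> q y = h))"
  have \<psi>q: "\<psi> (q y) = \<phi> y" if y: "y \<in> Y" for y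
  proof -
    define y' where "y' = (SOME y'. y' \<in> Y \<and> q y' = q y)"
    have y': "y' \<in> Y" "q y' = q y" using someI[of "\<lambda>y'. y' \<in> Y \<and> q y' = q y" y] y unfolding y'_def
      by auto
    have c: "y \<in> carrier (C 0)" "y' \<in> carrier (C 0)" "q y \<in> carrier H"
      using y y' Y_carrier H_carrier by auto
    have "q (y' \<oplus>\<^bsub>C 0\<^esub> \<ominus>\<^bsub>C 0\<^esub> y) = \<zero>\<^bsub>H\<^esub>"
      using q_add[OF y'(1) YS(3)[OF y]] q_minus[OF y] y'(2) c by (simp add: H.M.r_neg)
    then have "\<phi> (y' \<oplus>\<^bsub>C 0\<^esub> \<ominus>\<^bsub>C 0\<^esub> y) = \<zero>\<^bsub>E\<^esub>"
      using \<phi>N in_N_if_q_zero YS(5)[OF y'(1) YS(3)[OF y]] by blast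
    then have "\<phi> y' \<ominus>\<^bsub>E\<^esub> \<phi> y = \<zero>\<^bsub>E\<^esub>"
      using h\<phi>(3)[of y' "\<ominus>\<^bsub>C 0\<^esub> y"] c
        mod_hom_minus[OF hom_of_degreeD(1)[OF \<phi>] C.module_axioms E.module_axioms c(1)]
      by (simp add: a_minus_def)
    then have "\<phi> y' = \<phi> y" using E.M.minus_zero_iff h\<phi>(2) c by simp
    then show ?thesis unfolding \<psi>_def using c(3) by (simp add: y'_def)
  qed
  have "\<psi> \<in> mod_hom R H E"
  proof (rule mod_homI)
    show "\<psi> \<in> carrier H \<rightarrow>\<^sub>E carrier E"
    proof (rule PiE_I)
      fix h assume "h \<in> carrier H"
      then obtain y where "y \<in> Y" "h = q y" unfolding H_carrier by blast
      then show "\<psi> h \<in> carrier E" using \<psi>q h\<phi>(2) Y_carrier by simp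
    qed (simp add: \<psi>_def)
    show "\<psi> (g \<oplus>\<^bsub>H\<^esub> h) = \<psi> g \<oplus>\<^bsub>E\<^esub> \<psi> h" if gh: "g \<in> carrier H" "h \<in> carrier H" for g h
    proof -
      obtain x y where xy: "x \<in> Y" "g = q x" "y \<in> Y" "h = q y" using gh unfolding H_carrier by blast
      show ?thesis unfolding xy(2,4) q_add[OF xy(1,3), symmetric]
        using \<psi>q xy YS(5)[OF xy(1,3)] h\<phi>(3) Y_carrier by simp
    qed
    show "\<psi> (r \<odot>\<^bsub>H\<^esub> h) = r \<odot>\<^bsub>E\<^esub> \<psi> h" if r: "r \<in> carrier R" and h: "h \<in> carrier H" for r h
    proof -
      obtain y where y: "y \<in> Y" "h = q y" using h unfolding H_carrier by blast
      show ?thesis unfolding y(2) q_smult[OF r y(1), symmetric]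
        using \<psi>q y YS(4)[OF r y(1)] h\<phi>(4)[OF r] Y_carrier by simp
    qed
  qed
  moreover have "\<psi> h \<in> GE (i + - d)" if h: "h \<in> GH i" for h i
  proof -
    obtain y where "y \<in> Y" "y \<in> GC 0 i" "h = q y" using h by (rule H_gradingE)
    then show ?thesis using \<psi>q hom_of_degreeD(2)[OF \<phi>] by simp
  qed
  ultimately have "\<psi> \<in> hom_of_degree R H GH E GE (- d)" unfolding hom_of_degree_def by blast
  then have \<psi>: "\<psi> \<in> carrier dual" using dual_facts(2) by blast
  have "\<psi> \<noteq> \<zero>\<^bsub>dual\<^esub>"
  proof
    assume "\<psi> = \<zero>\<^bsub>dual\<^esub>"
    then have "\<psi> (q x0) = \<zero>\<^bsub>E\<^esub>" using x0(1) H_carrier by auto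
    then show False using \<psi>q[OF x0(1)] \<phi>x e0(2) by simp
  qed
  then obtain p where p: "p \<in> Ass R dual" "annihilator R dual \<psi> \<subseteq> p"
    using Ass_exists[OF module_dual \<psi>] by blast
  have "j \<in> annihilator R dual \<psi>" if j: "j \<in> J" for j
  proof -
    have jc: "j \<in> carrier R" using j Jc by blast
    have "j \<odot>\<^bsub>E\<^esub> \<psi> (q y) = \<zero>\<^bsub>E\<^esub>" if y: "y \<in> Y" for y
      using \<phi>N[OF N_intros(3)[OF j y]] h\<phi>(4)[OF jc Y_carrier[OF y]] \<psi>q[OF y] by simp
    then show ?thesis unfolding annihilator_def H_carrier using jc
      by (auto intro!: restrict_ext simp: H_carrier)
  qed
  then show ?thesis using p by blast
qed

end

section \<open>The criterion\<close>

lemma (in cring) primeideal_pow: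
  assumes "primeideal p R" "f \<in> carrier R" "f [^] (n::nat) \<in> p" shows "f \<in> p"
  using assms(3)
proof (induction n)
  case 0
  then have "p = carrier R" using ideal.one_imp_carrier[OF primeideal.axioms(1)[OF assms(1)]]
    by simp
  then show ?case using assms(2) by simp
next
  case (Suc n)
  then show ?case using primeideal.I_prime[OF assms(1), of "f [^] n" f] assms(2) by auto
qed

lemma (in cring) radical_mono: "I \<subseteq> J \<Longrightarrow> radical R I \<subseteq> radical R J"
  unfolding radical_def by blast

lemma (in cring) genideal_empty: "Idl {} = Idl {\<zero>}"
  using genideal_minimal[OF zeroideal, of "{}"] genideal_zero
    additive_subgroup.zero_closed[OF ideal.axioms(1)[OF genideal_ideal[of "{}"]]] by auto

context local_cohomology_setup
begin

lemma lin_comb_in_N: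
  assumes "set fs \<subseteq> J" "set fs \<subseteq> carrier R" "y \<in> lin_comb (C 0) Y (\<Gamma> 0) fs"
  shows "y \<in> N J"
  using assms
proof (induction fs arbitrary: y)
  case (Cons f fs)
  then obtain y' where y: "y \<in> carrier (C 0)" and y': "y' \<in> Y" "y \<ominus>\<^bsub>C 0\<^esub> f \<odot>\<^bsub>C 0\<^esub> y' \<in> N J"
    by auto
  have "(y \<ominus>\<^bsub>C 0\<^esub> f \<odot>\<^bsub>C 0\<^esub> y') \<oplus>\<^bsub>C 0\<^esub> f \<odot>\<^bsub>C 0\<^esub> y' = y"
    using y Y_carrier[OF y'(1)] Cons.prems by (simp add: a_minus_def C.M.a_assoc C.M.l_neg)
  then show ?case using N_intros(5)[OF y'(2) N_intros(3)[OF _ y'(1), of f J]] Cons.prems by simp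
qed (simp add: N_intros(1))

text \<open>The cone argument for the resolution: \<open>divisible\<close> comes from graded
  injectivity, \<open>generated_mod\<close> from the vanishing of local cohomology in degrees at
  least 2.\<close>

lemma in_lin_comb:
  assumes van: "\<And>i. i \<ge> 2 \<Longrightarrow>
      carrier (local_cohomology R I C \<delta> i) = {\<zero>\<^bsub>local_cohomology R I C \<delta> i\<^esub>}"
    and fs: "set fs \<subseteq> homogeneous_elements G" "I = Idl (set fs)" and y: "y \<in> Y"
  shows "y \<in> lin_comb (C 0) Y (\<Gamma> 0) fs"
proof -
  have fsc: "set fs \<subseteq> carrier R" using fs homogeneous_carrier by blast
  have \<Gamma>: "\<Gamma> i = tors R (set fs) (C i)" for i using \<Gamma>_eq_tors[of "set fs" i] fs(2) fsc by simp
  \<comment> \<open>Degrees at least 2 have the form \<open>Suc (Suc n)\<close>; triviality of the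
    quotient makes each torsion cocycle the coboundary of a torsion element.\<close>
  have bound: "\<exists>t\<in>\<Gamma> (Suc n). z = \<delta> (Suc n) t"
    if z: "z \<in> \<Gamma> (Suc (Suc n))" "\<delta> (Suc (Suc n)) z = \<zero>\<^bsub>C (Suc (Suc (Suc n)))\<^esub>" for n z
  proof -
    let ?B = "lc_coboundaries R I C \<delta> (Suc (Suc n))"
    have "?B +>\<^bsub>(C (Suc (Suc n)))\<lparr>carrier := lc_cocycles R I C \<delta> (Suc (Suc n))\<rparr>\<^esub> z = ?B"
      using van[of "Suc (Suc n)"] z unfolding local_cohomology_def by (auto simp: lc_cocycles_def)
    moreover have "\<zero>\<^bsub>C (Suc (Suc n))\<^esub> \<in> ?B"
      using imageI[OF \<Gamma>_zero, of "\<delta> (Suc n)" "Suc n"] by (simp add: lc_coboundaries_def)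
    moreover have "z \<in> carrier (C (Suc (Suc n)))" using z \<Gamma>S(1) by blast
    ultimately have "z \<in> ?B" unfolding a_r_coset_def' by force
    then show ?thesis by (auto simp: lc_coboundaries_def)
  qed
  \<comment> \<open>Positions are shifted by one: \<open>X 0\<close> is the zero module in cohomological degree \<open>-1\<close>.\<close>
  define X where "X = (\<lambda>n. case n of 0 \<Rightarrow> (C 0)\<lparr>carrier := {\<zero>\<^bsub>C 0\<^esub>}\<rparr> | Suc m \<Rightarrow> C m)"
  define D where "D = (\<lambda>n. case n of 0 \<Rightarrow> (\<lambda>_. \<zero>\<^bsub>C 0\<^esub>) | Suc m \<Rightarrow> \<delta> m)"
  have [simp]: "X 0 = (C 0)\<lparr>carrier := {\<zero>\<^bsub>C 0\<^esub>}\<rparr>" "X (Suc m) = C m" "D 0 = (\<lambda>_. \<zero>\<^bsub>C 0\<^esub>)" "D (Suc m) = \<delta> m" for m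
    by (simp_all add: X_def D_def)
  have "submodule {\<zero>\<^bsub>C 0\<^esub>} R (C 0)" by (rule C.submoduleI) (auto simp: C.M.a_inv_zero)
  then have X0: "module R (X 0)" using submodule.submodule_is_module[OF _ C.module_axioms] by simp
  interpret X: cochain_complex R X D
  proof (intro cochain_complex.intro cochain_complex_axioms.intro R.is_cring)
    fix n r x y
    show "module R (X n)" using X0 C.module_axioms by (cases n) auto
    show "D n x \<in> carrier (X (Suc n))" if "x \<in> carrier (X n)" using that by (cases n) auto
    show "D n (x \<oplus>\<^bsub>X n\<^esub> y) = D n x \<oplus>\<^bsub>X (Suc n)\<^esub> D n y" if "x \<in> carrier (X n)" "y \<in> carrier (X n)"
      using that by (cases n) auto
    show "D n (r \<odot>\<^bsub>X n\<^esub> x) = r \<odot>\<^bsub>X (Suc n)\<^esub> D n x" if "r \<in> carrier R" "x \<in> carrier (X n)"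
      using that by (cases n) auto
    show "D (Suc n) (D n x) = \<zero>\<^bsub>X (Suc (Suc n))\<^esub>" if "x \<in> carrier (X n)" using that
      by (cases n) auto
  qed
  have div: "divisible R (set fs) X"
    unfolding divisible_def
  proof (intro ballI allI impI)
    fix f F n y assume f: "f \<in> set fs" and F: "F \<subseteq> set fs" and y: "y \<in> tors R F (X n)"
    have fc: "f \<in> carrier R" and Fc: "F \<subseteq> carrier R" "insert f F \<subseteq> carrier R" using f F fsc by auto
    show "\<exists>y'\<in>tors R F (X n). \<exists>c\<in>tors R (insert f F) (X n). f \<odot>\<^bsub>X n\<^esub> y' = y \<oplus>\<^bsub>X n\<^esub> c"
    proof (cases n)
      case 0
      then have "y = \<zero>\<^bsub>C 0\<^esub>" using y unfolding tors_def by simp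
      moreover have "\<zero>\<^bsub>C 0\<^esub> \<in> tors R F (X 0)" "\<zero>\<^bsub>C 0\<^esub> \<in> tors R (insert f F) (X 0)"
        using Fc unfolding tors_def by (auto simp: subset_iff)
      ultimately show ?thesis using 0 fc by (intro bexI[of _ "\<zero>\<^bsub>C 0\<^esub>"]) auto
    next
      case (Suc m)
      have y: "y \<in> tors R F (C m)" using y Suc by simp
      have "F \<subseteq> homogeneous_elements G" "f \<in> homogeneous_elements G" using f F fs by auto
      from star_injective_divide[OF C_inj this y] obtain y' k where y': "y' \<in> tors R F (C m)"
        and k: "(f [^] (k::nat)) \<odot>\<^bsub>C m\<^esub> ((f \<odot>\<^bsub>C m\<^esub> y') \<ominus>\<^bsub>C m\<^esub> y) = \<zero>\<^bsub>C m\<^esub>" by auto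
      note T = C.submoduleE[OF C.submodule_tors[OF Fc(1), of m]]
      have c: "y \<in> carrier (C m)" "y' \<in> carrier (C m)" using y y' T(1) by auto
      \<comment> \<open>The defect of the division stays in the \<open>F\<close>-torsion and is
        killed by a power of \<open>f\<close>.\<close>
      let ?c = "(f \<odot>\<^bsub>C m\<^esub> y') \<ominus>\<^bsub>C m\<^esub> y"
      have "?c \<in> tors R F (C m)" unfolding a_minus_def by (rule T(5)[OF T(4)[OF fc y'] T(3)[OF y]])
      then have "?c \<in> tors R (insert f F) (C m)" using k unfolding tors_def by auto
      moreover have "f \<odot>\<^bsub>C m\<^esub> y' = y \<oplus>\<^bsub>C m\<^esub> ?c"
        using c fc by (simp add: a_minus_def C.M.a_ac C.M.r_neg2 C.M.r_neg1 C.M.r_neg)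
      ultimately show ?thesis using y' Suc by auto
    qed
  qed
  have gen: "generated_mod R (set fs) X D Y"
    unfolding generated_mod_def
  proof (intro conjI allI ballI impI)
    \<comment> \<open>The connecting homomorphism: the coboundary of \<open>u\<close> is a torsion
      cocycle of degree at least 2, hence \<open>\<delta> (Suc n) t\<close> with \<open>t\<close>
      torsion; then \<open>u - t\<close> is a cocycle of the exact resolution.\<close>
    fix n u assume u: "u \<in> carrier (X (Suc (Suc n)))" "D (Suc (Suc n)) u \<in> tors R (set fs) (X (Suc (Suc (Suc n))))"
    then have uc: "u \<in> carrier (C (Suc n))" and "\<delta> (Suc n) u \<in> \<Gamma> (Suc (Suc n))" by (simp_all add: \<Gamma>)
    from bound[OF this(2)] obtain t where t: "t \<in> \<Gamma> (Suc n)" "\<delta> (Suc n) u = \<delta> (Suc n) t" using uc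
      by auto
    have tc: "t \<in> carrier (C (Suc n))" using t \<Gamma>S(1) by blast
    have "u \<oplus>\<^bsub>C (Suc n)\<^esub> \<ominus>\<^bsub>C (Suc n)\<^esub> t \<in> \<delta> n ` carrier (C n)"
      unfolding \<delta>_exact using uc tc t(2) by (simp add: C.M.r_neg)
    then obtain v where v: "v \<in> carrier (C n)" "u \<oplus>\<^bsub>C (Suc n)\<^esub> \<ominus>\<^bsub>C (Suc n)\<^esub> t = \<delta> n v" by blast
    have "u = \<delta> n v \<oplus>\<^bsub>C (Suc n)\<^esub> t" unfolding v(2)[symmetric] using uc tc
      by (simp add: C.M.a_assoc C.M.l_neg)
    then show "\<exists>v\<in>carrier (X (Suc n)). \<exists>t\<in>tors R (set fs) (X (Suc (Suc n))).
        u = D (Suc n) v \<oplus>\<^bsub>X (Suc (Suc n))\<^esub> t" using v t \<Gamma> by auto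
  next
    fix u assume u: "u \<in> carrier (X (Suc 0))" "D (Suc 0) u \<in> tors R (set fs) (X (Suc (Suc 0)))"
    then have "u \<in> Y" by (simp add: Y_def \<Gamma>)
    moreover have "\<zero>\<^bsub>C 0\<^esub> \<in> tors R (set fs) (C 0)" using \<Gamma>_zero[of 0] \<Gamma> by simp
    ultimately show "\<exists>z\<in>Y. \<exists>v\<in>carrier (X 0). \<exists>t\<in>tors R (set fs) (X (Suc 0)).
        u = z \<oplus>\<^bsub>X (Suc 0)\<^esub> (D 0 v \<oplus>\<^bsub>X (Suc 0)\<^esub> t)"
      by (intro bexI[of _ u] bexI[of _ "\<zero>\<^bsub>C 0\<^esub>"]) (use Y_carrier in auto)
  qed
  show ?thesis
    using X.lin_comb_if_acyclic[OF fsc div gen, of y] Y_submodule y \<Gamma> by (simp add: Y_def)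
qed

text \<open>For a principal ideal one multiple of \<open>f\<close> suffices: \<open>(s f) y\<close>
  is rewritten as \<open>f (s y)\<close>, and \<open>Y\<close> is a submodule.\<close>

lemma principal_decomposition:
  assumes f: "f \<in> carrier R" and "x \<in> N (Idl {f})"
  shows "\<exists>y\<in>Y. \<exists>t\<in>\<Gamma> 0. \<exists>r\<in>carrier R. x = (f \<odot>\<^bsub>C 0\<^esub> y \<oplus>\<^bsub>C 0\<^esub> t) \<oplus>\<^bsub>C 0\<^esub> \<epsilon> r"
proof -
  have c: "Idl {f} \<subseteq> carrier R"
    using additive_subgroup.a_subset[OF ideal.axioms(1)[OF genideal_ideal[of "{f}"]]] f by simp
  have Y0: "\<zero>\<^bsub>C 0\<^esub> \<in> Y" using \<Gamma>_in_Y[OF \<Gamma>_zero] .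
  have I: ?thesis if "y \<in> Y" "t \<in> \<Gamma> 0" "r \<in> carrier R" "x = (f \<odot>\<^bsub>C 0\<^esub> y \<oplus>\<^bsub>C 0\<^esub> t) \<oplus>\<^bsub>C 0\<^esub> \<epsilon> r" for y t r
    using that by blast
  show ?thesis using assms(2) c
  proof (induction x rule: N_induct(1))
    case (torsion t)
    then show ?case using Y0 \<Gamma>S(1)[where i = 0] f
      by - (rule bexI[of _ "\<zero>\<^bsub>C 0\<^esub>", OF bexI[of _ t, OF bexI[of _ \<zero>]]], auto)
  next
    case (ring r)
    then show ?case using Y0 f
      by - (rule bexI[of _ "\<zero>\<^bsub>C 0\<^esub>", OF bexI[of _ "\<zero>\<^bsub>C 0\<^esub>", OF bexI[of _ r]]], auto)
  next
    case (smult a y)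
    obtain s where s: "s \<in> carrier R" "a = s \<otimes> f" using smult(1) genideal_singleton_iff[OF f]
      by blast
    then have "a \<odot>\<^bsub>C 0\<^esub> y = f \<odot>\<^bsub>C 0\<^esub> (s \<odot>\<^bsub>C 0\<^esub> y)"
      using f Y_carrier[OF smult(2)] by (simp add: C.smult_assoc1 C.smult_swap)
    then show ?case using YS(4)[OF s(1) smult(2)] f Y_carrier[OF YS(4)[OF s(1) smult(2)]]
      by - (rule bexI[of _ "s \<odot>\<^bsub>C 0\<^esub> y", OF bexI[of _ "\<zero>\<^bsub>C 0\<^esub>", OF bexI[of _ \<zero>]]], auto)
  next
    case zero
    then show ?case using Y0 f
      by - (rule bexI[of _ "\<zero>\<^bsub>C 0\<^esub>", OF bexI[of _ "\<zero>\<^bsub>C 0\<^esub>", OF bexI[of _ \<zero>]]], auto)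
  next
    case (add x x')
    then obtain y t r y' t' r'
      where *: "y \<in> Y" "t \<in> \<Gamma> 0" "r \<in> carrier R" "x = (f \<odot>\<^bsub>C 0\<^esub> y \<oplus>\<^bsub>C 0\<^esub> t) \<oplus>\<^bsub>C 0\<^esub> \<epsilon> r"
      "y' \<in> Y" "t' \<in> \<Gamma> 0" "r' \<in> carrier R" "x' = (f \<odot>\<^bsub>C 0\<^esub> y' \<oplus>\<^bsub>C 0\<^esub> t') \<oplus>\<^bsub>C 0\<^esub> \<epsilon> r'" by blast
    have c: "y \<in> carrier (C 0)" "y' \<in> carrier (C 0)" "t \<in> carrier (C 0)" "t' \<in> carrier (C 0)"
      using * Y_carrier \<Gamma>S(1) by blast+
    have "x \<oplus>\<^bsub>C 0\<^esub> x' = (f \<odot>\<^bsub>C 0\<^esub> (y \<oplus>\<^bsub>C 0\<^esub> y') \<oplus>\<^bsub>C 0\<^esub> (t \<oplus>\<^bsub>C 0\<^esub> t')) \<oplus>\<^bsub>C 0\<^esub> \<epsilon> (r \<oplus> r')"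
      unfolding *(4,8) using c f *(3,7) by (simp add: C.smult_r_distr C.M.a_ac)
    then show ?case using YS(5)[OF *(1,5)] \<Gamma>S(5)[OF *(2,6)] *(3,7) by blast
  qed
qed

text \<open>In a sum of terms \<open>g z\<close> with \<open>g\<close> in \<open>J\<close>, fullness
  replaces \<open>z\<close> by \<open>f y + t + \<epsilon> r\<close>; then
  \<open>g \<epsilon> r\<close> is the image of an element of \<open>J\<close>. The ring part of the
  decomposition is thereby confined to \<open>J\<close>.\<close>

lemma lin_comb_decomposition:
  assumes f: "f \<in> carrier R" and full: "full (Idl {f})" and J: "ideal J R" "set fs \<subseteq> J"
    and "x \<in> lin_comb (C 0) Y (\<Gamma> 0) fs"
  shows "\<exists>y\<in>Y. \<exists>t\<in>\<Gamma> 0. \<exists>a\<in>J. x = (f \<odot>\<^bsub>C 0\<^esub> y \<oplus>\<^bsub>C 0\<^esub> t) \<oplus>\<^bsub>C 0\<^esub> \<epsilon> a"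
  using assms(4,5)
proof (induction fs arbitrary: x)
  case Nil
  have "\<zero>\<^bsub>C 0\<^esub> \<in> Y" using \<Gamma>_in_Y[OF \<Gamma>_zero] .
  moreover have "\<zero> \<in> J" using additive_subgroup.zero_closed[OF ideal.axioms(1)[OF J(1)]] .
  ultimately show ?case using Nil \<Gamma>S(1)[where i = 0] f
    by - (rule bexI[of _ "\<zero>\<^bsub>C 0\<^esub>", OF bexI[of _ x, OF bexI[of _ \<zero>]]], auto)
next
  case (Cons g fs)
  interpret J: ideal J R by (rule J(1))
  obtain z where x: "x \<in> carrier (C 0)"
    and z: "z \<in> Y" "x \<ominus>\<^bsub>C 0\<^esub> g \<odot>\<^bsub>C 0\<^esub> z \<in> lin_comb (C 0) Y (\<Gamma> 0) fs"
    using Cons.prems by auto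
  have g: "g \<in> J" "g \<in> carrier R" using Cons.prems J.Icarr by auto
  from Cons.IH[OF _ z(2)] Cons.prems(1) obtain y1 t1 a where 1: "y1 \<in> Y" "t1 \<in> \<Gamma> 0" "a \<in> J"
    "x \<ominus>\<^bsub>C 0\<^esub> g \<odot>\<^bsub>C 0\<^esub> z = (f \<odot>\<^bsub>C 0\<^esub> y1 \<oplus>\<^bsub>C 0\<^esub> t1) \<oplus>\<^bsub>C 0\<^esub> \<epsilon> a" by auto
  from principal_decomposition[OF f subsetD[OF full[unfolded full_def] z(1)]]
  obtain y2 t2 r where 2: "y2 \<in> Y" "t2 \<in> \<Gamma> 0" "r \<in> carrier R"
    "z = (f \<odot>\<^bsub>C 0\<^esub> y2 \<oplus>\<^bsub>C 0\<^esub> t2) \<oplus>\<^bsub>C 0\<^esub> \<epsilon> r" by blast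
  have c: "y1 \<in> carrier (C 0)" "y2 \<in> carrier (C 0)" "t1 \<in> carrier (C 0)" "t2 \<in> carrier (C 0)" "a \<in> carrier R"
    "z \<in> carrier (C 0)"
    using 1 2 Y_carrier \<Gamma>S(1) J.Icarr z by blast+
  have "x = (x \<ominus>\<^bsub>C 0\<^esub> g \<odot>\<^bsub>C 0\<^esub> z) \<oplus>\<^bsub>C 0\<^esub> g \<odot>\<^bsub>C 0\<^esub> z"
    using x c g by (simp add: a_minus_def C.M.a_assoc C.M.l_neg)
  also have "\<dots> = ((f \<odot>\<^bsub>C 0\<^esub> y1 \<oplus>\<^bsub>C 0\<^esub> t1) \<oplus>\<^bsub>C 0\<^esub> \<epsilon> a) \<oplus>\<^bsub>C 0\<^esub>
      g \<odot>\<^bsub>C 0\<^esub> ((f \<odot>\<^bsub>C 0\<^esub> y2 \<oplus>\<^bsub>C 0\<^esub> t2) \<oplus>\<^bsub>C 0\<^esub> \<epsilon> r)"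
    unfolding 1(4) 2(4)[symmetric] by simp
  also have "\<dots> = (f \<odot>\<^bsub>C 0\<^esub> (y1 \<oplus>\<^bsub>C 0\<^esub> g \<odot>\<^bsub>C 0\<^esub> y2) \<oplus>\<^bsub>C 0\<^esub> (t1 \<oplus>\<^bsub>C 0\<^esub> g \<odot>\<^bsub>C 0\<^esub> t2)) \<oplus>\<^bsub>C 0\<^esub> \<epsilon> (a \<oplus> g \<otimes> r)"
    using c f g 2(3) by (simp add: C.smult_r_distr C.smult_swap[of g f] C.M.a_ac)
  finally have "x = \<dots>" .
  moreover have "y1 \<oplus>\<^bsub>C 0\<^esub> g \<odot>\<^bsub>C 0\<^esub> y2 \<in> Y" by (rule YS(5)[OF 1(1) YS(4)[OF g(2) 2(1)]])
  moreover have "t1 \<oplus>\<^bsub>C 0\<^esub> g \<odot>\<^bsub>C 0\<^esub> t2 \<in> \<Gamma> 0" by (rule \<Gamma>S(5)[OF 1(2) \<Gamma>S(4)[OF g(2) 2(2)]])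
  moreover have "a \<oplus> g \<otimes> r \<in> J" by (rule J.a_closed[OF 1(3) J.I_r_closed[OF g(1) 2(3)]])
  ultimately show ?case by blast
qed

end

section \<open>Radicals of \<open>I\<close> and of principal ideals, compared through
  fullness\<close>

context local_cohomology_setup
begin

text \<open>Elements of \<open>Y\<close> are fractions with powers of \<open>f\<close> as
  denominators: a power kills the torsion element \<open>\<delta> 0 y\<close>, and exactness at
  \<open>C 0\<close> applies. All large \<open>n\<close> work, so exponents can be unified.\<close>

lemma Y_pow_in_ring:
  assumes "y \<in> Y" "f \<in> carrier R" "\<And>x i. x \<in> \<Gamma> i \<Longrightarrow> \<exists>n::nat. f [^] n \<odot>\<^bsub>C i\<^esub> x = \<zero>\<^bsub>C i\<^esub>"
  shows "\<exists>n0::nat. \<forall>n\<ge>n0. \<exists>r\<in>carrier R. f [^] n \<odot>\<^bsub>C 0\<^esub> y = \<epsilon> r"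
proof -
  have y: "y \<in> carrier (C 0)" "\<delta> 0 y \<in> \<Gamma> (Suc 0)" using assms(1) unfolding Y_def by auto
  obtain n0 :: nat where n0: "f [^] n0 \<odot>\<^bsub>C (Suc 0)\<^esub> \<delta> 0 y = \<zero>\<^bsub>C (Suc 0)\<^esub>" using assms(3)[OF y(2)]
    by blast
  have "\<exists>r\<in>carrier R. f [^] n \<odot>\<^bsub>C 0\<^esub> y = \<epsilon> r" if "n \<ge> n0" for n
  proof -
    have "f [^] n \<odot>\<^bsub>C (Suc 0)\<^esub> \<delta> 0 y = \<zero>\<^bsub>C (Suc 0)\<^esub>"
      using C.smult_pow_le[OF assms(2) _ n0 that] y by simp
    then have "\<delta> 0 (f [^] n \<odot>\<^bsub>C 0\<^esub> y) = \<zero>\<^bsub>C (Suc 0)\<^esub>" using \<delta>D(3)[of "f [^] n" y 0] assms(2) y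
      by simp
    then show ?thesis using \<epsilon>E[of "f [^] n \<odot>\<^bsub>C 0\<^esub> y"] assms(2) y by blast
  qed
  then show ?thesis by blast
qed

lemma \<epsilon>_eqD: "\<epsilon> r = \<epsilon> s \<Longrightarrow> r \<in> carrier R \<Longrightarrow> s \<in> carrier R \<Longrightarrow> r = s"
  using \<epsilon>_inj by (auto dest: inj_onD)

text \<open>Decompose 1 as \<open>f y + t + a\<close> with \<open>a\<close> in \<open>I\<close>. A
  power of a generator \<open>g\<close> that clears denominators and kills \<open>t\<close> gives
  \<open>g^n = f r + g^n a\<close> in \<open>R\<close>. In the degree of \<open>g^n\<close>, the
  last term involves the degree-0 component of \<open>a\<close>, which vanishes.\<close>

proposition radical_eq_if_full:
  assumes van: "\<And>i. i \<ge> 2 \<Longrightarrow>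
      carrier (local_cohomology R I C \<delta> i) = {\<zero>\<^bsub>local_cohomology R I C \<delta> i\<^esub>}"
    and I_mm: "I \<subseteq> mm" and f: "f \<in> homogeneous_elements G" "f \<in> I" and full: "full (Idl {f})"
  shows "radical R I = radical R (Idl {f})"
proof
  have fc: "f \<in> carrier R" using f homogeneous_carrier by blast
  have Jh: "homogeneous_ideal R G (Idl {f})" using homogeneous_ideal_genideal f by simp
  have J: "ideal (Idl {f}) R" using genideal_ideal[of "{f}"] fc by simp
  obtain fs where fs: "set fs \<subseteq> homogeneous_elements G" "I = Idl (set fs)" using I_generators
    by blast
  have fsc: "set fs \<subseteq> carrier R" using fs homogeneous_carrier by blast
  have fsI: "set fs \<subseteq> I" using genideal_self[OF fsc] fs(2) by simp
  have \<Gamma>: "\<Gamma> i = tors R (set fs) (C i)" for i using \<Gamma>_eq_tors[of "set fs" i] fs(2) fsc by simp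
  obtain y t a where y: "y \<in> Y" and t: "t \<in> \<Gamma> 0" and a: "a \<in> I"
    and eq: "\<epsilon> \<one> = (f \<odot>\<^bsub>C 0\<^esub> y \<oplus>\<^bsub>C 0\<^esub> t) \<oplus>\<^bsub>C 0\<^esub> \<epsilon> a"
    using lin_comb_decomposition[OF fc full I_ideal fsI in_lin_comb[OF van fs \<epsilon>_in_Y[OF R.one_closed]]]
    by blast
  have c: "y \<in> carrier (C 0)" "t \<in> carrier (C 0)" "a \<in> carrier R"
    using y t a Y_carrier \<Gamma>S(1) ideal.Icarr[OF I_ideal] by blast+
  have gJ: "\<exists>n::nat. g [^] n \<in> Idl {f}" if g: "g \<in> set fs" for g
  proof -
    have gc: "g \<in> carrier R" using g fsc by blast
    have "\<exists>n::nat. g [^] n \<odot>\<^bsub>C i\<^esub> x = \<zero>\<^bsub>C i\<^esub>" if "x \<in> \<Gamma> i" for x i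
      using that g unfolding \<Gamma> tors_def by auto
    note tor = this
    obtain n0 where n0: "\<And>n::nat. n \<ge> n0 \<Longrightarrow> \<exists>r\<in>carrier R. g [^] n \<odot>\<^bsub>C 0\<^esub> y = \<epsilon> r"
      using Y_pow_in_ring[OF y gc tor] by blast
    obtain n1 :: nat where n1: "g [^] n1 \<odot>\<^bsub>C 0\<^esub> t = \<zero>\<^bsub>C 0\<^esub>" using tor[OF t] by blast
    define n where "n = max n0 n1"
    obtain r where r: "r \<in> carrier R" "g [^] n \<odot>\<^bsub>C 0\<^esub> y = \<epsilon> r" using n0[of n] unfolding n_def
      by auto
    have tn: "g [^] n \<odot>\<^bsub>C 0\<^esub> t = \<zero>\<^bsub>C 0\<^esub>" using C.smult_pow_le[OF gc c(2) n1] unfolding n_def by simp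
    have "g [^] n \<odot>\<^bsub>C 0\<^esub> \<epsilon> \<one> = (f \<odot>\<^bsub>C 0\<^esub> (g [^] n \<odot>\<^bsub>C 0\<^esub> y) \<oplus>\<^bsub>C 0\<^esub> g [^] n \<odot>\<^bsub>C 0\<^esub> t) \<oplus>\<^bsub>C 0\<^esub> g [^] n \<odot>\<^bsub>C 0\<^esub> \<epsilon> a"
      unfolding eq using c fc gc by (simp add: C.smult_r_distr C.smult_swap[of "g [^] n" f])
    also have "\<dots> = \<epsilon> (f \<otimes> r \<oplus> g [^] n \<otimes> a)"
      unfolding r(2) tn using c r fc gc \<epsilon>D(3)[of f r] \<epsilon>D(3)[of "g [^] n" a] by simp
    finally have "\<epsilon> (g [^] n) = \<epsilon> (f \<otimes> r \<oplus> g [^] n \<otimes> a)" using \<epsilon>D(3)[of "g [^] n" \<one>] gc by simp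
    then have gn: "g [^] n = f \<otimes> r \<oplus> g [^] n \<otimes> a" using c r fc gc by (intro \<epsilon>_eqD) auto
    have "g [^] n \<in> homogeneous_elements G" using g fs(1) by (intro homogeneous_pow) blast
    then obtain d where d: "g [^] n \<in> G d" unfolding homogeneous_elements_def by blast
    \<comment> \<open>Multiplication by \<open>g^n\<close>, of degree \<open>d\<close>, moves the
      degree-0 component of \<open>a\<close> to degree \<open>d\<close>.\<close>
    have "g [^] n = rc (g [^] n) d" using rc_homog[OF d] by simp
    also have "\<dots> = rc (f \<otimes> r) d \<oplus> g [^] n \<otimes> rc a 0"
      using arg_cong[OF gn, of "\<lambda>x. rc x d"] rc_add[of "f \<otimes> r" "g [^] n \<otimes> a" d] rc_mult[OF c(3) d, of d] c r fc gc by simp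
    also have "rc a 0 = \<zero>" using rc_mm_zero a I_mm by blast
    finally have "g [^] n = rc (f \<otimes> r) d" using rc_carrier fc r gc by simp
    moreover have "f \<otimes> r \<in> Idl {f}" using genideal_singleton_iff[OF fc] r fc m_comm by blast
    ultimately show ?thesis using homogeneous_ideal_component[OF Jh] by metis
  qed
  show "radical R I \<subseteq> radical R (Idl {f})"
    unfolding fs(2) by (rule genideal_subset_radical[OF _ fsc J gJ]) simp
  show "radical R (Idl {f}) \<subseteq> radical R I"
    by (rule radical_mono[OF genideal_minimal[OF I_ideal]]) (use f in simp)
qed

lemma \<Gamma>_if_radical_eq:
  assumes "f \<in> carrier R" "radical R I = radical R (Idl {f})"
  shows "\<Gamma> i = {x \<in> carrier (C i). \<exists>n::nat. f [^] n \<odot>\<^bsub>C i\<^esub> x = \<zero>\<^bsub>C i\<^esub>}"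
  using \<Gamma>_eq_tors[of "{f}" i] assms unfolding tors_def by simp

text \<open>With equal radicals, torsion means \<open>f\<close>-power torsion, which multiplication
  by \<open>f^k\<close> does not affect.\<close>

lemma Y_if_smult:
  assumes f: "f \<in> carrier R" "radical R I = radical R (Idl {f})"
    and y: "y \<in> carrier (C 0)" "f [^] (k::nat) \<odot>\<^bsub>C 0\<^esub> y \<in> Y"
  shows "y \<in> Y"
proof -
  have "\<delta> 0 (f [^] k \<odot>\<^bsub>C 0\<^esub> y) \<in> \<Gamma> (Suc 0)" using y(2) unfolding Y_def by blast
  then have "f [^] k \<odot>\<^bsub>C (Suc 0)\<^esub> \<delta> 0 y \<in> \<Gamma> (Suc 0)" using \<delta>D(3)[of "f [^] k" y 0] f y by simp
  then obtain n :: nat where "f [^] n \<odot>\<^bsub>C (Suc 0)\<^esub> (f [^] k \<odot>\<^bsub>C (Suc 0)\<^esub> \<delta> 0 y) = \<zero>\<^bsub>C (Suc 0)\<^esub>"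
    unfolding \<Gamma>_if_radical_eq[OF f] by auto
  then have "f [^] (n + k) \<odot>\<^bsub>C (Suc 0)\<^esub> \<delta> 0 y = \<zero>\<^bsub>C (Suc 0)\<^esub>"
    using f y by (simp add: C.smult_assoc1[symmetric] R.nat_pow_mult)
  then show ?thesis using y unfolding Y_def \<Gamma>_if_radical_eq[OF f] by auto
qed

text \<open>Divide \<open>y\<close> by \<open>f\<close> in the injective module \<open>C 0\<close>,
  up to \<open>f\<close>-torsion. As \<open>f\<close>-torsion is \<open>I\<close>-torsion, the
  defect lies in \<open>\<Gamma> 0\<close> and the result lies in \<open>Y\<close> again.\<close>

proposition full_if_radical_eq:
  assumes f: "f \<in> homogeneous_elements G" "radical R I = radical R (Idl {f})"
  shows "full (Idl {f})"
  unfolding full_def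
proof
  fix y assume y: "y \<in> Y"
  have fc: "f \<in> carrier R" using f homogeneous_carrier by blast
  have yc: "y \<in> carrier (C 0)" using y Y_carrier by blast
  \<comment> \<open>With no torsion condition, the division takes place in all of
    \<open>C 0\<close>.\<close>
  then have "y \<in> tors R {} (C 0)" unfolding tors_def by simp
  from star_injective_divide[OF C_inj _ f(1) this] obtain y' k where y': "y' \<in> carrier (C 0)"
    and k: "f [^] (k::nat) \<odot>\<^bsub>C 0\<^esub> ((f \<odot>\<^bsub>C 0\<^esub> y') \<ominus>\<^bsub>C 0\<^esub> y) = \<zero>\<^bsub>C 0\<^esub>"
    unfolding tors_def by auto
  let ?c = "(f \<odot>\<^bsub>C 0\<^esub> y') \<ominus>\<^bsub>C 0\<^esub> y"
  have c: "?c \<in> \<Gamma> 0" using k y' yc fc unfolding \<Gamma>_if_radical_eq[OF fc f(2)] by auto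
  have eq: "f \<odot>\<^bsub>C 0\<^esub> y' = y \<oplus>\<^bsub>C 0\<^esub> ?c"
    using y' yc fc by (simp add: a_minus_def C.M.a_ac C.M.r_neg2 C.M.r_neg1 C.M.r_neg)
  have "f \<odot>\<^bsub>C 0\<^esub> y' \<in> Y" by (subst eq) (rule YS(5)[OF y \<Gamma>_in_Y[OF c]])
  then have "y' \<in> Y" using Y_if_smult[OF fc f(2) y', of 1] fc by simp
  then have "f \<odot>\<^bsub>C 0\<^esub> y' \<in> N (Idl {f})" using genideal_self'[OF fc] by (intro N_intros(3))
  moreover have "\<ominus>\<^bsub>C 0\<^esub> ?c \<in> N (Idl {f})" using \<Gamma>S(3)[OF c] by (rule N_intros(1))
  ultimately have "f \<odot>\<^bsub>C 0\<^esub> y' \<oplus>\<^bsub>C 0\<^esub> \<ominus>\<^bsub>C 0\<^esub> ?c \<in> N (Idl {f})" by (rule N_intros(5))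
  moreover have "y = f \<odot>\<^bsub>C 0\<^esub> y' \<oplus>\<^bsub>C 0\<^esub> \<ominus>\<^bsub>C 0\<^esub> ?c"
    by (rule C.M.move_right[OF yc _ _ eq[symmetric]]) (use y' yc fc in auto)
  ultimately show "y \<in> N (Idl {f})" by simp
qed

text \<open>One class is tested: \<open>y\<close> with \<open>f^(k+1) y = f^k\<close> plays the role
  of \<open>1 / f\<close>. Membership in \<open>N J\<close> gives, after clearing denominators,
  \<open>f^m = j + f^(m+1) r\<close> with \<open>j\<close> in \<open>J\<close>. In the degree of
  \<open>f^m\<close> only \<open>j\<close> contributes, because \<open>f r\<close> has no component
  of degree 0.\<close>

proposition pow_in_if_full:
  assumes f: "f \<in> homogeneous_elements G" "radical R I = radical R (Idl {f})" and fmm: "f \<in> mm"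
    and J: "homogeneous_ideal R G J" and full: "full J"
  shows "\<exists>n::nat. f [^] n \<in> J"
proof -
  have id: "ideal J R" using J unfolding homogeneous_ideal_def by blast
  interpret J: ideal J R by (rule id)
  interpret mm: ideal mm R by (rule mm_ideal)
  have Jc: "J \<subseteq> carrier R" using J.a_subset .
  have fc: "f \<in> carrier R" using f homogeneous_carrier by blast
  obtain e where e: "f \<in> G e" using f unfolding homogeneous_elements_def by blast
  have "\<epsilon> \<one> \<in> GC 0 0" using hom_of_degreeD(2)[OF \<epsilon>_hom one_degree] by simp
  from star_injective_divide_homogeneous[OF C_inj e this] obtain y k where y: "y \<in> carrier (C 0)"
    and k: "f [^] Suc k \<odot>\<^bsub>C 0\<^esub> y = f [^] (k::nat) \<odot>\<^bsub>C 0\<^esub> \<epsilon> \<one>" by blast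
  have k': "f [^] Suc k \<odot>\<^bsub>C 0\<^esub> y = \<epsilon> (f [^] k)" unfolding k using \<epsilon>D(3)[of "f [^] k" \<one>] fc by simp
  have yY: "y \<in> Y" by (rule Y_if_smult[OF fc f(2) y, of "Suc k"]) (use k' \<epsilon>_in_Y fc in simp)
  have tor: "\<exists>n::nat. f [^] n \<odot>\<^bsub>C i\<^esub> x = \<zero>\<^bsub>C i\<^esub>" if "x \<in> \<Gamma> i" for x i
    using that unfolding \<Gamma>_if_radical_eq[OF fc f(2)] by blast
  \<comment> \<open>Stated for all large \<open>n\<close>, since sums need a common exponent and the
    exponent used afterwards must also exceed \<open>k\<close>; \<open>j\<close> and
    \<open>r\<close> may depend on \<open>n\<close>.\<close>
  have "\<exists>n0. \<forall>n\<ge>n0. \<exists>j\<in>J. \<exists>r\<in>carrier R. f [^] (n::nat) \<odot>\<^bsub>C 0\<^esub> x = \<epsilon> (j \<oplus> f [^] n \<otimes> r)" if "x \<in> N J" for x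
    using that Jc
  proof (induction x rule: N_induct(1))
    case (torsion t)
    have t: "t \<in> carrier (C 0)" using torsion \<Gamma>S(1) by blast
    obtain n0 :: nat where n0: "f [^] n0 \<odot>\<^bsub>C 0\<^esub> t = \<zero>\<^bsub>C 0\<^esub>" using tor[OF torsion] by blast
    have "f [^] n \<odot>\<^bsub>C 0\<^esub> t = \<epsilon> (\<zero> \<oplus> f [^] n \<otimes> \<zero>)" if "n \<ge> n0" for n
      using C.smult_pow_le[OF fc t n0 that] fc by simp
    then show ?case using J.zero_closed R.zero_closed by blast
  next
    case (ring r)
    have "f [^] n \<odot>\<^bsub>C 0\<^esub> \<epsilon> r = \<epsilon> (\<zero> \<oplus> f [^] n \<otimes> r)" for n :: nat
      using \<epsilon>D(3)[of "f [^] n" r] ring fc by simp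
    then show ?case using J.zero_closed ring by blast
  next
    case (smult a y)
    have a: "a \<in> carrier R" using smult Jc by blast
    have yc: "y \<in> carrier (C 0)" using smult Y_carrier by blast
    obtain n0 where n0: "\<And>n::nat. n \<ge> n0 \<Longrightarrow> \<exists>r\<in>carrier R. f [^] n \<odot>\<^bsub>C 0\<^esub> y = \<epsilon> r"
      using Y_pow_in_ring[OF smult(2) fc tor] by blast
    have "\<exists>j\<in>J. \<exists>r\<in>carrier R. f [^] n \<odot>\<^bsub>C 0\<^esub> (a \<odot>\<^bsub>C 0\<^esub> y) = \<epsilon> (j \<oplus> f [^] n \<otimes> r)" if n: "n \<ge> n0" for n
    proof -
      obtain r where r: "r \<in> carrier R" "f [^] n \<odot>\<^bsub>C 0\<^esub> y = \<epsilon> r" using n0[OF n] by blast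
      have "f [^] n \<odot>\<^bsub>C 0\<^esub> (a \<odot>\<^bsub>C 0\<^esub> y) = \<epsilon> (a \<otimes> r \<oplus> f [^] n \<otimes> \<zero>)"
        using C.smult_swap[of "f [^] n" a y] r a yc fc \<epsilon>D(3)[OF a r(1)] by simp
      then show ?thesis using J.I_r_closed[OF smult(1) r(1)] by blast
    qed
    then show ?case by blast
  next
    case zero
    have "f [^] n \<odot>\<^bsub>C 0\<^esub> \<zero>\<^bsub>C 0\<^esub> = \<epsilon> (\<zero> \<oplus> f [^] n \<otimes> \<zero>)" for n :: nat using fc by simp
    then show ?case using J.zero_closed R.zero_closed by blast
  next
    case (add x x')
    have c: "x \<in> carrier (C 0)" "x' \<in> carrier (C 0)" using add Y_carrier by auto
    obtain n0 n1
      where n0: "\<And>n::nat. n \<ge> n0 \<Longrightarrow> \<exists>j\<in>J. \<exists>r\<in>carrier R. f [^] n \<odot>\<^bsub>C 0\<^esub> x = \<epsilon> (j \<oplus> f [^] n \<otimes> r)"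
      and n1: "\<And>n::nat. n \<ge> n1 \<Longrightarrow> \<exists>j\<in>J. \<exists>r\<in>carrier R. f [^] n \<odot>\<^bsub>C 0\<^esub> x' = \<epsilon> (j \<oplus> f [^] n \<otimes> r)"
      using add by blast
    have "\<exists>j\<in>J. \<exists>r\<in>carrier R. f [^] n \<odot>\<^bsub>C 0\<^esub> (x \<oplus>\<^bsub>C 0\<^esub> x') = \<epsilon> (j \<oplus> f [^] n \<otimes> r)" if n: "n \<ge> max n0 n1" for n
    proof -
      obtain j r where 1: "j \<in> J" "r \<in> carrier R" "f [^] n \<odot>\<^bsub>C 0\<^esub> x = \<epsilon> (j \<oplus> f [^] n \<otimes> r)"
        using n0[of n] n by auto
      obtain j' r' where 2: "j' \<in> J" "r' \<in> carrier R" "f [^] n \<odot>\<^bsub>C 0\<^esub> x' = \<epsilon> (j' \<oplus> f [^] n \<otimes> r')"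
        using n1[of n] n by auto
      have jc: "j \<in> carrier R" "j' \<in> carrier R" using 1 2 J.Icarr by auto
      have "f [^] n \<odot>\<^bsub>C 0\<^esub> (x \<oplus>\<^bsub>C 0\<^esub> x') = \<epsilon> (j \<oplus> f [^] n \<otimes> r) \<oplus>\<^bsub>C 0\<^esub> \<epsilon> (j' \<oplus> f [^] n \<otimes> r')"
        using c fc 1(3) 2(3) by (simp add: C.smult_r_distr)
      also have "\<dots> = \<epsilon> ((j \<oplus> f [^] n \<otimes> r) \<oplus> (j' \<oplus> f [^] n \<otimes> r'))"
        using \<epsilon>D(2)[of "j \<oplus> f [^] n \<otimes> r" "j' \<oplus> f [^] n \<otimes> r'"] jc 1 2 fc by simp
      also have "(j \<oplus> f [^] n \<otimes> r) \<oplus> (j' \<oplus> f [^] n \<otimes> r') = (j \<oplus> j') \<oplus> f [^] n \<otimes> (r \<oplus> r')"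
        using jc 1(2) 2(2) fc by (simp add: r_distr R.a_ac)
      finally show ?thesis using J.a_closed[OF 1(1) 2(1)] 1(2) 2(2) R.a_closed by blast
    qed
    then show ?case by blast
  qed
  then obtain n0
    where n0: "\<And>n::nat. n \<ge> n0 \<Longrightarrow> \<exists>j\<in>J. \<exists>r\<in>carrier R. f [^] n \<odot>\<^bsub>C 0\<^esub> y = \<epsilon> (j \<oplus> f [^] n \<otimes> r)"
    using full yY unfolding full_def by blast
  \<comment> \<open>\<open>Suc m\<close> exceeds \<open>n0\<close>, and
    \<open>f^(m+1) y = f^n0 f^(k+1) y = f^m\<close>: one power of \<open>f\<close> less than in the
    factor of \<open>r\<close>.\<close>
  define m where "m = n0 + k"
  obtain j r where jr: "j \<in> J" "r \<in> carrier R" "f [^] Suc m \<odot>\<^bsub>C 0\<^esub> y = \<epsilon> (j \<oplus> f [^] Suc m \<otimes> r)"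
    using n0[of "Suc m"] unfolding m_def by auto
  have jc: "j \<in> carrier R" using jr J.Icarr by blast
  have "f [^] Suc m \<odot>\<^bsub>C 0\<^esub> y = f [^] n0 \<odot>\<^bsub>C 0\<^esub> (f [^] Suc k \<odot>\<^bsub>C 0\<^esub> y)"
    using fc y
      by (simp only: C.smult_assoc1[symmetric] R.nat_pow_closed R.nat_pow_mult m_def add_Suc_right)
  also have "\<dots> = \<epsilon> (f [^] m)"
    unfolding k' using \<epsilon>D(3)[of "f [^] n0" "f [^] k"] fc by (simp add: m_def R.nat_pow_mult)
  finally have "\<epsilon> (f [^] m) = \<epsilon> (j \<oplus> f [^] Suc m \<otimes> r)" using jr(3) by simp
  then have "f [^] m = j \<oplus> f [^] Suc m \<otimes> r" using jc jr fc by (intro \<epsilon>_eqD) auto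
  also have "\<dots> = j \<oplus> f [^] m \<otimes> (f \<otimes> r)" using fc jr by (simp add: m_assoc)
  finally have fm: "f [^] m = j \<oplus> f [^] m \<otimes> (f \<otimes> r)" .
  obtain d where d: "f [^] m \<in> G d" using homogeneous_pow[OF f(1)]
    unfolding homogeneous_elements_def by blast
  have frc: "f \<otimes> r \<in> carrier R" using fc jr by simp
  have "f [^] m = rc (f [^] m) d" using rc_homog[OF d] by simp
  also have "\<dots> = rc j d \<oplus> f [^] m \<otimes> rc (f \<otimes> r) 0"
    using arg_cong[OF fm, of "\<lambda>x. rc x d"] rc_add[OF jc, of "f [^] m \<otimes> (f \<otimes> r)" d] rc_mult[OF frc d, of d] frc fc by simp
  also have "rc (f \<otimes> r) 0 = \<zero>" by (rule rc_mm_zero[OF mm.I_r_closed[OF fmm jr(2)]])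
  finally have "f [^] m = rc j d" using rc_carrier[OF jc] fc by simp
  then show ?thesis using homogeneous_ideal_component[OF J jr(1)] by metis
qed

text \<open>A unit kills no nonzero element, so all torsion vanishes; then \<open>H = 0\<close> and
  \<open>Y\<close> is the image of \<open>R\<close>.\<close>

lemma full_if_unit:
  assumes f: "f \<in> Units R" "radical R I = radical R (Idl {f})" shows "full J"
  unfolding full_def
proof
  fix y assume y: "y \<in> Y"
  have fc: "f \<in> carrier R" using f by blast
  have y': "y \<in> carrier (C 0)" "\<delta> 0 y \<in> \<Gamma> (Suc 0)" using y unfolding Y_def by auto
  then obtain n :: nat where n: "f [^] n \<odot>\<^bsub>C (Suc 0)\<^esub> \<delta> 0 y = \<zero>\<^bsub>C (Suc 0)\<^esub>"
    unfolding \<Gamma>_if_radical_eq[OF fc f(2)] by blast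
  have u: "f [^] n \<in> Units R" by (induction n) (use f(1) in auto)
  have "\<delta> 0 y = inv (f [^] n) \<odot>\<^bsub>C (Suc 0)\<^esub> (f [^] n \<odot>\<^bsub>C (Suc 0)\<^esub> \<delta> 0 y)"
    using C.smult_assoc1[OF Units_inv_closed[OF u] Units_closed[OF u], of "\<delta> 0 y" "Suc 0"] u y'(1)
      by simp
  then have "\<delta> 0 y = \<zero>\<^bsub>C (Suc 0)\<^esub>" unfolding n using u by simp
  then show "y \<in> N J" using \<epsilon>E[OF y'(1)] N_intros(2) by metis
qed

text \<open>The \<open>LEAST\<close> is attained because \<open>I\<close> has finitely many
  homogeneous generators. The empty list is traded for the single generator 0.\<close>

lemma homogeneous_ara_le_1_iff:
  "homogeneous_ara R G I \<le> 1 \<longleftrightarrow> (\<exists>f\<in>homogeneous_elements G. radical R I = radical R (Idl {f}))"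
proof -
  let ?P = "\<lambda>s. \<exists>rs. length rs = s \<and> set rs \<subseteq> homogeneous_elements G \<and> radical R I = radical R (Idl (set rs))"
  have ex: "\<exists>s. ?P s" using I_generators by blast
  show ?thesis
  proof
    assume le: "homogeneous_ara R G I \<le> 1"
    have "?P (homogeneous_ara R G I)" unfolding homogeneous_ara_def by (rule LeastI_ex[OF ex])
    then obtain rs
      where rs: "length rs \<le> 1" "set rs \<subseteq> homogeneous_elements G" "radical R I = radical R (Idl (set rs))"
      using le by metis
    show "\<exists>f\<in>homogeneous_elements G. radical R I = radical R (Idl {f})"
    proof (cases rs)
      case Nil
      have "\<zero> \<in> homogeneous_elements G" using reg.GM_zero unfolding homogeneous_elements_def by auto
      then show ?thesis using rs(3) genideal_empty unfolding Nil by auto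
    next
      case (Cons f fs)
      then show ?thesis using rs by auto
    qed
  next
    assume "\<exists>f\<in>homogeneous_elements G. radical R I = radical R (Idl {f})"
    then obtain f where "f \<in> homogeneous_elements G" "radical R I = radical R (Idl {f})" by blast
    then have "?P 1" by (intro exI[of _ "[f]"]) simp
    then show "homogeneous_ara R G I \<le> 1" unfolding homogeneous_ara_def by (rule Least_le)
  qed
qed

theorem homogeneous_ara_iff_prime_avoidance:
  assumes van: "\<And>i. i \<ge> 2 \<Longrightarrow>
      carrier (local_cohomology R I C \<delta> i) = {\<zero>\<^bsub>local_cohomology R I C \<delta> i\<^esub>}"
  shows "homogeneous_ara R G I \<le> 1 \<longleftrightarrow> homogeneous_prime_avoidance R G (Ass R dual)"
  unfolding homogeneous_ara_le_1_iff
proof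
  have principal: "Idl {r} \<subseteq> p" if "p \<in> Ass R dual" "r \<in> p" for r p
    using that genideal_minimal[of p "{r}"] primeideal.axioms(1) unfolding Ass_def by blast
  {
    assume "\<exists>f\<in>homogeneous_elements G. radical R I = radical R (Idl {f})"
    then obtain f where f: "f \<in> homogeneous_elements G" "radical R I = radical R (Idl {f})" by blast
    have fc: "f \<in> carrier R" using f homogeneous_carrier by blast
    show "homogeneous_prime_avoidance R G (Ass R dual)"
      unfolding homogeneous_prime_avoidance_def
    proof (intro allI impI)
      fix J assume J: "homogeneous_ideal R G J"
        and sub: "J \<inter> homogeneous_elements G \<subseteq> \<Union> (Ass R dual)"
      have "\<not> full J"
      proof
        assume full: "full J"
        show False
        proof (cases "f \<in> mm")
          case True
          obtain n :: nat where "f [^] n \<in> J" using pow_in_if_full[OF f True J full] by blast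
          \<comment> \<open>The covering hypothesis applies to the homogeneous element
            \<open>f^n\<close> of \<open>J\<close>, but \<open>f H = H\<close> keeps
            \<open>f\<close> out of all associated primes.\<close>
          then obtain p where p: "p \<in> Ass R dual" "f [^] n \<in> p" using sub homogeneous_pow[OF f(1)]
            by blast
          then have "f \<in> p" using primeideal_pow[OF _ fc p(2)] unfolding Ass_def by blast
          then show False using not_full_if_Ass[OF principal[OF p(1)] p(1)] full_if_radical_eq[OF f]
            by blast
        next
          case False
          obtain e where e: "f \<in> G e" using f unfolding homogeneous_elements_def by blast
          then have "e = 0" using False degree_nonzero_mm by blast
          moreover have "f \<noteq> \<zero>"
            using False additive_subgroup.zero_closed[OF ideal.axioms(1)[OF mm_ideal]] by blast
          ultimately have u: "f \<in> Units R" using degree_zero_units e by blast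
          \<comment> \<open>In this case \<open>H = 0\<close> and there are no associated primes,
            yet the element 0 of \<open>J\<close> would have to be covered by one.\<close>
          have "\<zero> \<in> J \<inter> homogeneous_elements G"
            using J additive_subgroup.zero_closed[OF ideal.axioms(1)] reg.GM_zero
            unfolding homogeneous_ideal_def homogeneous_elements_def by auto
          then obtain p where p: "p \<in> Ass R dual" "\<zero> \<in> p" using sub by blast
          then show False using not_full_if_Ass[OF principal[OF p] p(1)] full_if_unit[OF u f(2)]
            by blast
        qed
      qed
      then show "\<exists>p\<in>Ass R dual. J \<subseteq> p" by (rule Ass_if_not_full[OF J])
    qed
  }
  assume pa: "homogeneous_prime_avoidance R G (Ass R dual)"
  show "\<exists>f\<in>homogeneous_elements G. radical R I = radical R (Idl {f})"
  proof (cases "I \<subseteq> mm")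
    case True
    obtain fs where fs: "set fs \<subseteq> homogeneous_elements G" "I = Idl (set fs)" using I_generators
      by blast
    have fsc: "set fs \<subseteq> carrier R" using fs homogeneous_carrier by blast
    have fsI: "set fs \<subseteq> I" using genideal_self[OF fsc] fs(2) by simp
    have "full I" unfolding full_def
      using lin_comb_in_N[OF fsI fsc] in_lin_comb[OF van fs] by blast
    \<comment> \<open>A full ideal lies in no associated prime; avoidance turns this into a single
      homogeneous element outside all of them.\<close>
    then have "\<not> I \<inter> homogeneous_elements G \<subseteq> \<Union> (Ass R dual)"
      using pa not_full_if_Ass I_homogeneous unfolding homogeneous_prime_avoidance_def by blast
    then obtain f where f: "f \<in> homogeneous_elements G" "f \<in> I" and nf: "f \<notin> \<Union> (Ass R dual)"
      by blast
    have "full (Idl {f})"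
    proof (rule ccontr)
      assume "\<not> full (Idl {f})"
      then obtain p where "p \<in> Ass R dual" "Idl {f} \<subseteq> p"
        using Ass_if_not_full homogeneous_ideal_genideal[of "{f}"] f by blast
      then show False using nf genideal_self'[of f] f homogeneous_carrier by blast
    qed
    then show ?thesis using radical_eq_if_full[OF van True f] f(1) by blast
  next
    \<comment> \<open>A component of \<open>x\<close> is a unit of degree 0 in \<open>I\<close>, so
      \<open>I = R\<close> and 1 serves as generator.\<close>
    case False
    then obtain x where x: "x \<in> I" "x \<notin> mm" by blast
    have xc: "x \<in> carrier R" using ideal.Icarr[OF I_ideal x(1)] .
    obtain d where d: "rc x d \<notin> mm" using ideal_component_sum[OF mm_ideal xc] x(2) by blast
    have xd: "rc x d \<in> G d" "rc x d \<in> I"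
      using rc_in[OF xc] homogeneous_ideal_component[OF I_homogeneous x(1)] by auto
    have "d = 0" using d xd degree_nonzero_mm by blast
    moreover have "rc x d \<noteq> \<zero>"
      using d additive_subgroup.zero_closed[OF ideal.axioms(1)[OF mm_ideal]] by auto
    ultimately have u: "rc x d \<in> Units R" using degree_zero_units xd by blast
    have "Idl {\<one>} = carrier R" by (rule genideal_one)
    moreover have "I = carrier R"
      using ideal.one_imp_carrier[OF I_ideal] ideal.I_r_closed[OF I_ideal xd(2) Units_inv_closed[OF u]] u by simp
    moreover have "\<one> \<in> homogeneous_elements G" using one_degree unfolding homogeneous_elements_def
      by blast
    ultimately show ?thesis by (intro bexI[of _ \<one>]) auto
  qed
qed

end

section \<open>Hilbert's basis theorem\<close>

text \<open>A monotone subsequence exists; if it decreases, it is eventually constant, hence its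
  tail is increasing.\<close>

lemma incseq_subsequence:
  fixes g :: "nat \<Rightarrow> nat"
  shows "\<exists>h. strict_mono h \<and> incseq (g \<circ> h)"
proof -
  obtain h :: "nat \<Rightarrow> nat" where h: "strict_mono h" "monoseq (g \<circ> h)"
    using seq_monosub[of g] by (auto simp: comp_def)
  show ?thesis
  proof (cases "incseq (g \<circ> h)")
    case False
    then have dec: "decseq (g \<circ> h)" using h(2) by (simp add: monoseq_iff)
    define v where "v = (LEAST v. v \<in> range (g \<circ> h))"
    have "v \<in> range (g \<circ> h)" unfolding v_def by (rule LeastI_ex) blast
    then obtain K where K: "(g \<circ> h) K = v" by auto
    have "(g \<circ> h) k = v" if "k \<ge> K" for k
      using decseqD[OF dec that] K Least_le[of "\<lambda>v. v \<in> range (g \<circ> h)" "(g \<circ> h) k"] unfolding v_def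
        by auto
    then have "incseq (g \<circ> (\<lambda>k. h (k + K)))" by (simp add: incseq_def)
    moreover have "strict_mono (\<lambda>k. h (k + K))" using h(1) by (simp add: strict_mono_def)
    ultimately show ?thesis by blast
  qed (use h in blast)
qed

text \<open>Dickson's lemma: subsequences are extracted one coordinate at a time, and any two terms
  of the last one are comparable.\<close>

lemma dickson:
  fixes f :: "nat \<Rightarrow> 'n::finite \<Rightarrow> nat"
  shows "\<exists>i j. i < j \<and> (\<forall>s. f i s \<le> f j s)"
proof -
  have "\<exists>r :: nat \<Rightarrow> nat. strict_mono r \<and> (\<forall>s\<in>S. incseq (\<lambda>k. f (r k) s))" if "finite S" for S :: "'n set"
    using that
  proof (induction S rule: finite_induct)
    case empty
    show ?case by (intro exI[of _ id]) (simp add: strict_mono_def)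
  next
    case (insert x S)
    then obtain r :: "nat \<Rightarrow> nat" where r: "strict_mono r" "\<forall>s\<in>S. incseq (\<lambda>k. f (r k) s)" by blast
    obtain h where h: "strict_mono h" "incseq ((\<lambda>k. f (r k) x) \<circ> h)" using incseq_subsequence
      by blast
    have "incseq (\<lambda>k. f (r (h k)) s)" if "s \<in> S" for s
      using bspec[OF r(2) that] h(1) by (auto simp: incseq_def strict_mono_less_eq)
    then have "\<forall>s\<in>insert x S. incseq (\<lambda>k. f ((r \<circ> h) k) s)" using h(2) by (simp add: comp_def)
    then show ?case using strict_mono_o[OF r(1) h(1)] by blast
  qed
  from this[OF finite_UNIV] obtain r :: "nat \<Rightarrow> nat"
    where r: "strict_mono r" "\<And>s. incseq (\<lambda>k. f (r k) s)" by auto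
  have "r 0 < r 1" using r(1) by (simp add: strict_mono_def)
  moreover have "f (r 0) s \<le> f (r 1) s" for s using incseqD[OF r(2), of 0 1 s] by simp
  ultimately show ?thesis by blast
qed

text \<open>Lexicographic order on exponents; the enumeration \<open>to_nat\<close> of the finite
  index type orders the variables.\<close>

definition lex_less :: "('n::finite \<Rightarrow>\<^sub>0 nat) \<Rightarrow> ('n \<Rightarrow>\<^sub>0 nat) \<Rightarrow> bool" where
  "lex_less m m' \<longleftrightarrow> (\<exists>i. Poly_Mapping.lookup m i < Poly_Mapping.lookup m' i \<and>
     (\<forall>j. to_nat j < to_nat i \<longrightarrow> Poly_Mapping.lookup m j = Poly_Mapping.lookup m' j))"

lemma lex_less_irrefl: "\<not> lex_less m m" by (simp add: lex_less_def)

lemma lex_less_trans: "lex_less a b \<Longrightarrow> lex_less b c \<Longrightarrow> lex_less a c"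
proof -
  assume "lex_less a b" "lex_less b c"
  then obtain i k where i: "Poly_Mapping.lookup a i < Poly_Mapping.lookup b i"
    "\<And>j. to_nat j < to_nat i \<Longrightarrow> Poly_Mapping.lookup a j = Poly_Mapping.lookup b j"
    and k: "Poly_Mapping.lookup b k < Poly_Mapping.lookup c k"
    "\<And>j. to_nat j < to_nat k \<Longrightarrow> Poly_Mapping.lookup b j = Poly_Mapping.lookup c j"
    unfolding lex_less_def by blast
  consider "to_nat i < to_nat k" | "to_nat k < to_nat i" | "i = k"
    using injD[OF inj_to_nat, of i k] by (metis linorder_neqE_nat)
  then show "lex_less a c"
  proof cases
    case 1
    then show ?thesis unfolding lex_less_def using i k by (intro exI[of _ i]) auto
  next
    case 2
    then show ?thesis unfolding lex_less_def using i k by (intro exI[of _ k]) auto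
  next
    case 3
    then show ?thesis unfolding lex_less_def using i k by (intro exI[of _ k]) auto
  qed
qed

lemma lex_less_total: "m \<noteq> m' \<Longrightarrow> lex_less m m' \<or> lex_less m' m"
proof -
  assume ne: "m \<noteq> m'"
  let ?D = "{i. Poly_Mapping.lookup m i \<noteq> Poly_Mapping.lookup m' i}"
  have "?D \<noteq> {}" using ne poly_mapping_eqI[of m m'] by blast
  then obtain i where i: "i \<in> ?D" "\<And>j. j \<in> ?D \<Longrightarrow> to_nat i \<le> to_nat j"
    using ex_has_least_nat[of "\<lambda>i. i \<in> ?D" _ to_nat] by blast
  then have "Poly_Mapping.lookup m j = Poly_Mapping.lookup m' j" if "to_nat j < to_nat i" for j
    using that by force
  then show ?thesis using i(1) unfolding lex_less_def
    by (metis (mono_tags, lifting) mem_Collect_eq nat_neq_iff)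
qed

lemma lex_less_add: "lex_less m m' \<Longrightarrow> lex_less (u + m) (u + m')"
  unfolding lex_less_def by (auto simp: lookup_add)

lemma not_lex_less_if_le:
  assumes "\<And>i. Poly_Mapping.lookup m i \<le> Poly_Mapping.lookup m' i" shows "\<not> lex_less m' m"
  using assms unfolding lex_less_def by (meson not_less)

text \<open>In a descending chain, Dickson's lemma finds an exponent that is componentwise at most a
  later one, which therefore cannot be lexicographically smaller.\<close>

lemma wf_lex_less: "wf {(a, b :: 'n::finite \<Rightarrow>\<^sub>0 nat). lex_less a b}"
  unfolding wf_iff_no_infinite_down_chain
proof
  assume "\<exists>f. \<forall>i. (f (Suc i), f i :: 'n \<Rightarrow>\<^sub>0 nat) \<in> {(a, b). lex_less a b}"
  then obtain f :: "nat \<Rightarrow> 'n \<Rightarrow>\<^sub>0 nat" where f: "\<And>i. lex_less (f (Suc i)) (f i)" by auto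
  have less: "lex_less (f j) (f i)" if "i < j" for i j
    using that by (induction rule: less_Suc_induct) (use f lex_less_trans in blast)+
  obtain i j where "i < j" "\<And>s. Poly_Mapping.lookup (f i) s \<le> Poly_Mapping.lookup (f j) s"
    using dickson[of "\<lambda>i. Poly_Mapping.lookup (f i)"] by blast
  then show False using less not_lex_less_if_le by blast
qed

definition lead :: "('n::finite, 'k::field) mpoly \<Rightarrow> ('n \<Rightarrow>\<^sub>0 nat)" where
  "lead p = (SOME m. m \<in> Poly_Mapping.keys p \<and> (\<forall>m'\<in>Poly_Mapping.keys p. m' \<noteq> m \<longrightarrow> lex_less m' m))"

lemma lead:
  assumes "p \<noteq> 0"
  shows "lead p \<in> Poly_Mapping.keys p" "m \<in> Poly_Mapping.keys p \<Longrightarrow> m \<noteq> lead p \<Longrightarrow> lex_less m (lead p)"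
proof -
  have "\<exists>m\<in>Poly_Mapping.keys p. \<forall>x\<in>Poly_Mapping.keys p. x \<noteq> m \<longrightarrow> \<not> lex_less m x"
  proof (rule Finite_Set.bex_max_element)
    show "asymp_on (Poly_Mapping.keys p) lex_less" using lex_less_trans lex_less_irrefl
      by (metis asymp_onI)
    show "transp_on (Poly_Mapping.keys p) lex_less" using lex_less_trans by (metis transp_onI)
  qed (use assms in auto)
  then have "\<exists>m. m \<in> Poly_Mapping.keys p \<and> (\<forall>m'\<in>Poly_Mapping.keys p. m' \<noteq> m \<longrightarrow> lex_less m' m)"
    using lex_less_total by blast
  from someI_ex[OF this]
  show "lead p \<in> Poly_Mapping.keys p" "m \<in> Poly_Mapping.keys p \<Longrightarrow> m \<noteq> lead p \<Longrightarrow> lex_less m (lead p)"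
    unfolding lead_def by auto
qed

text \<open>Once the term at \<open>m\<close> is split off, cancellation of exponents shows that
  nothing else in the product lands on \<open>u + m\<close>.\<close>

lemma lookup_single_times:
  fixes p :: "('n, 'k::field) mpoly"
  shows "Poly_Mapping.lookup (Poly_Mapping.single u c * p) (u + m) = c * Poly_Mapping.lookup p m"
proof -
  define p' where "p' = p - Poly_Mapping.single m (Poly_Mapping.lookup p m)"
  have p: "p = Poly_Mapping.single m (Poly_Mapping.lookup p m) + p'" unfolding p'_def by simp
  have "m \<notin> Poly_Mapping.keys p'" unfolding p'_def by (simp add: in_keys_iff lookup_minus)
  then have "u + m \<notin> Poly_Mapping.keys (Poly_Mapping.single u c * p')"
    using keys_mult[of "Poly_Mapping.single u c" p'] by (auto split: if_splits)
  then have "Poly_Mapping.lookup (Poly_Mapping.single u c * p') (u + m) = 0"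
    by (simp add: in_keys_iff)
  then show ?thesis by (subst p) (simp add: distrib_left lookup_add mult_single)
qed

lemma poly_ring_simps [simp]:
  "carrier poly_ring = UNIV" "x \<oplus>\<^bsub>poly_ring\<^esub> y = x + y" "x \<otimes>\<^bsub>poly_ring\<^esub> y = x * y"
  "\<zero>\<^bsub>poly_ring\<^esub> = 0" "\<one>\<^bsub>poly_ring\<^esub> = 1"
  by (simp_all add: poly_ring_def)

lemma cring_poly_ring: "cring (poly_ring :: ('n, 'k::field) mpoly ring)"
proof (rule cringI)
  show "abelian_group (poly_ring :: ('n, 'k) mpoly ring)"
    by (rule abelian_groupI) (auto simp: algebra_simps intro: exI[of _ "- _"])
qed (auto simp: comm_monoid_def monoid_def comm_monoid_axioms_def algebra_simps)

lemma ideal_poly_ring: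
  fixes A :: "('n, 'k::field) mpoly set"
  assumes "ideal A poly_ring"
  shows "0 \<in> A" "x \<in> A \<Longrightarrow> y \<in> A \<Longrightarrow> x + y \<in> A" "x \<in> A \<Longrightarrow> r * x \<in> A" "x \<in> A \<Longrightarrow> y \<in> A \<Longrightarrow> x - y \<in> A"
proof -
  interpret ideal A poly_ring by fact
  show "0 \<in> A" using additive_subgroup.zero_closed[OF is_additive_subgroup] by simp
  show add: "x + y \<in> A" if "x \<in> A" "y \<in> A" for x y
    using additive_subgroup.a_closed[OF is_additive_subgroup that] by simp
  show mult: "r * x \<in> A" if "x \<in> A" for r x using I_l_closed[OF that, of r] by simp
  show "x - y \<in> A" if "x \<in> A" "y \<in> A" using add[OF that(1) mult[OF that(2), of "- 1"]] by simp
qed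

text \<open>Along a strictly increasing chain, \<open>g k\<close> is a new element of
  \<open>A (Suc k)\<close> with minimal leading exponent. By Dickson's lemma an earlier leading term
  divides a later one; cancelling the latter gives a new element with smaller leading
  exponent.\<close>

theorem poly_ring_noetherian:
  fixes \<A> :: "('n::finite, 'k::field) mpoly set set"
  assumes ne: "\<A> \<noteq> {}" and id: "\<And>J. J \<in> \<A> \<Longrightarrow> ideal J poly_ring"
  shows "\<exists>J\<in>\<A>. \<forall>K\<in>\<A>. J \<subseteq> K \<longrightarrow> K = J"
proof (rule ccontr)
  assume "\<not> ?thesis"
  then have step: "\<exists>K. K \<in> \<A> \<and> J \<subset> K" if "J \<in> \<A>" for J using that by blast
  obtain J0 where "J0 \<in> \<A>" using ne by blast
  from dependent_nat_choice[of "\<lambda>_ J. J \<in> \<A>" "\<lambda>_ J K. J \<subset> K"] this step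
  obtain A where A: "\<And>k. A k \<in> \<A>" "\<And>k. A k \<subset> A (Suc k)" by metis
  have mono: "A i \<subseteq> A j" if "i \<le> j" for i j using lift_Suc_mono_le[of A] A(2) that by blast
  have "\<exists>g. g \<in> A (Suc k) - A k \<and> (\<forall>h\<in>A (Suc k) - A k. \<not> lex_less (lead h) (lead g))" for k
  proof -
    have "\<exists>g. g \<in> A (Suc k) - A k" using A(2)[of k] by blast
    then obtain g0 where "g0 \<in> A (Suc k) - A k" by blast
    then obtain g where "g \<in> A (Suc k) - A k"
      "\<And>h. (h, g) \<in> inv_image {(a, b). lex_less a b} lead \<Longrightarrow> h \<notin> A (Suc k) - A k"
      by (rule wfE_min[OF wf_inv_image[OF wf_lex_less, of lead]]) blast
    then show ?thesis by (intro exI[of _ g]) (auto simp: inv_image_def)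
  qed
  then obtain g where g: "\<And>k. g k \<in> A (Suc k)" "\<And>k. g k \<notin> A k"
    and gmin: "\<And>k h. h \<in> A (Suc k) \<Longrightarrow> h \<notin> A k \<Longrightarrow> \<not> lex_less (lead h) (lead (g k))"
    by (metis DiffD1 DiffD2 DiffI)
  note idA = ideal_poly_ring[OF id[OF A(1)]]
  have g0: "g k \<noteq> 0" for k using g(2)[of k] idA(1) by metis
  obtain i j where ij: "i < j"
    and le: "\<And>s. Poly_Mapping.lookup (lead (g i)) s \<le> Poly_Mapping.lookup (lead (g j)) s"
    using dickson[of "\<lambda>i. Poly_Mapping.lookup (lead (g i))"] by blast
  define u where "u = lead (g j) - lead (g i)"
  have u: "u + lead (g i) = lead (g j)"
    unfolding u_def by (rule poly_mapping_eqI) (simp add: lookup_add lookup_minus le)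
  \<comment> \<open>\<open>c\<close> and \<open>u\<close> give the multiple of \<open>g i\<close>
    the leading term of \<open>g j\<close>, so that \<open>h\<close> loses this term.\<close>
  define c
    where "c = Poly_Mapping.lookup (g j) (lead (g j)) / Poly_Mapping.lookup (g i) (lead (g i))"
  define h where "h = g j - Poly_Mapping.single u c * g i"
  \<comment> \<open>As \<open>i < j\<close>, the ideal \<open>A j\<close> already contains
    \<open>g i\<close>; subtracting its multiple leaves \<open>h\<close> new at stage
    \<open>j\<close>.\<close>
  have gi: "Poly_Mapping.single u c * g i \<in> A j"
    using idA(3) g(1)[of i] mono[of "Suc i" j] ij by (meson Suc_leI subsetD)
  have hj: "h \<in> A (Suc j)" unfolding h_def using idA(4)[OF g(1)] gi mono[of j "Suc j"] by auto
  have hnj: "h \<notin> A j"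
  proof
    assume "h \<in> A j"
    then have "h + Poly_Mapping.single u c * g i \<in> A j" using gi idA(2) by blast
    then show False using g(2)[of j] unfolding h_def by simp
  qed
  then have h0: "h \<noteq> 0" using idA(1) by metis
  have "Poly_Mapping.lookup (g i) (lead (g i)) \<noteq> 0" using lead(1)[OF g0] by (simp add: in_keys_iff)
  then have "Poly_Mapping.lookup h (lead (g j)) = 0"
    using lookup_single_times[of u c "g i" "lead (g i)"] unfolding h_def c_def u
      by (simp add: lookup_minus)
  then have ne: "lead h \<noteq> lead (g j)" using lead(1)[OF h0] by (auto simp: in_keys_iff)
  have "lead h \<in> Poly_Mapping.keys (g j) \<or> lead h \<in> Poly_Mapping.keys (Poly_Mapping.single u c * g i)"
    using lead(1)[OF h0] keys_diff[of "g j" "Poly_Mapping.single u c * g i"] unfolding h_def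
      by blast
  then have "lex_less (lead h) (lead (g j))"
  proof
    assume "lead h \<in> Poly_Mapping.keys (g j)"
    then show ?thesis using lead(2)[OF g0] ne by blast
  next
    assume "lead h \<in> Poly_Mapping.keys (Poly_Mapping.single u c * g i)"
    then obtain m where m: "lead h = u + m" "m \<in> Poly_Mapping.keys (g i)"
      using keys_mult[of "Poly_Mapping.single u c" "g i"] by (auto split: if_splits)
    then have "m \<noteq> lead (g i)" using ne u by metis
    then have "lex_less (u + m) (u + lead (g i))" using lead(2)[OF g0 m(2)] lex_less_add by blast
    then show ?thesis using m u by simp
  qed
  then show False using gmin[OF hj hnj] by blast
qed

section \<open>Quotients of multigraded polynomial rings\<close>

lemma monomial_degree_zero: "monomial_degree w 0 = 0"
  by (simp add: monomial_degree_def fun_eq_iff)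

text \<open>All summands are nonnegative, and each variable has positive weight in some component.
  Hence degree 0 consists of the constants.\<close>

lemma monomial_degree_zero_iff:
  assumes "\<And>i. w i \<noteq> (\<lambda>_. 0)" shows "monomial_degree w m = 0 \<longleftrightarrow> m = 0"
proof
  assume d: "monomial_degree w m = 0"
  have "Poly_Mapping.lookup m i = 0" for i
  proof -
    obtain j where j: "w i j \<noteq> 0" using assms[of i] by (auto simp: fun_eq_iff)
    have "(\<Sum>i\<in>UNIV. int (Poly_Mapping.lookup m i * w i j)) = 0"
      using fun_cong[OF d, of j] by (simp add: monomial_degree_def)
    then have "int (Poly_Mapping.lookup m i * w i j) = 0"
      using sum_nonneg_eq_0_iff[of UNIV "\<lambda>i. int (Poly_Mapping.lookup m i * w i j)"] by simp
    then show ?thesis using j by simp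
  qed
  then show "m = 0" by (intro poly_mapping_eqI) simp
qed (simp add: monomial_degree_zero)

lemma add_monomials_zero:
  fixes a b :: "'n \<Rightarrow>\<^sub>0 nat" assumes "0 = a + b" shows "a = 0" "b = 0"
proof -
  have "Poly_Mapping.lookup a i = 0 \<and> Poly_Mapping.lookup b i = 0" for i
    using arg_cong[OF assms, of "\<lambda>m. Poly_Mapping.lookup m i"] by (simp add: lookup_add)
  then show "a = 0" "b = 0" by (auto intro!: poly_mapping_eqI)
qed

text \<open>This is the ideal generated by the variables, in a form in which properness is
  immediate.\<close>

definition no_const :: "('n, 'k::field) mpoly set" where
  "no_const = {p. 0 \<notin> Poly_Mapping.keys p}"

lemma ideal_no_const: "ideal (no_const :: ('n, 'k::field) mpoly set) poly_ring"
proof -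
  interpret P: cring "poly_ring :: ('n, 'k) mpoly ring" by (rule cring_poly_ring)
  have mult: "x * a \<in> no_const" if "a \<in> no_const" for x a :: "('n, 'k) mpoly"
    using that keys_mult[of x a] add_monomials_zero unfolding no_const_def by blast
  show ?thesis
  proof (rule idealI)
    have "0 \<in> (no_const :: ('n, 'k) mpoly set)" by (simp add: no_const_def)
    moreover have "a + b \<in> no_const" if "a \<in> no_const" "b \<in> no_const" for a b :: "('n, 'k) mpoly"
      using that by (simp add: no_const_def in_keys_iff lookup_add)
    moreover have "\<ominus>\<^bsub>poly_ring\<^esub> a \<in> no_const" if "a \<in> no_const" for a :: "('n, 'k) mpoly"
    proof -
      have "\<ominus>\<^bsub>poly_ring\<^esub> a = (- 1) * a" by (rule P.minus_equality) auto
      then show ?thesis using mult[OF that] by metis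
    qed
    ultimately show "subgroup no_const (add_monoid (poly_ring :: ('n, 'k) mpoly ring))"
      using P.add.subgroupI[of no_const] unfolding a_inv_def by auto
  qed (use mult in \<open>auto simp: P.ring_axioms mult.commute\<close>)
qed

text \<open>A homogeneous generator with nonzero constant term has degree 0 and is thus a nonzero
  constant, which a proper ideal excludes.\<close>

lemma homogeneous_ideal_subset_no_const:
  fixes w :: "'n::finite \<Rightarrow> 'l::finite \<Rightarrow> nat" and J :: "('n, 'k::field) mpoly set"
  assumes w: "\<And>i. w i \<noteq> (\<lambda>_. 0)" and J: "homogeneous_ideal poly_ring (poly_grading w) J"
    and proper: "J \<noteq> carrier poly_ring"
  shows "J \<subseteq> no_const"
proof -
  interpret P: cring "poly_ring :: ('n, 'k) mpoly ring" by (rule cring_poly_ring)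
  obtain S where S: "S \<subseteq> homogeneous_elements (poly_grading w)" "J = Idl\<^bsub>poly_ring\<^esub> S"
    and id: "ideal J poly_ring"
    using J unfolding homogeneous_ideal_def by blast
  have "S \<subseteq> no_const"
  proof
    fix s assume s: "s \<in> S"
    show "s \<in> no_const"
    proof (rule ccontr)
      assume "s \<notin> no_const"
      then have 0: "0 \<in> Poly_Mapping.keys s" unfolding no_const_def by simp
      obtain d where d: "\<And>m. m \<in> Poly_Mapping.keys s \<Longrightarrow> monomial_degree w m = d"
        using s S unfolding homogeneous_elements_def poly_grading_def by blast
      have "d = 0" using d[OF 0] monomial_degree_zero[of w] by simp
      then have keys: "Poly_Mapping.keys s = {0}" using d 0 monomial_degree_zero_iff[of w, OF w]
        by blast
      define c where "c = Poly_Mapping.lookup s 0"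
      have c: "c \<noteq> 0" unfolding c_def using 0 by (simp add: in_keys_iff)
      have "s = Poly_Mapping.single 0 c"
      proof (rule poly_mapping_eqI)
        show "Poly_Mapping.lookup s k = Poly_Mapping.lookup (Poly_Mapping.single 0 c) k" for k
        proof (cases "k = 0")
          case False
          then have "k \<notin> Poly_Mapping.keys s" using keys by simp
          then show ?thesis using False by (simp add: in_keys_iff lookup_single)
        qed (simp add: c_def)
      qed
      then have "Poly_Mapping.single 0 (1 / c) * s = 1" using c by (simp add: mult_single)
      moreover have "s \<in> J" using P.genideal_self[of S] s S(2) by auto
      ultimately have "1 \<in> J" using ideal_poly_ring(3)[OF id] by metis
      then show False using ideal.one_imp_carrier[OF id] proper by simp
    qed
  qed
  then show ?thesis unfolding S(2) by (rule P.genideal_minimal[OF ideal_no_const])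
qed

lemma monomial_decomposition: "p = (\<Sum>m\<in>Poly_Mapping.keys p. Poly_Mapping.single m (Poly_Mapping.lookup p m))"
proof (rule poly_mapping_eqI)
  fix k
  show "Poly_Mapping.lookup p k =
      Poly_Mapping.lookup (\<Sum>m\<in>Poly_Mapping.keys p. Poly_Mapping.single m (Poly_Mapping.lookup p m)) k"
    by (cases "k \<in> Poly_Mapping.keys p")
      (auto simp: lookup_sum lookup_single when_def in_keys_iff sum.delta)
qed

text \<open>Every nonconstant monomial is a multiple of a variable.\<close>

lemma no_const_subset:
  fixes A :: "('n::finite, 'k::field) mpoly set"
  assumes A: "ideal A poly_ring" and var: "\<And>i. poly_var i \<in> A"
  shows "no_const \<subseteq> A"
proof
  fix p :: "('n, 'k) mpoly" assume p: "p \<in> no_const"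
  have mon: "Poly_Mapping.single m c \<in> A" if "m \<noteq> 0" for m :: "'n \<Rightarrow>\<^sub>0 nat" and c :: 'k
  proof -
    have "\<exists>i. Poly_Mapping.lookup m i \<noteq> 0" using that poly_mapping_eqI[of m 0] by fastforce
    then obtain i where i: "Poly_Mapping.lookup m i \<noteq> 0" by blast
    define m' where "m' = m - Poly_Mapping.single i 1"
    have "m' + Poly_Mapping.single i 1 = m"
      unfolding m'_def
        by (rule poly_mapping_eqI) (use i in \<open>auto simp: lookup_add lookup_minus lookup_single when_def\<close>)
    then have "Poly_Mapping.single m c = Poly_Mapping.single m' c * poly_var i"
      by (simp add: poly_var_def mult_single)
    then show ?thesis using ideal_poly_ring(3)[OF A var] by metis
  qed
  have "(\<Sum>m\<in>M. Poly_Mapping.single m (Poly_Mapping.lookup p m)) \<in> A" if "finite M" "0 \<notin> M" for M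
    using that
  proof (induction M rule: finite_induct)
    case (insert m M)
    then show ?case using mon[of m] ideal_poly_ring(2)[OF A] by simp
  qed (use ideal_poly_ring(1)[OF A] in simp)
  from this[of "Poly_Mapping.keys p"] show "p \<in> A"
    using p monomial_decomposition[of p] unfolding no_const_def by simp
qed

locale graded_quotient =
  fixes w :: "'n::finite \<Rightarrow> 'l::finite \<Rightarrow> nat" and J :: "('n, 'k::field) mpoly set"
    and R :: "('n, 'k) mpoly set ring" and G :: "('l \<Rightarrow> int) \<Rightarrow> ('n, 'k) mpoly set set"
    and mm :: "('n, 'k) mpoly set set"
  assumes w: "\<And>i. w i \<noteq> (\<lambda>_. 0)"
    and J: "homogeneous_ideal poly_ring (poly_grading w) J" "J \<noteq> carrier poly_ring"
    and R: "R = poly_ring Quot J" and G: "G = quot_grading poly_ring J (poly_grading w)"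
    and mm: "mm = Idl\<^bsub>R\<^esub> (range (\<lambda>i. J +>\<^bsub>poly_ring\<^esub> poly_var i))"
begin

lemma ideal_J: "ideal J poly_ring" using J(1) unfolding homogeneous_ideal_def by blast

sublocale P: cring "poly_ring :: ('n, 'k) mpoly ring" by (rule cring_poly_ring)
sublocale J: ideal J poly_ring by (rule ideal_J)
sublocale RR: cring R unfolding R by (rule J.quotient_is_cring[OF cring_poly_ring])

abbreviation cl where "cl p \<equiv> J +>\<^bsub>poly_ring\<^esub> p"

lemma cl_hom: "cl \<in> ring_hom poly_ring R" unfolding R by (rule J.rcos_ring_hom)

lemma cl_mult: "cl (p * s) = cl p \<otimes>\<^bsub>R\<^esub> cl s" and cl_add: "cl (p + s) = cl p \<oplus>\<^bsub>R\<^esub> cl s"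
  and cl_one: "cl 1 = \<one>\<^bsub>R\<^esub>" and cl_carrier: "cl p \<in> carrier R"
  using ring_hom_mult[OF cl_hom, of p s] ring_hom_add[OF cl_hom, of p s] ring_hom_one[OF cl_hom]
    ring_hom_closed[OF cl_hom, of p] by simp_all

sublocale cl: ring_hom_ring poly_ring R cl
  by (rule ring_hom_ringI2) (use P.ring_axioms RR.ring_axioms cl_hom in auto)

lemma cl_zero: "cl 0 = \<zero>\<^bsub>R\<^esub>" using cl.hom_zero by simp

lemma R_carrier: "carrier R = range cl"
  unfolding R FactRing_def by (auto simp: A_RCOSETS_def')

lemma cl_eqD: assumes "cl p = cl s" shows "p - s \<in> J"
proof -
  have "p \<in> cl p" using ideal_poly_ring(1)[OF ideal_J] unfolding a_r_coset_def' by force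
  then have "p \<in> cl s" unfolding assms .
  then obtain h where "h \<in> J" "p = h + s" unfolding a_r_coset_def' by auto
  then show ?thesis by simp
qed

lemma vimage_ideal: "ideal K R \<Longrightarrow> ideal {p. cl p \<in> K} poly_ring"
  using cl.ideal_vimage[of K] by simp

text \<open>Since \<open>cl\<close> is surjective, an ideal is determined by its preimage, and the
  maximal condition transfers from the polynomial ring.\<close>

lemma quotient_noetherian:
  assumes ne: "\<A> \<noteq> {}" and id: "\<And>K. K \<in> \<A> \<Longrightarrow> ideal K R"
  shows "\<exists>K\<in>\<A>. \<forall>L\<in>\<A>. K \<subseteq> L \<longrightarrow> L = K"
proof -
  have im: "L = cl ` {p. cl p \<in> L}" if "L \<in> \<A>" for L
    using additive_subgroup.a_subset[OF ideal.axioms(1)[OF id[OF that]]] unfolding R_carrier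
      by blast
  have "\<exists>A\<in>(\<lambda>K. {p. cl p \<in> K}) ` \<A>. \<forall>B\<in>(\<lambda>K. {p. cl p \<in> K}) ` \<A>. A \<subseteq> B \<longrightarrow> B = A"
    by (rule poly_ring_noetherian) (use ne id vimage_ideal in auto)
  then obtain A where A: "A \<in> (\<lambda>K. {p. cl p \<in> K}) ` \<A>" "\<forall>B\<in>(\<lambda>K. {p. cl p \<in> K}) ` \<A>. A \<subseteq> B \<longrightarrow> B = A"
    by (elim bexE)
  then obtain K where K: "K \<in> \<A>" "A = {p. cl p \<in> K}" by auto
  have "L = K" if L: "L \<in> \<A>" "K \<subseteq> L" for L
  proof -
    have "{p. cl p \<in> L} = A" using bspec[OF A(2) imageI[OF L(1)]] L(2) K(2) by auto
    then show ?thesis using im[OF L(1)] im[OF K(1)] K(2) by simp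
  qed
  then show ?thesis using K(1) by blast
qed

lemma vars_carrier: "range (\<lambda>i. cl (poly_var i)) \<subseteq> carrier R" using cl_carrier by auto

lemma mm_ideal: "ideal mm R" unfolding mm by (rule RR.genideal_ideal[OF vars_carrier])

lemma one_notin_mm: "\<one>\<^bsub>R\<^esub> \<notin> mm"
proof
  assume one: "\<one>\<^bsub>R\<^esub> \<in> mm"
  have "ideal (cl ` no_const) R" unfolding R
    by (rule P.ring_ideal_imp_quot_ideal[OF ideal_J ideal_no_const])
  moreover have "poly_var i \<in> no_const" for i :: 'n
  proof -
    have "Poly_Mapping.single i (1::nat) \<noteq> 0" by (metis lookup_single_eq lookup_zero one_neq_zero)
    then show ?thesis by (simp add: poly_var_def no_const_def)
  qed
  then have "range (\<lambda>i. cl (poly_var i)) \<subseteq> cl ` no_const" by blast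
  ultimately have "mm \<subseteq> cl ` no_const" unfolding mm by (rule RR.genideal_minimal)
  then obtain p where p: "p \<in> no_const" "cl 1 = cl p" using one cl_one by force
  \<comment> \<open>\<open>J\<close> lies in \<open>no_const\<close>, so neither
    \<open>1 - p\<close> nor \<open>p\<close> has a constant term, but their sum 1 does.\<close>
  have "1 - p \<in> no_const" using cl_eqD[OF p(2)] homogeneous_ideal_subset_no_const[OF w J] by blast
  then have "1 - p + p \<in> no_const" using ideal_poly_ring(2)[OF ideal_no_const _ p(1)] by blast
  then show False by (simp add: no_const_def)
qed

lemma G_cases: assumes "x \<in> G d" obtains p where "p \<in> poly_grading w d" "x = cl p"
  using assms unfolding G quot_grading_def by blast

lemma degree_nonzero_mm: assumes "d \<noteq> 0" shows "G d \<subseteq> mm"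
proof
  fix x assume "x \<in> G d"
  then obtain p where p: "p \<in> poly_grading w d" "x = cl p" by (rule G_cases)
  have "no_const \<subseteq> {p. cl p \<in> mm}"
    by (rule no_const_subset[OF vimage_ideal[OF mm_ideal]])
      (use RR.genideal_self[OF vars_carrier] mm in auto)
  moreover have "p \<in> no_const"
    using p(1) assms monomial_degree_zero[of w] unfolding no_const_def poly_grading_def by auto
  ultimately show "x \<in> mm" using p(2) by blast
qed

lemma degree_zero_units: assumes "x \<in> G 0" shows "x = \<zero>\<^bsub>R\<^esub> \<or> x \<in> Units R"
proof -
  obtain p where p: "p \<in> poly_grading w 0" "x = cl p" using assms by (rule G_cases)
  have keys: "Poly_Mapping.keys p \<subseteq> {0}"
    using p(1) monomial_degree_zero_iff[of w, OF w] by (auto simp: poly_grading_def)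
  define c where "c = Poly_Mapping.lookup p 0"
  have p_eq: "p = Poly_Mapping.single 0 c"
  proof (rule poly_mapping_eqI)
    show "Poly_Mapping.lookup p k = Poly_Mapping.lookup (Poly_Mapping.single 0 c) k" for k
    proof (cases "k = 0")
      case False
      then have "k \<notin> Poly_Mapping.keys p" using keys by blast
      then show ?thesis using False by (simp add: in_keys_iff lookup_single)
    qed (simp add: c_def)
  qed
  show ?thesis
  proof (cases "c = 0")
    case True
    then show ?thesis using p p_eq cl_zero by simp
  next
    case False
    have "cl (Poly_Mapping.single 0 (1 / c)) \<otimes>\<^bsub>R\<^esub> x = \<one>\<^bsub>R\<^esub>" "x \<otimes>\<^bsub>R\<^esub> cl (Poly_Mapping.single 0 (1 / c)) = \<one>\<^bsub>R\<^esub>"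
      unfolding p(2) p_eq cl_mult[symmetric] cl_one[symmetric] using False
        by (simp_all add: mult_single)
    moreover have "x \<in> carrier R" using p(2) cl_carrier by simp
    ultimately show ?thesis using cl_carrier[of "Poly_Mapping.single 0 (1 / c)"] unfolding Units_def
      by auto
  qed
qed

lemma one_degree: "\<one>\<^bsub>R\<^esub> \<in> G 0"
proof -
  have "1 \<in> poly_grading w (0 :: 'l \<Rightarrow> int)"
    using monomial_degree_zero[of w] by (auto simp: poly_grading_def)
  then show ?thesis unfolding G quot_grading_def cl_one[symmetric] by blast
qed

end

theorem theorem2:
  fixes w :: "'n::finite \<Rightarrow> 'l::finite \<Rightarrow> nat"
    and J\<^sub>0 :: "('n, 'k::field) mpoly set"
    and R :: "('n, 'k) mpoly set ring"
    and G :: "('l \<Rightarrow> int) \<Rightarrow> ('n, 'k) mpoly set set"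
    and \<mm> I :: "('n, 'k) mpoly set set"
    and E :: "(('n, 'k) mpoly set, 'e) module"
    and GE :: "('l \<Rightarrow> int) \<Rightarrow> 'e set"
    and C :: "nat \<Rightarrow> (('n, 'k) mpoly set, 'c) module"
    and GC :: "nat \<Rightarrow> ('l \<Rightarrow> int) \<Rightarrow> 'c set"
    and \<delta> :: "nat \<Rightarrow> 'c \<Rightarrow> 'c"
  assumes degrees_nonzero: "\<And>i. w i \<noteq> (\<lambda>_. 0)"
    and J\<^sub>0_homogeneous: "homogeneous_ideal poly_ring (poly_grading w) J\<^sub>0"
    and J\<^sub>0_proper: "J\<^sub>0 \<noteq> carrier poly_ring"
    and R_def: "R = poly_ring Quot J\<^sub>0"
    and G_def: "G = quot_grading poly_ring J\<^sub>0 (poly_grading w)"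
    and \<mm>_def: "\<mm> = Idl\<^bsub>R\<^esub> (range (\<lambda>i. J\<^sub>0 +>\<^bsub>poly_ring\<^esub> poly_var i))"
    and E_hull: "star_injective_hull R G (quot_module (regular_module R) \<mm>)
                   (quot_grading (regular_module R) \<mm> G) E GE"
    and resolution: "star_injective_resolution R G (regular_module R) G C GC \<delta>"
    and I_homogeneous: "homogeneous_ideal R G I"
    and vanishing: "\<And>i. i \<ge> 2 \<Longrightarrow>
                      carrier (local_cohomology R I C \<delta> i) = {\<zero>\<^bsub>local_cohomology R I C \<delta> i\<^esub>}"
  shows "homogeneous_ara R G I \<le> 1 \<longleftrightarrow>
         homogeneous_prime_avoidance R G
           (Ass R (star_Hom R (local_cohomology R I C \<delta> 1)
                     (local_cohomology_grading R I C GC \<delta> 1) E GE))"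
proof -
  interpret Q: graded_quotient w J\<^sub>0 R G \<mm>
    by (rule graded_quotient.intro[OF degrees_nonzero J\<^sub>0_homogeneous J\<^sub>0_proper R_def G_def \<mm>_def])
  note res = resolution[unfolded star_injective_resolution_def]
  interpret L: local_graded_cring R G \<mm>
  proof (intro local_graded_cring.intro noeth_graded_cring.intro graded_cring.intro
      graded_cring_axioms.intro noeth_graded_cring_axioms.intro local_graded_cring_axioms.intro Q.RR.is_cring)
    \<comment> \<open>That the induced components form a grading of \<open>R\<close> is contained in
      the notion of a resolution of the graded module \<open>R\<close>.\<close>
    show "graded_module R G (regular_module R) G" using res by blast
  qed (use Q.one_degree Q.quotient_noetherian Q.mm_ideal Q.one_notin_mm Q.degree_nonzero_mm Q.degree_zero_units in auto)
  obtain \<epsilon> where \<epsilon>: "\<epsilon> \<in> hom_of_degree R (regular_module R) G (C 0) (GC 0) 0"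
    "inj_on \<epsilon> (carrier R)" "\<epsilon> ` carrier R = {x \<in> carrier (C 0). \<delta> 0 x = \<zero>\<^bsub>C 1\<^esub>}"
    using res by auto
  let ?k = "quot_module (regular_module R) \<mm>" and ?Gk = "quot_grading (regular_module R) \<mm> G"
  obtain \<iota> where E_inj: "star_injective R G E GE"
    and \<iota>: "\<iota> \<in> hom_of_degree R ?k ?Gk E GE 0" "inj_on \<iota> (carrier ?k)"
    using E_hull unfolding star_injective_hull_def by blast
  have mmS: "submodule \<mm> R (regular_module R)"
  proof (rule L.reg.submoduleI)
    interpret mm: ideal \<mm> R by (rule Q.mm_ideal)
    show "\<mm> \<subseteq> carrier (regular_module R)" using mm.a_subset by simp
  qed (use additive_subgroup.zero_closed[OF ideal.axioms(1)[OF Q.mm_ideal]]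
      additive_subgroup.a_closed[OF ideal.axioms(1)[OF Q.mm_ideal]]
      additive_subgroup.a_inv_closed[OF ideal.axioms(1)[OF Q.mm_ideal]] ideal.I_l_closed[OF Q.mm_ideal] in auto)
  \<comment> \<open>The class of 1 generates the residue field; its image under
    \<open>\<iota>\<close> becomes \<open>e0\<close>: of degree 0, nonzero by injectivity, and
    killed by \<open>\<mm>\<close>.\<close>
  let ?u = "\<mm> +>\<^bsub>regular_module R\<^esub> \<one>\<^bsub>R\<^esub>"
  have uk: "?u \<in> carrier ?k" by auto
  have E: "module R E" using E_inj unfolding star_injective_def graded_module_def by blast
  note km = L.reg.module_quot_module[OF mmS]
  have \<iota>hom: "\<iota> \<in> mod_hom R ?k E" by (rule hom_of_degreeD(1)[OF \<iota>(1)])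
  have \<iota>0: "\<iota> \<mm> = \<zero>\<^bsub>E\<^esub>" using mod_hom_zero[OF \<iota>hom km E] by simp
  have mmk: "\<mm> \<in> carrier ?k"
    using abelian_monoid.zero_closed[OF abelian_group.axioms(1)[OF module.axioms(2)[OF km]]] by simp
  have e0: "\<iota> ?u \<in> GE 0"
    using hom_of_degreeD(2)[OF \<iota>(1), of ?u 0] Q.one_degree unfolding quot_grading_def by auto
  have e0_ne: "\<iota> ?u \<noteq> \<zero>\<^bsub>E\<^esub>"
  proof
    assume "\<iota> ?u = \<zero>\<^bsub>E\<^esub>"
    then have "?u = \<mm>" using \<iota>0 inj_onD[OF \<iota>(2) _ uk mmk] by metis
    then show False using L.reg.coset_eq_zero_iff[OF mmS, of "\<one>\<^bsub>R\<^esub>"] Q.one_notin_mm by simp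
  qed
  have e0_mm: "r \<odot>\<^bsub>E\<^esub> \<iota> ?u = \<zero>\<^bsub>E\<^esub>" if r: "r \<in> \<mm>" for r
  proof -
    have rc: "r \<in> carrier R" using ideal.Icarr[OF Q.mm_ideal r] .
    have "r \<odot>\<^bsub>E\<^esub> \<iota> ?u = \<iota> (r \<odot>\<^bsub>?k\<^esub> ?u)" using mod_homD(4)[OF \<iota>hom rc uk] by simp
    also have "r \<odot>\<^bsub>?k\<^esub> ?u = \<mm> +>\<^bsub>regular_module R\<^esub> r"
      using L.reg.quot_module_smult[OF mmS rc, of "\<one>\<^bsub>R\<^esub>"] rc by simp
    also have "\<dots> = \<mm>" using L.reg.coset_eq_zero_iff[OF mmS, of r] r rc by simp
    finally show ?thesis using \<iota>0 by simp
  qed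
  interpret S: local_cohomology_setup R G \<mm> E GE "\<iota> ?u" C GC \<delta> \<epsilon> I
  proof (intro local_cohomology_setup.intro local_cohomology_setup_axioms.intro L.local_graded_cring_axioms)
    show "\<delta> i ` carrier (C i) = {x \<in> carrier (C (Suc i)). \<delta> (Suc i) x = \<zero>\<^bsub>C (Suc (Suc i))\<^esub>}" for i
      using res by blast
  qed (use E_inj e0 e0_ne e0_mm res \<epsilon> I_homogeneous in auto)
  show ?thesis using S.homogeneous_ara_iff_prime_avoidance[OF vanishing] by simp
qed

end
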